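(* Let $\Omega=[0,1]$, $T>0$ and $p\in(1,+\infty)$. Let $g,g_n\in L^\infty(\Omega)$ ($n\in\mathbb{N}$), and let $K,K_n:\Omega^2\to\mathbb{R}$ ($n\in\mathbb{N}$) be measurable, symmetric, nonnegative and bounded mappings. Then the problem $(\mathcal P)$ with kernel $K$ and initial datum $g$, and the problem $(\mathcal P_n)$ with kernel $K_n$ and initial datum $g_n$, have unique solutions in $[0,T]$, denoted $u$ and $u_n$ respectively. Moreover the following hold. (i) We have the error estimate $$\|u-u_n\|_{C(0,T;L^p(\Omega))}\le C\left(\|g-g_n\|_{L^p(\Omega)}+\|K-K_n\|_{L^p(\Omega^2)}\right),$$ where the constant $C$ is independent of $n$. (ii) Moreover, if $g_n\to g$ and $K_n\to K$ as $n\to\infty$, almost everywhere on $\Omega$ and $\Omega^2$, respectively, then $$\|u-u_n\|_{C(0,T;L^p(\Omega))}\longrightarrow 0\quad\text{as } n\to\infty.$$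
   Context: For a kernel $K$, the nonlocal $p$-Laplacian is $\boldsymbol{\Delta}_p^{K}(u)(x)=-\int_\Omega K(x,y)|u(y)-u(x)|^{p-2}(u(y)-u(x))\,dy$. Problem $(\mathcal P)$: $u_t(x,t)=-\boldsymbol{\Delta}_p^{K}(u(x,t))$ on $\Omega\times(0,T]$, $u(x,0)=g(x)$ for $x\in\Omega$. Problem $(\mathcal P_n)$: $\partial_t u_n(x,t)=-\boldsymbol{\Delta}_p^{K_n}(u_n(x,t))$ on $\Omega\times(0,T]$, $u_n(x,0)=g_n(x)$ for $x\in\Omega$. A solution in $[0,T]$ is a function in $W^{1,1}(0,T;L^1(\Omega))$ satisfying the initial condition a.e. in $\Omega$ and the evolution equation a.e. in $\Omega\times(0,T)$. Here $\|w\|_{C(0,T;L^p(\Omega))}=\sup_{t\in[0,T]}\|w(\cdot,t)\|_{L^p(\Omega)}$.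
   Formalization: In (ii), g_n and K_n are also assumed bounded uniformly in n (false otherwise: K=K_n=0, g=0, g_n=n on [0,1/n]); a solution must also have K(x,y)|u(y,t)-u(x,t)|^{p-1} integrable on Ω² for a.e. t, as uniqueness can fail for p>3 otherwise. *)

theory Defs
  imports "HOL-Analysis.Analysis"
begin

definition Omega :: "real set" where
  "Omega = {0..1}"

text \<open>The norm of \<open>L\<^sup>p(M)\<close>, for finite \<open>p\<close>, with value \<open>\<infinity>\<close> outside of the space; it only depends on
  the almost-everywhere class of \<open>f\<close>.\<close>

definition Lp_norm :: "real \<Rightarrow> 'a measure \<Rightarrow> ('a \<Rightarrow> real) \<Rightarrow> ennreal" where
  "Lp_norm p M f =
     (let I = (\<integral>\<^sup>+x. ennreal (\<bar>f x\<bar> powr p) \<partial>M)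
      in if I = \<infinity> then \<infinity> else ennreal (enn2real I powr (1 / p)))"

definition Linfty :: "'a measure \<Rightarrow> ('a \<Rightarrow> real) set" where
  "Linfty M = {f \<in> borel_measurable M. \<exists>B. AE x in M. \<bar>f x\<bar> \<le> B}"

definition C_Lp_norm :: "real \<Rightarrow> real \<Rightarrow> (real \<Rightarrow> real \<Rightarrow> real) \<Rightarrow> ennreal" where
  "C_Lp_norm T p w = (SUP t\<in>{0..T}. Lp_norm p (lebesgue_on Omega) (\<lambda>x. w x t))"

definition symmetric_kernel :: "(real \<times> real \<Rightarrow> real) \<Rightarrow> bool" where
  "symmetric_kernel K \<longleftrightarrow>
     K \<in> borel_measurable (lebesgue_on (Omega \<times> Omega)) \<and>
     (\<forall>x\<in>Omega. \<forall>y\<in>Omega. K (x, y) = K (y, x)) \<and>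
     (\<forall>z\<in>Omega \<times> Omega. 0 \<le> K z) \<and>
     bounded (K ` (Omega \<times> Omega))"

text \<open>Since \<open>0 powr a = 0\<close>, the integrand vanishes where \<open>v y = v x\<close>, for \<open>p < 2\<close> too.\<close>

definition p_Laplacian ::
    "real \<Rightarrow> (real \<times> real \<Rightarrow> real) \<Rightarrow> (real \<Rightarrow> real) \<Rightarrow> real \<Rightarrow> real" where
  "p_Laplacian p K v x =
     - (LINT y|lebesgue_on Omega. K (x, y) * \<bar>v y - v x\<bar> powr (p - 2) * (v y - v x))"

text \<open>The integral defining the operator converges absolutely and gives a function in \<open>L\<^sup>1(\<Omega>)\<close>.
  This has to be required explicitly, because a divergent Bochner integral has the value \<open>0\<close>. It
  holds for every bounded \<open>v\<close>, and for every \<open>v \<in> L\<^sup>1(\<Omega>)\<close> if \<open>p \<le> 2\<close>. Convergence of the inner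
  integral for almost every \<open>x\<close> would not be enough for uniqueness: for \<open>p > 3\<close> and some kernels there
  would be nonzero solutions with initial datum \<open>0\<close>.\<close>

definition in_p_Laplacian_domain ::
    "real \<Rightarrow> (real \<times> real \<Rightarrow> real) \<Rightarrow> (real \<Rightarrow> real) \<Rightarrow> bool" where
  "in_p_Laplacian_domain p K v \<longleftrightarrow>
     integrable (lebesgue_on (Omega \<times> Omega))
       (\<lambda>(x, y). K (x, y) * \<bar>v y - v x\<bar> powr (p - 2) * (v y - v x))"

text \<open>The space \<open>C\<^sub>c\<^sup>\<infinity>(0,T)\<close>.\<close>

definition test_function :: "real \<Rightarrow> (real \<Rightarrow> real) \<Rightarrow> bool" where
  "test_function T \<phi> \<longleftrightarrow>
     (\<forall>k t. (deriv ^^ k) \<phi> field_differentiable at t) \<and>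
     (\<exists>a b. 0 < a \<and> b < T \<and> (\<forall>t. t \<notin> {a..b} \<longrightarrow> \<phi> t = 0))"

text \<open>A function \<open>t \<mapsto> u(\<cdot>,t)\<close> with values in \<open>L\<^sup>1(\<Omega>)\<close> is represented by a function of \<open>x\<close> and \<open>t\<close>,
  and \<open>L\<^sup>1(0,T; L\<^sup>1(\<Omega>))\<close> is identified with \<open>L\<^sup>1(\<Omega> \<times> (0,T))\<close>. By Fubini's theorem, the \<open>L\<^sup>1(\<Omega>)\<close>-valued
  integral over \<open>(0,T)\<close> is computed for almost every \<open>x\<close>; so the last clause is the equation
  \<open>\<integral> u(t) \<phi>'(t) dt = - \<integral> u'(t) \<phi>(t) dt\<close> in \<open>L\<^sup>1(\<Omega>)\<close>.\<close>

definition has_weak_time_derivative ::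
    "real \<Rightarrow> (real \<Rightarrow> real \<Rightarrow> real) \<Rightarrow> (real \<Rightarrow> real \<Rightarrow> real) \<Rightarrow> bool" where
  "has_weak_time_derivative T u u' \<longleftrightarrow>
     integrable (lebesgue_on (Omega \<times> {0<..<T})) (\<lambda>(x, t). u x t) \<and>
     integrable (lebesgue_on (Omega \<times> {0<..<T})) (\<lambda>(x, t). u' x t) \<and>
     (\<forall>\<phi>. test_function T \<phi> \<longrightarrow>
        (AE x in lebesgue_on Omega.
           (LINT t|lebesgue_on {0<..<T}. u x t * deriv \<phi> t) =
           - (LINT t|lebesgue_on {0<..<T}. u' x t * \<phi> t)))"

text \<open>An element of \<open>W\<^sup>1\<^sup>,\<^sup>1(0,T; L\<^sup>1(\<Omega>))\<close> has a unique representative in \<open>C([0,T]; L\<^sup>1(\<Omega>))\<close>. Values at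
  single times, as in the initial condition, refer to this representative.\<close>

definition L1_continuous :: "real \<Rightarrow> (real \<Rightarrow> real \<Rightarrow> real) \<Rightarrow> bool" where
  "L1_continuous T u \<longleftrightarrow>
     (\<forall>t\<in>{0..T}. integrable (lebesgue_on Omega) (\<lambda>x. u x t)) \<and>
     (\<forall>t\<in>{0..T}. ((\<lambda>s. LINT x|lebesgue_on Omega. \<bar>u x s - u x t\<bar>) \<longlongrightarrow> 0) (at t within {0..T}))"

definition is_solution ::
    "real \<Rightarrow> real \<Rightarrow> (real \<times> real \<Rightarrow> real) \<Rightarrow> (real \<Rightarrow> real) \<Rightarrow> (real \<Rightarrow> real \<Rightarrow> real) \<Rightarrow> bool" where
  "is_solution T p K g u \<longleftrightarrow>
     L1_continuous T u \<and>
     (AE x in lebesgue_on Omega. u x 0 = g x) \<and>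
     (AE t in lebesgue_on {0<..<T}. in_p_Laplacian_domain p K (\<lambda>x. u x t)) \<and>
     (\<exists>u'. has_weak_time_derivative T u u' \<and>
        (AE (x, t) in lebesgue_on (Omega \<times> {0<..<T}). u' x t = - p_Laplacian p K (\<lambda>y. u y t) x))"

definition has_unique_solution ::
    "real \<Rightarrow> real \<Rightarrow> (real \<times> real \<Rightarrow> real) \<Rightarrow> (real \<Rightarrow> real) \<Rightarrow> bool" where
  "has_unique_solution T p K g \<longleftrightarrow>
     (\<exists>u. is_solution T p K g u \<and>
        (\<forall>w. is_solution T p K g w \<longrightarrow>
           (\<forall>t\<in>{0..T}. AE x in lebesgue_on Omega. w x t = u x t)))"

end

theory Submission
  imports Defs
begin

text \<open>
Write \<open>\<Phi>(s) = \<bar>s\<bar>\<^sup>p\<^sup>-\<^sup>2s\<close>, so that the equation is \<open>u\<^sub>t(x) = \<integral> K(x,y) \<Phi>(u(y) - u(x)) dy\<close>. The right-hand side,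
the net flux into \<open>x\<close>, is dissipative in two ways, and the proof uses both.

\<^emph>\<open>Supremum norm: existence.\<close> Where \<open>u - w\<close> is maximal, \<open>u(y) - u(x) \<le> w(y) - w(x)\<close> for all \<open>y\<close>, and since
\<open>\<Phi>\<close> is nondecreasing, the net flux into \<open>x\<close> is not larger for \<open>u\<close> than for \<open>w\<close>. Hence two functions that
solve the equation up to small errors stay close for all \<open>x\<close> and \<open>t\<close> (\<open>comparison\<close>). Approximate
solutions come from the equation with a delay \<open>h\<close> in the flux, which is solved by finitely many
substitutions. They are Lipschitz in time, uniformly in \<open>h\<close>, so that their error tends to \<open>0\<close> with \<open>h\<close>, and
they converge uniformly (\<open>integral_solution_exists\<close>). All this requires the flux function to be
nondecreasing, bounded and uniformly continuous, with value \<open>0\<close> at \<open>0\<close>. These properties hold for every \<open>p > 1\<close> once \<open>\<Phi>\<close> is truncated at \<open>\<plusminus>2M\<close>,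
where \<open>M\<close> bounds the datum. Comparison with the solution \<open>0\<close> shows that the solution stays in \<open>[-M, M]\<close>, where the
truncation has no effect (\<open>bounded_evolution_exists\<close>).

\<^emph>\<open>Convex integrals: uniqueness and stability.\<close> If \<open>\<beta>\<close> is nondecreasing, then exchanging \<open>x\<close> and \<open>y\<close> shows
that the integral of \<open>\<beta>(u - w)\<close> against the difference of the net fluxes is not positive, because \<open>K\<close> is symmetric
(\<open>dissipation\<close>). So \<open>\<integral> j(u - w)\<close> is nonincreasing for convex \<open>j\<close> with slope \<open>\<beta>\<close>. The choice
\<open>j(s) = \<surd>(1 + s\<^sup>2) - 1\<close>, which has bounded slope, admits unbounded solutions and gives uniqueness
(\<open>evolution_unique\<close>). In particular every solution is bounded by its datum. For two kernels and
\<open>j(s) = \<bar>s\<bar>\<^sup>p/p\<close> there remains the term \<open>\<integral>\<integral> \<bar>u - u\<^sub>n\<bar>\<^sup>p\<^sup>-\<^sup>1 \<bar>K - K\<^sub>n\<bar> \<bar>\<Phi>(u(y) - u(x))\<bar>\<close>. Its last factor is at most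
\<open>(2M)\<^sup>p\<^sup>-\<^sup>1\<close>, with the bound \<open>M\<close> of \<open>g\<close> alone, and Young's inequality splits the rest into \<open>\<bar>K - K\<^sub>n\<bar>\<^sup>p\<close> and a
multiple of \<open>\<bar>u - u\<^sub>n\<bar>\<^sup>p\<close> that is small enough to be absorbed (\<open>evolution_Lp_estimate\<close>). This is the first
estimate, with a constant that depends on \<open>T\<close>, \<open>p\<close> and \<open>M\<close>; the convergence statement follows from it by
dominated convergence.

\<^emph>\<open>Weak derivatives.\<close> These arguments need functions that are primitives in time of their derivative.
Testing with smooth cut-offs of \<open>(0, t)\<close>, whose derivatives concentrate at \<open>0\<close> and at \<open>t\<close>, the continuity in
\<open>L\<^sup>1\<close> identifies the value of a solution at each time \<open>t\<close> (\<open>weak_derivative_primitive\<close>). Since Fubini's theorem is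
used throughout, solutions, data and kernels are first replaced by Borel functions on the whole line, with
value \<open>0\<close> outside of \<open>\<Omega>\<close> (\<open>solution_is_evolution\<close>, \<open>bounded_evolution_is_solution\<close>).
\<close>

section \<open>Integrals over bounded sets\<close>

abbreviation plane :: "(real \<times> real) measure" where
  "plane \<equiv> lborel \<Otimes>\<^sub>M lborel"

abbreviation borel_plane :: "(real \<times> real) measure" where
  "borel_plane \<equiv> borel \<Otimes>\<^sub>M borel"

lemma Omega_sets [measurable, simp]: "Omega \<in> sets borel"
  by (simp add: Omega_def)

lemma integrable_bounded_Omega:
  fixes h :: "real \<Rightarrow> real"
  assumes [measurable]: "h \<in> borel_measurable borel" and "\<And>y. \<bar>h y\<bar> \<le> C * indicator Omega y"
  shows "integrable lborel h" "\<bar>\<integral>y. h y \<partial>lborel\<bar> \<le> C"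
proof -
  have i: "integrable lborel (\<lambda>y. C * indicator Omega y :: real)"
    by (auto intro!: integrable_mult_right integrable_real_indicator simp: Omega_def)
  then show ih: "integrable lborel h"
    by (rule Bochner_Integration.integrable_bound) (use assms(2) in \<open>auto intro: order_trans[OF _ abs_ge_self]\<close>)
  have "\<bar>\<integral>y. h y \<partial>lborel\<bar> \<le> (\<integral>y. \<bar>h y\<bar> \<partial>lborel)"
    by (rule integral_abs_bound)
  also have "\<dots> \<le> (\<integral>y. C * indicator Omega y \<partial>lborel)"
    using assms(2) by (intro integral_mono integrable_abs ih i) auto
  also have "\<dots> = C" by (simp add: Omega_def)
  finally show "\<bar>\<integral>y. h y \<partial>lborel\<bar> \<le> C" .
qed

lemma set_integrable_bounded_interval:
  fixes q :: "real \<Rightarrow> real"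
  assumes [measurable]: "q \<in> borel_measurable borel" and "\<And>r. r \<in> {a..b} \<Longrightarrow> \<bar>q r\<bar> \<le> C"
  shows "set_integrable lborel {a..b} q"
  unfolding set_integrable_def
  by (rule integrableI_bounded_set[where A="{a..b}" and B=C])
     (auto simp: assms emeasure_lborel_Icc_eq)

lemma set_integral_point_trivial [simp]:
  fixes q :: "real \<Rightarrow> real"
  shows "(LINT r:{a}|lborel. q r) = 0"
proof -
  have "AE r in lborel. indicator {a} r *\<^sub>R q r = 0"
    using AE_lborel_singleton[of a] by eventually_elim auto
  then show ?thesis
    unfolding set_lebesgue_integral_def by (rule integral_eq_zero_AE)
qed

lemma set_integral_diff_Ioc:
  fixes q :: "real \<Rightarrow> real"
  assumes q: "set_integrable lborel {0..b} q" and ab: "0 \<le> a" "a \<le> b"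
  shows "(LINT r:{0..b}|lborel. q r) - (LINT r:{0..a}|lborel. q r) = (LINT r:{a<..b}|lborel. q r)"
proof -
  have eq: "{0..b} = {0..a} \<union> {a<..b}" using ab by auto
  have "(LINT r:{0..a} \<union> {a<..b}|lborel. q r) = (LINT r:{0..a}|lborel. q r) + (LINT r:{a<..b}|lborel. q r)"
    by (rule set_integral_Un) (use ab in \<open>auto intro!: set_integrable_subset[OF q]\<close>)
  then show ?thesis by (simp add: eq)
qed

lemma set_integral_Ioc_le:
  fixes q :: "real \<Rightarrow> real"
  assumes q: "set_integrable lborel {a<..b} q" and ab: "a \<le> b" and le: "\<And>r. r \<in> {a<..b} \<Longrightarrow> q r \<le> c"
  shows "(LINT r:{a<..b}|lborel. q r) \<le> c * (b - a)"
proof -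
  have "(LINT r:{a<..b}|lborel. q r) \<le> (LINT r:{a<..b}|lborel. c)"
    by (rule set_integral_mono[OF q _ le])
      (use ab in \<open>auto simp: set_integrable_def intro!: integrable_mult_left integrable_real_indicator\<close>)
  also have "\<dots> = c * (b - a)"
    using ab by (simp add: set_lebesgue_integral_def)
  finally show ?thesis .
qed

lemma increment_bound:
  fixes q :: "real \<Rightarrow> real"
  assumes [measurable]: "q \<in> borel_measurable borel" and q: "\<And>r. r \<in> {0..T} \<Longrightarrow> \<bar>q r\<bar> \<le> C"
    and st: "0 \<le> s" "s \<le> t" "t \<le> T"
  shows "\<bar>(LINT r:{0..t}|lborel. q r) - (LINT r:{0..s}|lborel. q r)\<bar> \<le> C * (t - s)"
proof -
  have 1: "set_integrable lborel {0..t} q"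
    by (rule set_integrable_bounded_interval[where C=C]) (use q st in auto)
  have 2: "set_integrable lborel {s<..t} q"
    by (rule set_integrable_subset[OF 1]) (use st in auto)
  have "(LINT r:{s<..t}|lborel. q r) \<le> C * (t - s)"
    by (rule set_integral_Ioc_le[OF 2]) (use q st in \<open>force simp: abs_le_iff\<close>)+
  moreover have "(LINT r:{s<..t}|lborel. - q r) \<le> C * (t - s)"
    by (rule set_integral_Ioc_le) (use q st 2 in \<open>force simp: abs_le_iff set_integrable_def\<close>)+
  ultimately show ?thesis
    using set_integral_diff_Ioc[OF 1 st(1,2)] set_integral_uminus[OF 2] by (simp add: abs_le_iff)
qed

section \<open>Bounded solutions for a bounded flux function\<close>

text \<open>The function \<open>\<psi>\<close> stands for a truncated flux function, and \<open>net_flux v x\<close> for the right-hand side of the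
  equation at \<open>x\<close>.\<close>

locale bounded_flux =
  fixes k :: "real \<Rightarrow> real \<Rightarrow> real" and \<psi> :: "real \<Rightarrow> real" and B c :: real
  assumes k_meas [measurable]: "case_prod k \<in> borel_measurable borel_plane"
    and k_nonneg: "0 \<le> k x y" and k_le: "k x y \<le> B * indicator Omega y"
    and psi_mono: "mono \<psi>" and psi_bound: "\<bar>\<psi> s\<bar> \<le> c"
    and psi_uc: "uniformly_continuous_on UNIV \<psi>" and psi_0: "\<psi> 0 = 0"
begin

definition net_flux :: "(real \<Rightarrow> real) \<Rightarrow> real \<Rightarrow> real" where
  "net_flux v x = (\<integral>y. k x y * \<psi> (v y - v x) \<partial>lborel)"

lemma psi_cont: "isCont \<psi> s"
  using uniformly_continuous_imp_continuous[OF psi_uc] continuous_on_eq_continuous_at by blast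

lemma psi_meas [measurable]: "\<psi> \<in> borel_measurable borel"
  using uniformly_continuous_imp_continuous[OF psi_uc] borel_measurable_continuous_onI by blast

lemma B_nonneg: "0 \<le> B"
  using k_nonneg[of 0 0] k_le[of 0 0] by (simp add: Omega_def)

lemma c_nonneg: "0 \<le> c"
  using psi_bound[of 0] by simp

lemma integrand_bound: "\<bar>k x y * \<psi> s\<bar> \<le> B * c * indicator Omega y"
proof -
  have "\<bar>k x y * \<psi> s\<bar> \<le> (B * indicator Omega y) * c"
    unfolding abs_mult using k_le[of x y] k_nonneg[of x y] psi_bound[of s] B_nonneg
    by (intro mult_mono) auto
  then show ?thesis by (simp add: mult_ac)
qed

lemma net_flux_integrable:
  assumes [measurable]: "v \<in> borel_measurable borel"
  shows "integrable lborel (\<lambda>y. k x y * \<psi> (v y - v x))"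
  by (rule integrable_bounded_Omega(1)[OF _ integrand_bound]) measurable

lemma net_flux_bound:
  assumes [measurable]: "v \<in> borel_measurable borel"
  shows "\<bar>net_flux v x\<bar> \<le> B * c"
  unfolding net_flux_def by (rule integrable_bounded_Omega(2)[OF _ integrand_bound]) measurable

lemma net_flux_zero: "net_flux (\<lambda>_. 0) x = 0"
  by (simp add: net_flux_def psi_0)

text \<open>Monotonicity in the differences \<open>v y - v x\<close> is the source of the comparison principle.\<close>

lemma net_flux_le:
  assumes [measurable]: "v \<in> borel_measurable borel" "w \<in> borel_measurable borel"
    and e: "0 \<le> e" and le: "\<And>y. \<psi> (v y - v x) \<le> \<psi> (w y - w x) + e"
  shows "net_flux v x \<le> net_flux w x + B * e"
proof -
  have *: "integrable lborel (\<lambda>y. B * e * indicator Omega y :: real)" 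
    "(\<integral>y. B * e * indicator Omega y \<partial>lborel) = B * e"
    by (auto simp: Omega_def intro!: integrable_mult_right integrable_real_indicator)
  have "net_flux v x \<le> (\<integral>y. k x y * \<psi> (w y - w x) + B * e * indicator Omega y \<partial>lborel)"
    unfolding net_flux_def
  proof (intro integral_mono Bochner_Integration.integrable_add net_flux_integrable * assms)
    fix y
    have "k x y * \<psi> (v y - v x) \<le> k x y * (\<psi> (w y - w x) + e)"
      by (intro mult_left_mono le k_nonneg)
    moreover have "k x y * e \<le> B * indicator Omega y * e"
      by (intro mult_right_mono k_le e)
    ultimately show "k x y * \<psi> (v y - v x) \<le> k x y * \<psi> (w y - w x) + B * e * indicator Omega y"
      by (simp add: algebra_simps)
  qed
  also have "\<dots> = net_flux w x + B * e"
    unfolding net_flux_def by (subst Bochner_Integration.integral_add) (use * net_flux_integrable in auto)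
  finally show ?thesis .
qed

lemma net_flux_measurable [measurable]:
  assumes [measurable]: "case_prod u \<in> borel_measurable borel_plane"
  shows "(\<lambda>(x, t). net_flux (\<lambda>y. u y t) x) \<in> borel_measurable borel_plane"
  unfolding net_flux_def by measurable

text \<open>Consider a step from \<open>s\<close> to \<open>s + h\<close>, where \<open>u1 - u2 \<le> m'\<close> at time \<open>s\<close>. Since the supremum of
  \<open>u1 - u2\<close> need not be attained, the points are divided into two classes. If the difference at \<open>x\<close> is below
  \<open>m' - 2Ch\<close>, it cannot pass \<open>m'\<close> within the step. Otherwise the difference at \<open>x\<close> is nearly maximal throughout the
  step: at other points it is larger by at most \<open>6Ch\<close>, so the net flux into \<open>x\<close> is at most slightly larger for \<open>u1\<close>
  than for \<open>u2\<close>. In both cases the bound grows only by the given errors and a multiple of \<open>h\<close> that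
  is small by uniform continuity; refining the steps removes the latter.\<close>

lemma comparison:
  fixes u1 u2 G1 G2 :: "real \<Rightarrow> real \<Rightarrow> real"
  assumes [measurable]: "case_prod u1 \<in> borel_measurable borel_plane"
      "case_prod u2 \<in> borel_measurable borel_plane"
      "\<And>x. G1 x \<in> borel_measurable borel" "\<And>x. G2 x \<in> borel_measurable borel"
    and C: "\<And>x s. s \<in> {0..T} \<Longrightarrow> \<bar>G1 x s\<bar> \<le> C" "\<And>x s. s \<in> {0..T} \<Longrightarrow> \<bar>G2 x s\<bar> \<le> C"
    and u1: "\<And>x t. t \<in> {0..T} \<Longrightarrow> u1 x t = g1 x + (LINT s:{0..t}|lborel. G1 x s)"
    and u2: "\<And>x t. t \<in> {0..T} \<Longrightarrow> u2 x t = g2 x + (LINT s:{0..t}|lborel. G2 x s)"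
    and d1: "\<And>x s. s \<in> {0..T} \<Longrightarrow> \<bar>G1 x s - net_flux (\<lambda>y. u1 y s) x\<bar> \<le> d1"
    and d2: "\<And>x s. s \<in> {0..T} \<Longrightarrow> \<bar>G2 x s - net_flux (\<lambda>y. u2 y s) x\<bar> \<le> d2"
    and m: "\<And>x. g1 x - g2 x \<le> m"
    and t: "t \<in> {0..T}"
  shows "u1 x t - u2 x t \<le> m + t * (d1 + d2)"
proof -
  define z where "z x s = u1 x s - u2 x s" for x s
  have C0: "0 \<le> C" using order_trans[OF abs_ge_zero C(1)[of 0 0]] t by auto
  have int1: "set_integrable lborel {0..b} (G1 x)" "set_integrable lborel {0..b} (G2 x)"
    if "b \<le> T" for b x
    using that C by (auto intro!: set_integrable_bounded_interval[where C=C])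
  have lip: "\<bar>z x b - z x a\<bar> \<le> 2 * C * (b - a)" if "0 \<le> a" "a \<le> b" "b \<le> T" for x a b
    using increment_bound[of "G1 x" T C a b] increment_bound[of "G2 x" T C a b] C that
    unfolding z_def by (simp add: u1 u2 algebra_simps abs_le_iff)
  have main: "z x t \<le> m + t * (d1 + d2 + B * e)" if e: "0 < e" for e x
  proof (cases "t = 0")
    case True
    then show ?thesis using m[of x] u1[of 0 x] u2[of 0 x] t
      by (simp add: z_def)
  next
    case False
    with t have t0: "0 < t" "t \<le> T" by auto
    obtain \<delta> where \<delta>: "0 < \<delta>" "\<And>a b. \<bar>a - b\<bar> < \<delta> \<Longrightarrow> \<bar>\<psi> a - \<psi> b\<bar> < e"
      using psi_uc[unfolded uniformly_continuous_on_def] e by (auto simp: dist_real_def)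
    \<comment> \<open>A step may not exceed \<open>\<delta>/(6C)\<close>, see the bound \<open>6Ch\<close> on differences below.\<close>
    obtain N :: nat where N: "6 * C * t / \<delta> < real N" using reals_Archimedean2 by blast
    have N0: "0 < real N" using N C0 t0 \<delta>(1) by (smt (verit) divide_nonneg_pos mult_nonneg_nonneg)
    define h where "h = t / real N"
    have h: "0 < h" "6 * C * h < \<delta>" using t0 N0 N \<delta>(1) by (auto simp: h_def field_simps)
    have "\<forall>x. z x (real i * h) \<le> m + real i * h * (d1 + d2 + B * e)" if "i \<le> N" for i
      using that
    proof (induction i)
      case 0
      show ?case
        using m u1[of 0] u2[of 0] t by (simp add: z_def)
    next
      case (Suc i)
      define s where "s = real i * h"
      have sh: "real (Suc i) * h = s + h" by (simp add: s_def algebra_simps)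
      have "real (Suc i) * h \<le> real N * h" using Suc.prems h by (intro mult_right_mono) auto
      also have "\<dots> = t" using N0 by (simp add: h_def)
      finally have s: "0 \<le> s" "s + h \<le> T" unfolding sh using t0 h by (auto simp: s_def)
      define m' where "m' = m + s * (d1 + d2 + B * e)"
      have IH: "z y s \<le> m'" for y using Suc by (auto simp: s_def m'_def)
      have d0: "0 \<le> d1" "0 \<le> d2"
        using d1[of 0 0] d2[of 0 0] t by auto
      have "z x (s + h) \<le> m' + h * (d1 + d2 + B * e)" for x
      proof (cases "z x s \<le> m' - 2 * C * h")
        case True
        have "z x (s + h) \<le> m'" using lip[of s "s + h" x] True s h by (auto simp: abs_le_iff)
        moreover have "0 \<le> h * (d1 + d2 + B * e)" using h d0 B_nonneg e by auto
        ultimately show ?thesis by linarith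
      next
        case False
        have G: "G1 x r - G2 x r \<le> d1 + d2 + B * e" if r: "r \<in> {s<..s + h}" for r
        proof -
          have r': "r \<in> {0..T}" "0 \<le> r" "s \<le> r" "r \<le> T" "r - s \<le> h" using r s by auto
          have Chr: "2 * C * (r - s) \<le> 2 * C * h" using r' C0 by (intro mult_left_mono) auto
          have "net_flux (\<lambda>y. u1 y r) x \<le> net_flux (\<lambda>y. u2 y r) x + B * e"
          proof (rule net_flux_le)
            fix y
            have "z y r \<le> m' + 2 * C * h" using lip[of s r y] IH[of y] r' s Chr by (auto simp: abs_le_iff)
            moreover have "z x r \<ge> m' - 4 * C * h" using lip[of s r x] False r' s Chr by (auto simp: abs_le_iff)
            ultimately have "u1 y r - u1 x r \<le> (u2 y r - u2 x r) + 6 * C * h"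
              by (simp add: z_def)
            then have "\<psi> (u1 y r - u1 x r) \<le> \<psi> ((u2 y r - u2 x r) + 6 * C * h)"
              by (rule monoD[OF psi_mono])
            moreover have "0 \<le> 6 * C * h" using C0 h by auto
            ultimately show "\<psi> (u1 y r - u1 x r) \<le> \<psi> (u2 y r - u2 x r) + e"
              using \<delta>(2)[of "(u2 y r - u2 x r) + 6 * C * h" "u2 y r - u2 x r"] h by auto
          qed (use e in auto)
          then show ?thesis using d1[of r x] d2[of r x] r' by (auto simp: abs_le_iff)
        qed
        have i1: "set_integrable lborel {s<..s + h} (G1 x)" "set_integrable lborel {s<..s + h} (G2 x)"
          by (rule set_integrable_subset[OF int1(1)[of "s + h" x]], use s in auto)
             (rule set_integrable_subset[OF int1(2)[of "s + h" x]], use s in auto)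
        have "z x (s + h) - z x s = (LINT r:{s<..s + h}|lborel. G1 x r) - (LINT r:{s<..s + h}|lborel. G2 x r)"
          using set_integral_diff_Ioc[OF int1(1)[of "s + h" x], of s]
            set_integral_diff_Ioc[OF int1(2)[of "s + h" x], of s] s h
          by (simp add: z_def u1 u2)
        also have "\<dots> = (LINT r:{s<..s + h}|lborel. G1 x r - G2 x r)"
          using i1 by (simp add: set_integral_diff)
        also have "\<dots> \<le> (d1 + d2 + B * e) * (s + h - s)"
          by (rule set_integral_Ioc_le) (use i1 h G in \<open>auto intro: set_integral_diff\<close>)
        finally show ?thesis using IH[of x] by (simp add: algebra_simps)
      qed
      then show ?case unfolding sh by (simp add: m'_def algebra_simps)
    qed
    from this[of N] show ?thesis using N0 by (auto simp: h_def)
  qed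
  have "z x t \<le> m + t * (d1 + d2)"
  proof (rule field_le_epsilon)
    fix \<epsilon> :: real assume \<epsilon>: "0 < \<epsilon>"
    define e where "e = \<epsilon> / (t * B + 1)"
    have tB: "0 \<le> t * B" using t B_nonneg by auto
    then have "0 < e" using \<epsilon> by (auto simp: e_def)
    from main[OF this, of x] have "z x t \<le> m + t * (d1 + d2) + (t * B) * e"
      by (simp add: algebra_simps)
    moreover have "(t * B) * e \<le> \<epsilon>"
      using tB \<epsilon> by (auto simp: e_def field_simps)
    ultimately show "z x t \<le> m + t * (d1 + d2) + \<epsilon>" by linarith
  qed
  then show ?thesis by (simp add: z_def)
qed


text \<open>For \<open>t \<le> 0\<close> the domain of integration is a null set. So every image continues the datum \<open>g\<close> to the
  negative times that the delayed argument visits first.\<close>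

definition delay_step :: "real \<Rightarrow> (real \<Rightarrow> real) \<Rightarrow> (real \<Rightarrow> real \<Rightarrow> real) \<Rightarrow> real \<Rightarrow> real \<Rightarrow> real" where
  "delay_step h g v x t = g x + (LINT s:{0..t}|lborel. net_flux (\<lambda>y. v y (s - h)) x)"

definition delay_iterate :: "real \<Rightarrow> (real \<Rightarrow> real) \<Rightarrow> nat \<Rightarrow> real \<Rightarrow> real \<Rightarrow> real" where
  "delay_iterate h g n = (delay_step h g ^^ n) (\<lambda>x t. g x)"

lemma delay_step_measurable:
  assumes [measurable]: "case_prod v \<in> borel_measurable borel_plane" "g \<in> borel_measurable borel"
  shows "case_prod (delay_step h g v) \<in> borel_measurable borel_plane"
proof -
  have eq: "delay_step h g v x t =
      g x + (\<integral>s. (if 0 \<le> s \<and> s \<le> t then 1 else 0) * net_flux (\<lambda>y. v y (s - h)) x \<partial>lborel)" for x t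
    unfolding delay_step_def set_lebesgue_integral_def
    by (auto intro!: Bochner_Integration.integral_cong simp: indicator_def)
  have [measurable]: "(\<lambda>(x, s). net_flux (\<lambda>y. v y (s - h)) x) \<in> borel_measurable borel_plane"
    by (rule net_flux_measurable) measurable
  show ?thesis
    unfolding eq by measurable
qed

lemma delay_iterate_measurable:
  assumes [measurable]: "g \<in> borel_measurable borel"
  shows "case_prod (delay_iterate h g n) \<in> borel_measurable borel_plane"
  by (induction n) (auto simp: delay_iterate_def intro!: delay_step_measurable)

text \<open>The values up to time \<open>(n + 1)h\<close> depend on those up to \<open>nh\<close> only: each iteration settles one more
  interval of length \<open>h\<close>, and finitely many of them solve the delayed equation on \<open>[0, T]\<close>.\<close>

lemma delay_iterate_stable:
  assumes h: "0 < h" and t: "t \<le> real n * h"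
  shows "delay_iterate h g (Suc n) x t = delay_iterate h g n x t"
  using t
proof (induction n arbitrary: x t)
  case 0
  then have "{0..t} = {} \<or> {0..t} = {0}" by auto
  then show ?case by (auto simp: delay_iterate_def delay_step_def set_lebesgue_integral_def[of _ "{}"])
next
  case (Suc n)
  have "delay_iterate h g (Suc n) y (s - h) = delay_iterate h g n y (s - h)" if "s \<in> {0..t}" for s y
    by (rule Suc.IH) (use that Suc.prems in \<open>auto simp: algebra_simps\<close>)
  then have "delay_step h g (delay_iterate h g (Suc n)) x t = delay_step h g (delay_iterate h g n) x t"
    unfolding delay_step_def by (intro arg_cong2[where f="(+)"] set_lebesgue_integral_cong) auto
  then show ?case by (simp add: delay_iterate_def)
qed

text \<open>A solution of the delayed equation has Lipschitz constant \<open>B c\<close> in time, whatever the delay. For a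
  short delay, the delayed and the present differences are therefore so close that the uniform continuity of \<open>\<psi>\<close>
  makes their net fluxes almost equal.\<close>

lemma approximate_solution:
  fixes g :: "real \<Rightarrow> real" and T d :: real
  assumes T: "0 \<le> T" and g [measurable]: "g \<in> borel_measurable borel" and d: "0 < d"
  obtains u G where "case_prod u \<in> borel_measurable borel_plane"
    "\<And>x. G x \<in> borel_measurable borel"
    "\<And>x s. \<bar>G x s\<bar> \<le> B * c"
    "\<And>x t. t \<in> {0..T} \<Longrightarrow> u x t = g x + (LINT s:{0..t}|lborel. G x s)"
    "\<And>x s. s \<in> {0..T} \<Longrightarrow> \<bar>G x s - net_flux (\<lambda>y. u y s) x\<bar> \<le> d"
proof -
  define C where "C = B * c"
  have C0: "0 \<le> C" using B_nonneg c_nonneg by (simp add: C_def)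
  obtain \<delta> where \<delta>: "0 < \<delta>" "\<And>a b. \<bar>a - b\<bar> < \<delta> \<Longrightarrow> \<bar>\<psi> a - \<psi> b\<bar> < d / (B + 1)"
    using psi_uc[unfolded uniformly_continuous_on_def, rule_format, of "d / (B + 1)"] d B_nonneg
    by (auto simp: dist_real_def)
  define h where "h = \<delta> / (2 * C + 1)"
  have h: "0 < h" "2 * C * h < \<delta>"
    using \<delta>(1) C0 by (auto simp: h_def field_simps)
  obtain N :: nat where "T / h < real N" using reals_Archimedean2 by blast
  then have N: "T \<le> real N * h" using h by (simp add: field_simps)
  define u where "u = delay_iterate h g N"
  define G where "G x s = net_flux (\<lambda>y. u y (s - h)) x" for x s
  have u [measurable]: "case_prod u \<in> borel_measurable borel_plane"
    unfolding u_def by (rule delay_iterate_measurable) measurable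
  have "(\<lambda>(x, s). net_flux (\<lambda>y. u y (s - h)) x) \<in> borel_measurable borel_plane"
    by (rule net_flux_measurable) measurable
  then have G [measurable]: "G x \<in> borel_measurable borel" for x
    unfolding G_def by measurable
  have GC: "\<bar>G x s\<bar> \<le> C" for x s
    unfolding G_def C_def by (rule net_flux_bound) measurable
  have u_eq: "u x t = g x + (LINT s:{0..t}|lborel. G x s)" if "t \<le> T" for x t
  proof -
    have "u x t = delay_iterate h g (Suc N) x t"
      unfolding u_def by (rule delay_iterate_stable[symmetric]) (use that N h in auto)
    then show ?thesis by (simp add: delay_iterate_def u_def delay_step_def G_def)
  qed
  have near: "\<bar>u x (s - h) - u x s\<bar> \<le> C * h" if s: "s \<in> {0..T}" for x s
  proof -
    \<comment> \<open>Before time \<open>h\<close>, the delayed argument is the datum, which is the value at time \<open>0\<close>.\<close>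
    have "u x (s - h) = u x (max 0 (s - h))"
    proof (cases "s < h")
      case True
      then show ?thesis using T u_eq[of "s - h" x] u_eq[of 0 x] s h by (simp add: max_def set_lebesgue_integral_def[of _ "{}"])
    qed (simp add: max_def)
    moreover have "\<bar>u x s - u x (max 0 (s - h))\<bar> \<le> C * (s - max 0 (s - h))"
      using increment_bound[of "G x" T C "max 0 (s - h)" s] GC s h u_eq[of s x] u_eq[of "max 0 (s - h)" x] by auto
    moreover have "C * (s - max 0 (s - h)) \<le> C * h" using C0 h by (intro mult_left_mono) auto
    ultimately show ?thesis by (simp add: abs_minus_commute)
  qed
  have close: "net_flux (\<lambda>y. u y s1) x \<le> net_flux (\<lambda>y. u y s2) x + d"
    if "\<And>y. \<bar>u y s1 - u y s2\<bar> \<le> C * h" for s1 s2 x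
  proof -
    have "net_flux (\<lambda>y. u y s1) x \<le> net_flux (\<lambda>y. u y s2) x + B * (d / (B + 1))"
    proof (rule net_flux_le)
      fix y
      have "\<bar>(u y s1 - u x s1) - (u y s2 - u x s2)\<bar> < \<delta>"
        using that[of x] that[of y] h by linarith
      from \<delta>(2)[OF this] show "\<psi> (u y s1 - u x s1) \<le> \<psi> (u y s2 - u x s2) + d / (B + 1)" by linarith
    qed (use d B_nonneg in auto)
    also have "B * (d / (B + 1)) \<le> d" using d B_nonneg by (simp add: field_simps)
    finally show ?thesis by simp
  qed
  have err: "\<bar>G x s - net_flux (\<lambda>y. u y s) x\<bar> \<le> d" if "s \<in> {0..T}" for x s
    using close[of "s - h" s x] close[of s "s - h" x] near[OF that] unfolding G_def
    by (auto simp: abs_minus_commute abs_le_iff)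
  show ?thesis
    by (rule that[OF u G]) (use GC[unfolded C_def] u_eq err in auto)
qed

lemma net_flux_tendsto:
  assumes [measurable]: "\<And>n. w n \<in> borel_measurable borel" "v \<in> borel_measurable borel"
    and lim: "\<And>y. (\<lambda>n. w n y) \<longlonglongrightarrow> v y"
  shows "(\<lambda>n. net_flux (w n) x) \<longlonglongrightarrow> net_flux v x"
  unfolding net_flux_def
proof (rule integral_dominated_convergence[where w="\<lambda>y. B * c * indicator Omega y"])
  show "integrable lborel (\<lambda>y. B * c * indicator Omega y :: real)"
    by (auto intro!: integrable_mult_right integrable_real_indicator simp: Omega_def)
  show "AE y in lborel. (\<lambda>n. k x y * \<psi> (w n y - w n x)) \<longlonglongrightarrow> k x y * \<psi> (v y - v x)"
    by (intro AE_I2 tendsto_mult tendsto_const isCont_tendsto_compose[OF psi_cont] tendsto_diff lim)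
qed (use integrand_bound in auto)

text \<open>By comparison, approximate solutions with errors \<open>d n\<close> and \<open>d m\<close> differ by at most
  \<open>T (d n + d m)\<close>, uniformly in \<open>x\<close>. The bound on the limit is a comparison with the solution \<open>0\<close>.\<close>

lemma integral_solution_exists:
  fixes g :: "real \<Rightarrow> real" and T M :: real
  assumes T: "0 \<le> T" and g [measurable]: "g \<in> borel_measurable borel" and M: "\<And>x. \<bar>g x\<bar> \<le> M"
  obtains u where "case_prod u \<in> borel_measurable borel_plane"
    "\<And>x t. t \<in> {0..T} \<Longrightarrow> u x t = g x + (LINT s:{0..t}|lborel. net_flux (\<lambda>y. u y s) x)"
    "\<And>x t. t \<in> {0..T} \<Longrightarrow> \<bar>u x t\<bar> \<le> M"
proof -
  define C where "C = B * c"
  have C0: "0 \<le> C" using B_nonneg c_nonneg by (simp add: C_def)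
  define d where "d n = inverse (real (Suc n))" for n
  have d: "0 < d n" "d \<longlonglongrightarrow> 0" for n
    unfolding d_def using LIMSEQ_inverse_real_of_nat by auto
  have "\<forall>n. \<exists>u G. case_prod u \<in> borel_measurable borel_plane \<and>
    (\<forall>x. G x \<in> borel_measurable borel) \<and> (\<forall>x s. \<bar>G x s\<bar> \<le> C) \<and>
    (\<forall>x. \<forall>t\<in>{0..T}. u x t = g x + (LINT s:{0..t}|lborel. G x s)) \<and>
    (\<forall>x. \<forall>s\<in>{0..T}. \<bar>G x s - net_flux (\<lambda>y. u y s) x\<bar> \<le> d n)"
    using approximate_solution[OF T g d(1)] unfolding C_def by metis
  then obtain w G where w [measurable]: "\<And>n. case_prod (w n) \<in> borel_measurable borel_plane"
    and G [measurable]: "\<And>n x. G n x \<in> borel_measurable borel"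
    and GC: "\<And>n x s. \<bar>G n x s\<bar> \<le> C"
    and w_eq: "\<And>n x t. t \<in> {0..T} \<Longrightarrow> w n x t = g x + (LINT s:{0..t}|lborel. G n x s)"
    and G_near: "\<And>n x s. s \<in> {0..T} \<Longrightarrow> \<bar>G n x s - net_flux (\<lambda>y. w n y s) x\<bar> \<le> d n"
    by metis
  have diff: "w n x t - w m x t \<le> T * (d n + d m)" if "t \<in> {0..T}" for n m x t
  proof -
    have "w n x t - w m x t \<le> 0 + t * (d n + d m)"
      by (rule comparison[where ?G1.0="G n" and ?G2.0="G m" and ?g1.0=g and ?g2.0=g and T=T and C=C])
        (use that w_eq G_near GC in auto)
    also have "\<dots> \<le> T * (d n + d m)"
      using that d(1)[of n] d(1)[of m] by (auto intro!: mult_right_mono)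
    finally show ?thesis .
  qed
  have conv: "convergent (\<lambda>n. w n x t)" if "t \<in> {0..T}" for x t
  proof (rule Cauchy_convergent, rule CauchyI)
    fix e :: real assume "0 < e"
    then have "0 < e / (2 * T + 1)" using T by auto
    then have "\<forall>\<^sub>F n in sequentially. d n < e / (2 * T + 1)" using d(2) order_tendstoD by blast
    then obtain N where N: "\<And>n. n \<ge> N \<Longrightarrow> d n < e / (2 * T + 1)" unfolding eventually_sequentially by blast
    show "\<exists>N. \<forall>m\<ge>N. \<forall>n\<ge>N. norm (w m x t - w n x t) < e"
    proof (intro exI[of _ N] allI impI)
      fix m n assume mn: "N \<le> m" "N \<le> n"
      have "T * (d m + d n) \<le> T * (2 * (e / (2 * T + 1)))"
        using N[OF mn(1)] N[OF mn(2)] T by (intro mult_left_mono) auto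
      also have "\<dots> < e" using T \<open>0 < e\<close> by (auto simp: field_simps)
      finally show "norm (w m x t - w n x t) < e"
        using diff[OF that, of m x n] diff[OF that, of n x m] by (auto simp: add.commute abs_less_iff)
    qed
  qed
  define u where "u x t = (if t \<in> {0..T} then lim (\<lambda>n. w n x t) else 0)" for x t
  have lim: "(\<lambda>n. w n x t) \<longlonglongrightarrow> u x t" if "t \<in> {0..T}" for x t
    using conv[OF that] that by (auto simp: u_def convergent_LIMSEQ_iff)
  have um [measurable]: "case_prod u \<in> borel_measurable borel_plane"
  proof (rule borel_measurable_LIMSEQ_real)
    show "(\<lambda>n. case z of (x, t) \<Rightarrow> if t \<in> {0..T} then w n x t else 0) \<longlonglongrightarrow> case_prod u z" for z
      using lim by (cases z) (auto simp: u_def)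
    show "(\<lambda>(x, t). if t \<in> {0..T} then w n x t else 0) \<in> borel_measurable borel_plane" for n
      by measurable
  qed
  have net_flux_lim: "(\<lambda>n. G n x s) \<longlonglongrightarrow> net_flux (\<lambda>y. u y s) x" if s: "s \<in> {0..T}" for x s
  proof -
    have "(\<lambda>n. net_flux (\<lambda>y. w n y s) x) \<longlonglongrightarrow> net_flux (\<lambda>y. u y s) x"
      by (rule net_flux_tendsto) (use lim s in auto)
    moreover have "(\<lambda>n. G n x s - net_flux (\<lambda>y. w n y s) x) \<longlonglongrightarrow> 0"
      by (rule Lim_null_comparison[OF _ d(2)]) (use G_near s in auto)
    ultimately have "(\<lambda>n. net_flux (\<lambda>y. w n y s) x + (G n x s - net_flux (\<lambda>y. w n y s) x)) \<longlonglongrightarrow> net_flux (\<lambda>y. u y s) x + 0"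
      by (rule tendsto_add)
    then show ?thesis by simp
  qed
  have "(\<lambda>(x, s). net_flux (\<lambda>y. u y s) x) \<in> borel_measurable borel_plane"
    by measurable
  then have net_flux_u [measurable]: "(\<lambda>s. net_flux (\<lambda>y. u y s) x) \<in> borel_measurable borel" for x
    by measurable
  have u_eq: "u x t = g x + (LINT s:{0..t}|lborel. net_flux (\<lambda>y. u y s) x)" if t: "t \<in> {0..T}" for x t
  proof (rule LIMSEQ_unique[OF lim[OF t]])
    have "(\<lambda>n. LINT s:{0..t}|lborel. G n x s) \<longlonglongrightarrow> (LINT s:{0..t}|lborel. net_flux (\<lambda>y. u y s) x)"
      unfolding set_lebesgue_integral_def
    proof (rule integral_dominated_convergence[where w="\<lambda>s. C * indicator {0..t} s"])
      show "integrable lborel (\<lambda>s. C * indicator {0..t} s :: real)"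
        by (auto intro!: integrable_mult_right integrable_real_indicator simp: emeasure_lborel_Icc_eq)
      show "AE s in lborel. (\<lambda>n. indicator {0..t} s *\<^sub>R G n x s) \<longlonglongrightarrow> indicator {0..t} s *\<^sub>R net_flux (\<lambda>y. u y s) x"
      proof (intro AE_I2)
        fix s
        show "(\<lambda>n. indicator {0..t} s *\<^sub>R G n x s) \<longlonglongrightarrow> indicator {0..t} s *\<^sub>R net_flux (\<lambda>y. u y s) x"
          using t net_flux_lim[of s x] by (cases "s \<in> {0..t}") auto
      qed
    qed (use GC in \<open>auto simp: indicator_def\<close>)
    then show "(\<lambda>n. w n x t) \<longlonglongrightarrow> g x + (LINT s:{0..t}|lborel. net_flux (\<lambda>y. u y s) x)"
      unfolding w_eq[OF t] by (rule tendsto_add[OF tendsto_const])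
  qed
  have bd: "\<bar>net_flux (\<lambda>y. u y s) x\<bar> \<le> C" for x s
    unfolding C_def by (rule net_flux_bound) measurable
  have "u x t - 0 \<le> M + t * (0 + 0)" if "t \<in> {0..T}" for x t
    by (rule comparison[where ?G1.0="\<lambda>x s. net_flux (\<lambda>y. u y s) x" and ?G2.0="\<lambda>x s. 0" and ?g1.0=g and ?g2.0="\<lambda>_. 0" and T=T and C=C and ?u2.0="\<lambda>x t. 0" and ?u1.0=u])
      (use that u_eq C0 bd net_flux_zero M in \<open>auto simp: abs_le_iff simp flip: u_eq\<close>)
  moreover have "0 - u x t \<le> M + t * (0 + 0)" if "t \<in> {0..T}" for x t
    by (rule comparison[where ?G2.0="\<lambda>x s. net_flux (\<lambda>y. u y s) x" and ?G1.0="\<lambda>x s. 0" and ?g2.0=g and ?g1.0="\<lambda>_. 0" and T=T and C=C and ?u1.0="\<lambda>x t. 0" and ?u2.0=u])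
      (use that u_eq C0 bd net_flux_zero M in \<open>auto simp: abs_le_iff simp flip: u_eq\<close>)
  ultimately have "\<bar>u x t\<bar> \<le> M" if "t \<in> {0..T}" for x t
    using that by (fastforce simp: abs_le_iff)
  with that[OF um] u_eq show ?thesis by blast
qed

end

section \<open>The flux function\<close>

definition flux :: "real \<Rightarrow> real \<Rightarrow> real" where
  "flux p s = \<bar>s\<bar> powr (p - 2) * s"

text \<open>This form has no singular factor at \<open>0\<close>, so that monotonicity and continuity can be read off from
  the positive exponent, also for \<open>p < 2\<close>.\<close>

lemma flux_eq: "flux p s = max 0 s powr (p - 1) - max 0 (- s) powr (p - 1)"
proof -
  have *: "r powr (p - 2) * r = r powr (p - 1)" if "0 < r" for r :: real
    using that powr_mult_base[of r "p - 2"] by (simp add: mult.commute)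
  consider "s = 0" | "0 < s" | "s < 0" by linarith
  then show ?thesis
    by cases (use *[of s] *[of "- s"] in \<open>auto simp: flux_def max_def\<close>)
qed

lemma flux_0 [simp]: "flux p 0 = 0"
  by (simp add: flux_def)

lemma flux_minus: "flux p (- s) = - flux p s"
  by (simp add: flux_def)

lemma abs_flux: "\<bar>flux p s\<bar> = \<bar>s\<bar> powr (p - 1)"
  unfolding flux_eq by (auto simp: max_def)

lemma flux_mono: "1 < p \<Longrightarrow> mono (flux p)"
  unfolding flux_eq
  by (intro monoI diff_mono powr_mono2) auto

lemma continuous_flux: "1 < p \<Longrightarrow> continuous_on S (flux p)"
  unfolding flux_eq by (intro continuous_intros continuous_on_powr') auto

lemma flux_measurable [measurable]: "flux p \<in> borel_measurable borel"
  unfolding flux_def[abs_def] by measurable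

lemma abs_flux_le: "1 < p \<Longrightarrow> \<bar>s\<bar> \<le> L \<Longrightarrow> \<bar>flux p s\<bar> \<le> L powr (p - 1)"
  unfolding abs_flux by (rule powr_mono2) auto

lemma flux_mult_self: "flux p s * s = \<bar>s\<bar> powr p"
  using powr_mult_base[of "\<bar>s\<bar>" "p - 1"] abs_flux[of p s]
  by (cases "0 \<le> s") (auto simp: flux_eq max_def mult.commute split: if_splits)

text \<open>The graph of \<open>\<bar>s\<bar>\<^sup>p/p\<close> lies above its tangents; this is Young's inequality for
  \<open>\<bar>a\<bar> \<bar>b\<bar>\<^sup>p\<^sup>-\<^sup>1\<close>.\<close>

lemma powr_convex_tangent:
  assumes p: "1 < p"
  shows "\<bar>b\<bar> powr p / p - \<bar>a\<bar> powr p / p \<le> flux p b * (b - a)"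
proof -
  have "flux p b * a \<le> \<bar>a\<bar> * \<bar>b\<bar> powr (p - 1)"
    using abs_ge_self[of "flux p b * a"] by (simp add: abs_mult abs_flux mult.commute)
  also have "\<dots> \<le> \<bar>a\<bar> powr p / p + (\<bar>b\<bar> powr (p - 1)) powr (p / (p - 1)) / (p / (p - 1))"
    by (rule Youngs_inequality) (use p in \<open>auto simp: field_simps\<close>)
  also have "(\<bar>b\<bar> powr (p - 1)) powr (p / (p - 1)) / (p / (p - 1)) = \<bar>b\<bar> powr p - \<bar>b\<bar> powr p / p"
  proof -
    have "(p - 1) * (p / (p - 1)) = p" using p by simp
    then have "(\<bar>b\<bar> powr (p - 1)) powr (p / (p - 1)) = \<bar>b\<bar> powr p"
      by (simp only: powr_powr)
    then show ?thesis using p by (simp add: field_simps)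
  qed
  finally show ?thesis using flux_mult_self[of p b] by (simp add: algebra_simps)
qed

text \<open>If \<open>\<kappa> \<le> \<epsilon> a\<close>, the product is at most the first term, and otherwise \<open>a < \<kappa>/\<epsilon>\<close> bounds it by the second.\<close>

lemma powr_young_split:
  fixes a \<kappa> \<epsilon> p :: real
  assumes "1 < p" "0 \<le> a" "0 \<le> \<kappa>" "0 < \<epsilon>"
  shows "a powr (p - 1) * \<kappa> \<le> \<epsilon> * a powr p + \<epsilon> powr (1 - p) * \<kappa> powr p"
proof (cases "\<kappa> \<le> \<epsilon> * a")
  case True
  have "a powr (p - 1) * \<kappa> \<le> a powr (p - 1) * (\<epsilon> * a)"
    by (rule mult_left_mono[OF True]) auto
  also have "\<dots> = \<epsilon> * a powr p"
    using powr_mult_base[of a "p - 1"] assms by (simp add: mult_ac)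
  finally show ?thesis by (simp add: add_increasing2)
next
  case False
  then have "a powr (p - 1) * \<kappa> \<le> (\<kappa> / \<epsilon>) powr (p - 1) * \<kappa>"
    using assms by (intro mult_right_mono powr_mono2) (auto simp: field_simps)
  also have "\<dots> = \<epsilon> powr (1 - p) * \<kappa> powr p"
    using powr_mult_base[of \<kappa> "p - 1"] powr_minus[of \<epsilon> "p - 1"] assms
    by (simp add: powr_divide field_simps)
  finally show ?thesis using assms by (simp add: add_increasing)
qed

section \<open>Energy inequalities\<close>

text \<open>The function \<open>z\<close> is a primitive of an integrable function and need not be differentiable at every time.
  Convexity gives \<open>j(z b) - j(z a) \<le> \<beta>(z b) \<integral> q\<close> on an interval \<open>(a, b]\<close>. On short intervals \<open>\<beta>(z r)\<close> differs from
  \<open>\<beta>(z b)\<close> by less than \<open>e\<close>, so the function \<open>H\<close> of the proof, which allows for an error \<open>e \<integral> \<bar>q\<bar>\<close>, does not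
  increase over any of them; then \<open>e\<close> tends to \<open>0\<close>.\<close>

lemma convex_chain_rule:
  fixes q z \<beta> j :: "real \<Rightarrow> real"
  assumes t: "0 \<le> t" and q: "set_integrable lborel {0..t} q"
    and z: "\<And>s. s \<in> {0..t} \<Longrightarrow> z s = z0 + (LINT r:{0..s}|lborel. q r)"
    and [measurable]: "z \<in> borel_measurable borel"
    and \<beta>: "continuous_on UNIV \<beta>" and tangent: "\<And>a b. j b - j a \<le> \<beta> b * (b - a)"
  shows "j (z t) - j z0 \<le> (LINT r:{0..t}|lborel. \<beta> (z r) * q r)"
proof -
  have \<beta>m [measurable]: "\<beta> \<in> borel_measurable borel"
    using \<beta> by (rule borel_measurable_continuous_onI)
  have sub: "set_integrable lborel {0..s} q" if "s \<le> t" for s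
    by (rule set_integrable_subset[OF q]) (use that in auto)
  have zc: "continuous_on {0..t} z"
  proof -
    have "continuous_on {0..t} (\<lambda>s. z0 + integral {0..s} q)"
      by (intro continuous_intros indefinite_integral_continuous_1 set_borel_integral_eq_integral(1) q)
    then show ?thesis
      by (rule continuous_on_eq) (use z in \<open>auto simp: set_borel_integral_eq_integral(2)[OF sub]\<close>)
  qed
  then have \<beta>zc: "continuous_on {0..t} (\<lambda>s. \<beta> (z s))"
    using continuous_on_compose2[OF \<beta>] by blast
  obtain b where "\<forall>s\<in>{0..t}. \<bar>\<beta> (z s)\<bar> \<le> b"
    using compact_imp_bounded[OF compact_continuous_image[OF \<beta>zc]] by (auto simp: bounded_iff)
  then have b: "\<bar>\<beta> (z s)\<bar> \<le> b" if "s \<in> {0..t}" for s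
    using that by blast
  have \<beta>q: "set_integrable lborel {0..t} (\<lambda>s. \<beta> (z s) * q s)"
    unfolding set_integrable_def
  proof (rule Bochner_Integration.integrable_bound)
    show "integrable lborel (\<lambda>s. b * (indicator {0..t} s *\<^sub>R q s))"
      using q unfolding set_integrable_def by (rule integrable_mult_right)
    have "(\<lambda>s. indicator {0..t} s *\<^sub>R q s) \<in> borel_measurable lborel"
      using q unfolding set_integrable_def by auto
    then have "(\<lambda>s. \<beta> (z s) * (indicator {0..t} s *\<^sub>R q s)) \<in> borel_measurable lborel"
      by measurable
    then show "(\<lambda>s. indicator {0..t} s *\<^sub>R (\<beta> (z s) * q s)) \<in> borel_measurable lborel"
      by (simp add: mult_ac)
    have "\<bar>\<beta> (z s)\<bar> * \<bar>q s\<bar> \<le> \<bar>b\<bar> * \<bar>q s\<bar>" if "s \<in> {0..t}" for s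
      using b[OF that] by (intro mult_right_mono) auto
    then show "AE s in lborel. norm (indicator {0..t} s *\<^sub>R (\<beta> (z s) * q s)) \<le> norm (b * (indicator {0..t} s *\<^sub>R q s))"
      by (auto simp: indicator_def abs_mult)
  qed
  have sub\<beta>: "set_integrable lborel {0..s} (\<lambda>s. \<beta> (z s) * q s)" if "s \<le> t" for s
    by (rule set_integrable_subset[OF \<beta>q]) (use that in auto)
  have suba: "set_integrable lborel {0..s} (\<lambda>s. \<bar>q s\<bar>)" if "s \<le> t" for s
    by (rule set_integrable_abs[OF sub[OF that]])
  have main: "j (z t) - (LINT r:{0..t}|lborel. \<beta> (z r) * q r) - e * (LINT r:{0..t}|lborel. \<bar>q r\<bar>) \<le> j z0"
    if e: "0 < e" for e
  proof -
    define H where "H s = j (z s) - (LINT r:{0..s}|lborel. \<beta> (z r) * q r) - e * (LINT r:{0..s}|lborel. \<bar>q r\<bar>)" for s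
    have "uniformly_continuous_on {0..t} (\<lambda>s. \<beta> (z s))"
      by (rule compact_uniformly_continuous[OF \<beta>zc]) auto
    then obtain \<delta> where \<delta>: "0 < \<delta>"
      "\<And>a b. a \<in> {0..t} \<Longrightarrow> b \<in> {0..t} \<Longrightarrow> \<bar>a - b\<bar> < \<delta> \<Longrightarrow> \<bar>\<beta> (z a) - \<beta> (z b)\<bar> < e"
      unfolding uniformly_continuous_on_def dist_real_def using e by metis
    have step: "H b \<le> H a" if ab: "0 \<le> a" "a \<le> b" "b \<le> t" "b - a < \<delta>" for a b
    proof -
      have ioc: "set_integrable lborel {a<..b} q" "set_integrable lborel {a<..b} (\<lambda>s. \<beta> (z s) * q s)"
        "set_integrable lborel {a<..b} (\<lambda>s. \<bar>q s\<bar>)"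
        using ab by (auto intro: set_integrable_subset[OF q] set_integrable_subset[OF \<beta>q]
            set_integrable_subset[OF suba[of t]])
      have "j (z b) - j (z a) \<le> \<beta> (z b) * (z b - z a)" by (rule tangent)
      also have "z b - z a = (LINT r:{a<..b}|lborel. q r)"
        using set_integral_diff_Ioc[OF sub[of b] ab(1,2)] ab z by auto
      also have "\<beta> (z b) * \<dots> = (LINT r:{a<..b}|lborel. \<beta> (z b) * q r)" by simp
      also have "\<dots> \<le> (LINT r:{a<..b}|lborel. \<beta> (z r) * q r + e * \<bar>q r\<bar>)"
      proof (rule set_integral_mono)
        fix r assume r: "r \<in> {a<..b}"
        have "(\<beta> (z b) - \<beta> (z r)) * q r \<le> \<bar>\<beta> (z b) - \<beta> (z r)\<bar> * \<bar>q r\<bar>"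
          by (metis abs_ge_self abs_mult)
        also have "\<dots> \<le> e * \<bar>q r\<bar>"
          using \<delta>(2)[of b r] r ab by (intro mult_right_mono) auto
        finally show "\<beta> (z b) * q r \<le> \<beta> (z r) * q r + e * \<bar>q r\<bar>" by (simp add: algebra_simps)
      qed (use ioc in auto)
      also have "\<dots> = (LINT r:{a<..b}|lborel. \<beta> (z r) * q r) + e * (LINT r:{a<..b}|lborel. \<bar>q r\<bar>)"
        using ioc by simp
      finally show ?thesis
        using set_integral_diff_Ioc[OF sub\<beta>[of b] ab(1,2)] set_integral_diff_Ioc[OF suba[of b] ab(1,2)] ab
        by (simp add: H_def algebra_simps)
    qed
    have iter: "H s \<le> H 0" if "s \<in> {0..t}" "s \<le> real n * (\<delta> / 2)" for n s
      using that
    proof (induction n arbitrary: s)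
      case 0
      then show ?case by (cases "s = 0") auto
    next
      case (Suc n)
      have "H s \<le> H (max 0 (s - \<delta> / 2))"
        by (rule step) (use Suc.prems \<delta>(1) in auto)
      also have "\<dots> \<le> H 0"
        by (rule Suc.IH) (use Suc.prems \<delta>(1) in \<open>auto simp: algebra_simps max_def\<close>)
      finally show ?case .
    qed
    obtain n :: nat where "t / (\<delta> / 2) < real n" using reals_Archimedean2 by blast
    then have "t \<le> real n * (\<delta> / 2)" using \<delta>(1) by (simp add: field_simps)
    from iter[OF _ this] t have "H t \<le> H 0" by simp
    then show ?thesis using z[of 0] t by (simp add: H_def)
  qed
  define Q where "Q = (LINT r:{0..t}|lborel. \<bar>q r\<bar>)"
  have Q: "0 \<le> Q" unfolding Q_def set_lebesgue_integral_def by (intro integral_nonneg_AE) auto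
  show ?thesis
  proof (rule field_le_epsilon)
    fix \<epsilon> :: real assume \<epsilon>: "0 < \<epsilon>"
    have "0 < \<epsilon> / (Q + 1)" using Q \<epsilon> by auto
    from main[OF this] have "j (z t) - j z0 \<le> (LINT r:{0..t}|lborel. \<beta> (z r) * q r) + \<epsilon> / (Q + 1) * Q"
      by (simp add: Q_def)
    moreover have "\<epsilon> / (Q + 1) * Q \<le> \<epsilon>" using Q \<epsilon> by (simp add: field_simps)
    ultimately show "j (z t) - j z0 \<le> (LINT r:{0..t}|lborel. \<beta> (z r) * q r) + \<epsilon>" by linarith
  qed
qed

lemma integrable_bounded_mult:
  fixes f g :: "'a \<Rightarrow> real"
  assumes "integrable M f" "g \<in> borel_measurable M" "\<And>x. \<bar>g x\<bar> \<le> C"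
  shows "integrable M (\<lambda>x. g x * f x)"
proof (rule Bochner_Integration.integrable_bound)
  show "integrable M (\<lambda>x. C * f x)" using assms(1) by (rule integrable_mult_right)
  show "(\<lambda>x. g x * f x) \<in> borel_measurable M" using assms by measurable
  have "\<bar>g x\<bar> * \<bar>f x\<bar> \<le> \<bar>C\<bar> * \<bar>f x\<bar>" for x
    using assms(3)[of x] by (intro mult_right_mono) auto
  then show "AE x in M. norm (g x * f x) \<le> norm (C * f x)"
    by (simp add: abs_mult)
qed

lemma integrated_chain_rule:
  fixes z q :: "real \<Rightarrow> real \<Rightarrow> real" and \<beta> j z0 :: "real \<Rightarrow> real"
  assumes t: "t \<in> {0..T}"
    and z_meas [measurable]: "case_prod z \<in> borel_measurable borel_plane"
    and q: "integrable plane (case_prod q)"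
    and z0: "integrable lborel z0"
    and z: "AE x in lborel. \<forall>s\<in>{0..T}. z x s = z0 x + (LINT r:{0..s}|lborel. q x r)"
    and \<beta>: "continuous_on UNIV \<beta>" and tangent: "\<And>a b. j b - j a \<le> \<beta> b * (b - a)"
    and jm [measurable]: "j \<in> borel_measurable borel"
    and \<beta>_bd: "\<And>x s. s \<in> {0..T} \<Longrightarrow> \<bar>\<beta> (z x s)\<bar> \<le> b"
    and j_bd: "\<And>x s. s \<in> {0..T} \<Longrightarrow> \<bar>j (z x s)\<bar> \<le> b * \<bar>z x s\<bar>"
  shows "integrable lborel (\<lambda>x. z x t)" "integrable lborel (\<lambda>x. j (z x t))"
    "set_integrable lborel {0..t} (\<lambda>s. \<integral>x. \<beta> (z x s) * q x s \<partial>lborel)"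
    "(\<integral>x. j (z x t) \<partial>lborel) \<le> (\<integral>x. j (z0 x) \<partial>lborel)
      + (LINT s:{0..t}|lborel. (\<integral>x. \<beta> (z x s) * q x s \<partial>lborel))"
proof -
  have [measurable]: "\<beta> \<in> borel_measurable borel"
    using \<beta> by (rule borel_measurable_continuous_onI)
  have zt: "integrable lborel (\<lambda>x. z x s)" if s: "s \<in> {0..T}" for s
  proof -
    have "integrable plane (\<lambda>w. indicator {0..s} (snd w) * case_prod q w)"
      by (rule integrable_bounded_mult[OF q, where C=1]) (auto simp: indicator_def)
    then have "integrable plane (\<lambda>(x, r). indicator {0..s} r * q x r)"
      by (simp add: case_prod_beta')
    from lborel_pair.integrable_fst[OF this]
    have "integrable lborel (\<lambda>x. z0 x + (LINT r:{0..s}|lborel. q x r))"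
      using z0 by (simp add: set_lebesgue_integral_def)
    then show ?thesis
      by (rule integrable_cong_AE_imp) (measurable, use z s in \<open>auto elim!: eventually_mono\<close>)
  qed
  show "integrable lborel (\<lambda>x. z x t)" by (rule zt[OF t])
  have jt: "integrable lborel (\<lambda>x. j (z x s))" if s: "s \<in> {0..T}" for s
  proof (rule Bochner_Integration.integrable_bound)
    show "integrable lborel (\<lambda>x. b * z x s)" using zt[OF s] by (rule integrable_mult_right)
    show "AE x in lborel. norm (j (z x s)) \<le> norm (b * z x s)"
      by (auto simp: abs_mult intro!: AE_I2 order_trans[OF j_bd[OF s]] mult_right_mono)
  qed measurable
  show "integrable lborel (\<lambda>x. j (z x t))" by (rule jt[OF t])
  have F: "integrable plane (\<lambda>(x, s). indicator {0..t} s * (\<beta> (z x s) * q x s))"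
  proof -
    have "integrable plane
        (\<lambda>w. (indicator {0..t} (snd w) * \<beta> (z (fst w) (snd w))) * case_prod q w)"
      by (rule integrable_bounded_mult[OF q, where C="\<bar>b\<bar>"])
        (use t \<beta>_bd in \<open>auto simp: indicator_def intro: order_trans[OF _ abs_ge_self]\<close>)
    then show ?thesis by (simp add: case_prod_beta' mult_ac)
  qed
  show "set_integrable lborel {0..t} (\<lambda>s. \<integral>x. \<beta> (z x s) * q x s \<partial>lborel)"
    using lborel_pair.integrable_snd[OF F] by (simp add: set_integrable_def)
  have ae: "AE x in lborel. j (z x t) \<le> j (z0 x) + (LINT s:{0..t}|lborel. \<beta> (z x s) * q x s)"
    using lborel_pair.AE_integrable_fst[OF q] z
  proof eventually_elim
    case (elim x)
    have "j (z x t) - j (z0 x) \<le> (LINT s:{0..t}|lborel. \<beta> (z x s) * q x s)"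
    proof (rule convex_chain_rule[OF _ _ _ _ \<beta> tangent])
      show "set_integrable lborel {0..t} (q x)"
        using elim(1) unfolding set_integrable_def
        by (auto intro!: integrable_mult_indicator[where 'b=real, simplified])
      show "z x \<in> borel_measurable borel" by measurable
    qed (use t elim(2) in auto)
    then show ?case by simp
  qed
  have z0': "AE x in lborel. z x 0 = z0 x" using z t by (auto elim!: eventually_mono)
  have jz0: "integrable lborel (\<lambda>x. j (z0 x))"
    by (rule integrable_cong_AE_imp[OF jt[of 0]]) (use t z0 z0' in \<open>auto elim!: eventually_mono\<close>)
  have "(\<integral>x. j (z x t) \<partial>lborel) \<le> (\<integral>x. j (z0 x) + (LINT s:{0..t}|lborel. \<beta> (z x s) * q x s) \<partial>lborel)"
    using jz0 lborel_pair.integrable_fst[OF F]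
    by (intro integral_mono_AE jt[OF t] Bochner_Integration.integrable_add ae)
       (auto simp: set_lebesgue_integral_def)
  also have "\<dots> = (\<integral>x. j (z0 x) \<partial>lborel) + (\<integral>x. (LINT s:{0..t}|lborel. \<beta> (z x s) * q x s) \<partial>lborel)"
    using jz0 lborel_pair.integrable_fst[OF F]
    by (intro Bochner_Integration.integral_add) (auto simp: set_lebesgue_integral_def)
  also have "(\<integral>x. (LINT s:{0..t}|lborel. \<beta> (z x s) * q x s) \<partial>lborel)
      = (LINT s:{0..t}|lborel. (\<integral>x. \<beta> (z x s) * q x s \<partial>lborel))"
    using lborel_pair.Fubini_integral[OF F] by (simp add: set_lebesgue_integral_def)
  finally show "(\<integral>x. j (z x t) \<partial>lborel) \<le> (\<integral>x. j (z0 x) \<partial>lborel)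
      + (LINT s:{0..t}|lborel. (\<integral>x. \<beta> (z x s) * q x s \<partial>lborel))" .
qed

lemma weighted_difference:
  fixes h1 h2 :: "real \<Rightarrow> real \<Rightarrow> real" and w :: "real \<Rightarrow> real"
  assumes h1: "integrable plane (case_prod h1)"
    and h2: "integrable plane (case_prod h2)"
    and [measurable]: "w \<in> borel_measurable borel" and b: "\<And>x. \<bar>w x\<bar> \<le> b"
  shows "integrable plane (\<lambda>(x, y). w x * (h1 x y - h2 x y))"
    "integrable lborel (\<lambda>x. w x * ((\<integral>y. h1 x y \<partial>lborel) - (\<integral>y. h2 x y \<partial>lborel)))"
    "(\<integral>x. w x * ((\<integral>y. h1 x y \<partial>lborel) - (\<integral>y. h2 x y \<partial>lborel)) \<partial>lborel)
      = integral\<^sup>L plane (\<lambda>(x, y). w x * (h1 x y - h2 x y))"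
proof -
  let ?G = "\<lambda>x y. w x * (h1 x y - h2 x y)"
  have "integrable plane (\<lambda>z. w (fst z) * (case_prod h1 z - case_prod h2 z))"
    by (rule integrable_bounded_mult[OF Bochner_Integration.integrable_diff[OF h1 h2], where C=b]) (use b in auto)
  then show G: "integrable plane (\<lambda>(x, y). ?G x y)"
    by (simp add: case_prod_beta')
  show I: "integrable lborel (\<lambda>x. w x * ((\<integral>y. h1 x y \<partial>lborel) - (\<integral>y. h2 x y \<partial>lborel)))"
    by (rule integrable_bounded_mult[OF Bochner_Integration.integrable_diff[OF
          lborel_pair.integrable_fst[OF h1] lborel_pair.integrable_fst[OF h2]], where C=b]) (use b in auto)
  have "(\<integral>x. w x * ((\<integral>y. h1 x y \<partial>lborel) - (\<integral>y. h2 x y \<partial>lborel)) \<partial>lborel) = (\<integral>x. (\<integral>y. ?G x y \<partial>lborel) \<partial>lborel)"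
  proof (rule integral_cong_AE)
    show "AE x in lborel. w x * ((\<integral>y. h1 x y \<partial>lborel) - (\<integral>y. h2 x y \<partial>lborel)) = (\<integral>y. ?G x y \<partial>lborel)"
      using lborel_pair.AE_integrable_fst[OF h1] lborel_pair.AE_integrable_fst[OF h2]
      by eventually_elim simp
    show "(\<lambda>x. \<integral>y. ?G x y \<partial>lborel) \<in> borel_measurable lborel"
      using lborel_pair.integrable_fst[OF G] by (rule borel_measurable_integrable)
  qed (use I in auto)
  also have "\<dots> = integral\<^sup>L plane (\<lambda>(x, y). ?G x y)"
    by (rule lborel_pair.integral_fst[OF G])
  finally show "(\<integral>x. w x * ((\<integral>y. h1 x y \<partial>lborel) - (\<integral>y. h2 x y \<partial>lborel)) \<partial>lborel)
      = integral\<^sup>L plane (\<lambda>(x, y). ?G x y)" .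
qed

text \<open>Exchanging \<open>x\<close> and \<open>y\<close> and averaging turns the integrand into half of
  \<open>k x y (\<beta>(z x) - \<beta>(z y)) (\<Phi>(v y - v x) - \<Phi>(w y - w x))\<close> with \<open>z = v - w\<close>. Because \<open>\<beta>\<close> and \<open>\<Phi>\<close> are nondecreasing, the two
  differences have opposite signs, those of \<open>z x - z y\<close> and \<open>z y - z x\<close>.\<close>

lemma dissipation:
  fixes k :: "real \<Rightarrow> real \<Rightarrow> real" and v w \<beta> \<Phi> :: "real \<Rightarrow> real"
  assumes k_nonneg: "\<And>x y. 0 \<le> k x y" and k_sym: "\<And>x y. k x y = k y x"
    and \<Phi>: "mono \<Phi>" "\<And>s. \<Phi> (- s) = - \<Phi> s"
    and v: "integrable plane (\<lambda>(x, y). k x y * \<Phi> (v y - v x))"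
    and w: "integrable plane (\<lambda>(x, y). k x y * \<Phi> (w y - w x))"
    and \<beta>: "mono \<beta>" and [measurable]: "\<beta> \<in> borel_measurable borel"
      "v \<in> borel_measurable borel" "w \<in> borel_measurable borel"
    and b: "\<And>x. \<bar>\<beta> (v x - w x)\<bar> \<le> b"
  shows "(\<integral>x. \<beta> (v x - w x) * ((\<integral>y. k x y * \<Phi> (v y - v x) \<partial>lborel) - (\<integral>y. k x y * \<Phi> (w y - w x) \<partial>lborel)) \<partial>lborel) \<le> 0"
proof -
  define h where "h x y = k x y * \<Phi> (v y - v x) - k x y * \<Phi> (w y - w x)" for x y
  define G where "G x y = \<beta> (v x - w x) * h x y" for x y
  have bm: "(\<lambda>x. \<beta> (v x - w x)) \<in> borel_measurable borel" by measurable
  note G = weighted_difference(1)[OF v w bm b, folded h_def, folded G_def]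
  have "(\<integral>x. \<beta> (v x - w x) * ((\<integral>y. k x y * \<Phi> (v y - v x) \<partial>lborel) - (\<integral>y. k x y * \<Phi> (w y - w x) \<partial>lborel)) \<partial>lborel)
      = integral\<^sup>L plane (case_prod G)"
    using weighted_difference(3)[OF v w bm b] by (simp add: h_def G_def[abs_def])
  also have "\<dots> \<le> 0"
  proof -
    have swap: "integrable plane (\<lambda>(x, y). G y x)"
      "integral\<^sup>L plane (\<lambda>(x, y). G y x) = integral\<^sup>L plane (case_prod G)"
      using lborel_pair.integrable_product_swap[OF G] lborel_pair.integral_product_swap[of "case_prod G"] G
      by auto
    have le: "G x y + G y x \<le> 0" for x y
    proof -
      have anti: "h y x = - h x y"
        using \<Phi>(2)[of "v y - v x"] \<Phi>(2)[of "w y - w x"] by (simp add: h_def k_sym[of y x])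
      have "(\<beta> (v x - w x) - \<beta> (v y - w y)) * (\<Phi> (v y - v x) - \<Phi> (w y - w x)) \<le> 0"
      proof (cases "v x - w x \<le> v y - w y")
        case True
        then have "\<beta> (v x - w x) \<le> \<beta> (v y - w y)" "\<Phi> (w y - w x) \<le> \<Phi> (v y - v x)"
          by (auto intro!: monoD[OF \<beta>] monoD[OF \<Phi>(1)])
        then show ?thesis by (simp add: mult_nonpos_nonneg)
      next
        case False
        then have "\<beta> (v y - w y) \<le> \<beta> (v x - w x)" "\<Phi> (v y - v x) \<le> \<Phi> (w y - w x)"
          by (auto intro!: monoD[OF \<beta>] monoD[OF \<Phi>(1)])
        then show ?thesis by (simp add: mult_nonneg_nonpos)
      qed
      then have "k x y * ((\<beta> (v x - w x) - \<beta> (v y - w y)) * (\<Phi> (v y - v x) - \<Phi> (w y - w x))) \<le> 0"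
        using k_nonneg[of x y] by (simp add: mult_nonneg_nonpos)
      also have "k x y * ((\<beta> (v x - w x) - \<beta> (v y - w y)) * (\<Phi> (v y - v x) - \<Phi> (w y - w x))) = G x y + G y x"
        unfolding G_def anti by (simp add: h_def algebra_simps)
      finally show ?thesis .
    qed
    have "0 \<le> integral\<^sup>L plane (\<lambda>z. - (case_prod G z + (case z of (x, y) \<Rightarrow> G y x)))"
    proof (intro integral_nonneg_AE AE_I2)
      fix z :: "real \<times> real"
      show "0 \<le> - (case_prod G z + (case z of (x, y) \<Rightarrow> G y x))"
        using le[of "fst z" "snd z"] by (simp add: case_prod_beta')
    qed
    then have "integral\<^sup>L plane (\<lambda>z. case_prod G z + (case z of (x, y) \<Rightarrow> G y x)) \<le> 0"
      by (simp only: integral_minus neg_0_le_iff_le)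
    then show ?thesis using Bochner_Integration.integral_add[OF G swap(1)] swap(2) by simp
  qed
  finally show ?thesis .
qed

section \<open>Uniqueness of evolutions\<close>

text \<open>Kernels are continued by \<open>0\<close>, so that integrals can run over the line and the plane.\<close>

definition regular_kernel :: "real \<Rightarrow> (real \<Rightarrow> real \<Rightarrow> real) \<Rightarrow> bool" where
  "regular_kernel B k \<longleftrightarrow> case_prod k \<in> borel_measurable borel_plane \<and>
     (\<forall>x y. 0 \<le> k x y) \<and> (\<forall>x y. k x y \<le> B * (indicator Omega x * indicator Omega y)) \<and>
     (\<forall>x y. k x y = k y x)"

text \<open>Here \<open>v\<close> is a solution with kernel \<open>k\<close> and datum \<open>g\<close>, and \<open>f\<close> is its time derivative. In contrast to a
  solution in the weak sense, \<open>v\<close> is given for each \<open>x\<close> and \<open>t\<close>, and is a primitive of \<open>f\<close>.\<close>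

definition evolution ::
    "real \<Rightarrow> real \<Rightarrow> (real \<Rightarrow> real \<Rightarrow> real) \<Rightarrow> (real \<Rightarrow> real) \<Rightarrow> (real \<Rightarrow> real \<Rightarrow> real) \<Rightarrow> (real \<Rightarrow> real \<Rightarrow> real) \<Rightarrow> bool" where
  "evolution T p k g v f \<longleftrightarrow>
     integrable lborel g \<and> (\<forall>x. x \<notin> Omega \<longrightarrow> g x = 0) \<and>
     case_prod v \<in> borel_measurable borel_plane \<and>
     integrable plane (case_prod f) \<and> (\<forall>x t. x \<notin> Omega \<longrightarrow> f x t = 0) \<and>
     (\<forall>x. \<forall>t\<in>{0..T}. v x t = g x + (LINT s:{0..t}|lborel. f x s)) \<and>
     (AE t in lborel. t \<in> {0<..<T} \<longrightarrow>
        integrable plane (\<lambda>(x, y). k x y * flux p (v y t - v x t)) \<and>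
        (AE x in lborel. f x t = (\<integral>y. k x y * flux p (v y t - v x t) \<partial>lborel)))"

lemma evolutionD:
  assumes "evolution T p k g v f"
  shows "integrable lborel g" "x \<notin> Omega \<Longrightarrow> g x = 0"
    "case_prod v \<in> borel_measurable borel_plane"
    "integrable plane (case_prod f)" "x \<notin> Omega \<Longrightarrow> f x t = 0"
    "t \<in> {0..T} \<Longrightarrow> v x t = g x + (LINT s:{0..t}|lborel. f x s)"
    "AE t in lborel. t \<in> {0<..<T} \<longrightarrow>
       integrable plane (\<lambda>(x, y). k x y * flux p (v y t - v x t)) \<and>
       (AE x in lborel. f x t = (\<integral>y. k x y * flux p (v y t - v x t) \<partial>lborel))"
  using assms by (auto simp: evolution_def)

lemma indicator_Omega_square:
  "integrable plane (\<lambda>(x, y). indicator Omega x * indicator Omega y :: real)"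
proof -
  have "emeasure plane (Omega \<times> Omega) < \<infinity>"
    by (subst lborel.emeasure_pair_measure_Times) (auto simp: Omega_def)
  then have "integrable plane (indicator (Omega \<times> Omega) :: real \<times> real \<Rightarrow> real)"
    by (intro integrable_real_indicator) auto
  then show ?thesis
    by (rule Bochner_Integration.integrable_cong[THEN iffD1, OF refl, rotated]) (auto simp: indicator_def)
qed

lemma integrable_bounded_square:
  fixes h :: "real \<times> real \<Rightarrow> real"
  assumes [measurable]: "h \<in> borel_measurable borel_plane"
    and h: "\<And>x y. \<bar>h (x, y)\<bar> \<le> C * (indicator Omega x * indicator Omega y)"
  shows "integrable plane h"
proof (rule Bochner_Integration.integrable_bound)
  show "integrable plane (\<lambda>z. C * (case z of (x, y) \<Rightarrow> indicator Omega x * indicator Omega y))"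
    by (intro integrable_mult_right indicator_Omega_square)
  show "h \<in> borel_measurable plane"
    by (simp cong: measurable_cong_sets)
  show "AE z in plane. norm (h z) \<le> norm (C * (case z of (x, y) \<Rightarrow> indicator Omega x * indicator Omega y))"
    by (auto intro!: AE_I2 order_trans[OF h] mult_right_mono simp: abs_mult)
qed

text \<open>The hypothesis bounds by \<open>R\<close> the rate at which \<open>\<integral> j(v1 - v2)\<close> can grow at almost every time: the net fluxes
  stand for the time derivatives.\<close>

lemma difference_energy_estimate:
  assumes e1: "evolution T p k1 g1 v1 f1" and e2: "evolution T p k2 g2 v2 f2" and T: "0 < T"
    and \<beta>: "continuous_on UNIV \<beta>" and tangent: "\<And>a b. j b - j a \<le> \<beta> b * (b - a)"
    and jm [measurable]: "j \<in> borel_measurable borel"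
    and \<beta>_bd: "\<And>x s. s \<in> {0..T} \<Longrightarrow> \<bar>\<beta> (v1 x s - v2 x s)\<bar> \<le> b"
    and j_bd: "\<And>x s. s \<in> {0..T} \<Longrightarrow> \<bar>j (v1 x s - v2 x s)\<bar> \<le> b * \<bar>v1 x s - v2 x s\<bar>"
    and t: "t \<in> {0..T}"
    and rate: "AE s in lborel. s \<in> {0<..<T} \<longrightarrow>
       (\<integral>x. \<beta> (v1 x s - v2 x s) * ((\<integral>y. k1 x y * flux p (v1 y s - v1 x s) \<partial>lborel)
          - (\<integral>y. k2 x y * flux p (v2 y s - v2 x s) \<partial>lborel)) \<partial>lborel) \<le> R"
    and R: "0 \<le> R"
  shows "integrable lborel (\<lambda>x. v1 x t - v2 x t)" "integrable lborel (\<lambda>x. j (v1 x t - v2 x t))"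
    "(\<integral>x. j (v1 x t - v2 x t) \<partial>lborel) \<le> (\<integral>x. j (g1 x - g2 x) \<partial>lborel) + T * R"
proof -
  define z where "z x s = v1 x s - v2 x s" for x s
  define q where "q x s = f1 x s - f2 x s" for x s
  have [measurable]: "\<beta> \<in> borel_measurable borel"
    using \<beta> by (rule borel_measurable_continuous_onI)
  note d = e1[unfolded evolution_def] e2[unfolded evolution_def]
  have [measurable]: "case_prod v1 \<in> borel_measurable borel_plane"
      "case_prod v2 \<in> borel_measurable borel_plane"
      "case_prod f1 \<in> borel_measurable borel_plane"
      "case_prod f2 \<in> borel_measurable borel_plane"
    using d by (auto dest!: borel_measurable_integrable cong: measurable_cong_sets)
  have z_meas: "case_prod z \<in> borel_measurable borel_plane"
    unfolding z_def by measurable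
  have q: "integrable plane (case_prod q)"
    using Bochner_Integration.integrable_diff[of _ "case_prod f1" "case_prod f2"] d
    by (simp add: q_def case_prod_beta')
  have primitive: "AE x in lborel. \<forall>s\<in>{0..T}. z x s = (g1 x - g2 x) + (LINT r:{0..s}|lborel. q x r)"
    using lborel_pair.AE_integrable_fst[OF evolutionD(4)[OF e1]]
      lborel_pair.AE_integrable_fst[OF evolutionD(4)[OF e2]]
  proof eventually_elim
    case (elim x)
    have "set_integrable lborel {0..s} (f1 x)" "set_integrable lborel {0..s} (f2 x)" for s
      using elim unfolding set_integrable_def
      by (auto intro!: integrable_mult_indicator[where 'b=real, simplified])
    then show ?case using d by (auto simp: z_def q_def)
  qed
  have z0: "integrable lborel (\<lambda>x. g1 x - g2 x)" using d by auto
  note chain = integrated_chain_rule[OF t z_meas q z0 primitive \<beta> tangent jm \<beta>_bd[folded z_def] j_bd[folded z_def]]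
  show "integrable lborel (\<lambda>x. v1 x t - v2 x t)" "integrable lborel (\<lambda>x. j (v1 x t - v2 x t))"
    using chain(1,2) by (auto simp: z_def)
  have rate': "AE s in lborel. s \<in> {0<..<T} \<longrightarrow> (\<integral>x. \<beta> (z x s) * q x s \<partial>lborel) \<le> R"
    using rate evolutionD(7)[OF e1]
      evolutionD(7)[OF e2]
  proof eventually_elim
    case (elim s)
    show ?case
    proof
      assume s: "s \<in> {0<..<T}"
      let ?F1 = "\<lambda>x. \<integral>y. k1 x y * flux p (v1 y s - v1 x s) \<partial>lborel"
      let ?F2 = "\<lambda>x. \<integral>y. k2 x y * flux p (v2 y s - v2 x s) \<partial>lborel"
      have int: "integrable plane (\<lambda>(x, y). k1 x y * flux p (v1 y s - v1 x s))"
        "integrable plane (\<lambda>(x, y). k2 x y * flux p (v2 y s - v2 x s))"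
        and ae: "AE x in lborel. f1 x s = ?F1 x" "AE x in lborel. f2 x s = ?F2 x"
        using elim s by auto
      have [measurable]: "?F1 \<in> borel_measurable lborel" "?F2 \<in> borel_measurable lborel"
        using lborel_pair.integrable_fst[OF int(1)] lborel_pair.integrable_fst[OF int(2)] by auto
      have [measurable]: "(\<lambda>x. f1 x s) \<in> borel_measurable lborel" "(\<lambda>x. f2 x s) \<in> borel_measurable lborel"
        by measurable
      have "(\<integral>x. \<beta> (z x s) * q x s \<partial>lborel) = (\<integral>x. \<beta> (v1 x s - v2 x s) * (?F1 x - ?F2 x) \<partial>lborel)"
        unfolding z_def q_def
      proof (rule integral_cong_AE)
        show "AE x in lborel. \<beta> (v1 x s - v2 x s) * (f1 x s - f2 x s) = \<beta> (v1 x s - v2 x s) * (?F1 x - ?F2 x)"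
          using ae by eventually_elim simp
      qed measurable
      then show "(\<integral>x. \<beta> (z x s) * q x s \<partial>lborel) \<le> R" using elim(1) s by simp
    qed
  qed
  have "(LINT s:{0..t}|lborel. (\<integral>x. \<beta> (z x s) * q x s \<partial>lborel)) \<le> (LINT s:{0..t}|lborel. R)"
  proof (rule set_integral_mono_AE[OF chain(3)])
    show "set_integrable lborel {0..t} (\<lambda>s. R)"
      by (rule set_integrable_bounded_interval[where C=R]) (use R in auto)
    show "AE s \<in> {0..t} in lborel. (\<integral>x. \<beta> (z x s) * q x s \<partial>lborel) \<le> R"
      using rate' AE_lborel_singleton[of 0] AE_lborel_singleton[of T]
      by eventually_elim (use t in auto)
  qed
  also have "\<dots> = t * R" using t by (simp add: set_lebesgue_integral_def)
  also have "\<dots> \<le> T * R" using t R by (intro mult_right_mono) auto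
  finally show "(\<integral>x. j (v1 x t - v2 x t) \<partial>lborel) \<le> (\<integral>x. j (g1 x - g2 x) \<partial>lborel) + T * R"
    using chain(4) by (simp add: z_def)
qed

text \<open>This is the Cauchy-Schwarz inequality for the vectors \<open>(1, a)\<close> and \<open>(1, b)\<close>.\<close>

lemma sqrt_tangent: "(sqrt (1 + b\<^sup>2) - 1) - (sqrt (1 + a\<^sup>2) - 1) \<le> b / sqrt (1 + b\<^sup>2) * (b - a)"
proof -
  have pos: "0 < sqrt (1 + b\<^sup>2)" by (simp add: add_pos_nonneg)
  have "1 + a * b \<le> sqrt ((1 + a\<^sup>2) * (1 + b\<^sup>2))"
  proof (rule real_le_rsqrt)
    have "(1 + a\<^sup>2) * (1 + b\<^sup>2) - (1 + a * b)\<^sup>2 = (a - b)\<^sup>2" by (simp add: power2_eq_square algebra_simps)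
    then show "(1 + a * b)\<^sup>2 \<le> (1 + a\<^sup>2) * (1 + b\<^sup>2)" using zero_le_power2[of "a - b"] by linarith
  qed
  then have "1 + a * b \<le> sqrt (1 + a\<^sup>2) * sqrt (1 + b\<^sup>2)" by (simp add: real_sqrt_mult)
  moreover have "sqrt (1 + b\<^sup>2) * sqrt (1 + b\<^sup>2) = 1 + b\<^sup>2" by simp
  ultimately have "(sqrt (1 + b\<^sup>2) - sqrt (1 + a\<^sup>2)) * sqrt (1 + b\<^sup>2) \<le> b * (b - a)"
    by (simp add: algebra_simps power2_eq_square)
  then show ?thesis using pos by (simp add: pos_le_divide_eq)
qed

text \<open>The slopes of the tangents of a convex function are nondecreasing: add the tangent inequality to the
  one with \<open>a\<close> and \<open>b\<close> exchanged.\<close>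

lemma mono_sqrt_slope: "mono (\<lambda>s::real. s / sqrt (1 + s\<^sup>2))"
proof (rule monoI)
  fix a b :: real assume ab: "a \<le> b"
  have aux: "0 \<le> (u - w) * (b - a)" if "c \<le> u * (b - a)" "- c \<le> w * (a - b)" for u w c :: real
    using that by (simp add: algebra_simps)
  have "0 \<le> (b / sqrt (1 + b\<^sup>2) - a / sqrt (1 + a\<^sup>2)) * (b - a)"
    by (rule aux[OF sqrt_tangent[of b a]]) (use sqrt_tangent[of a b] in simp)
  then show "a / sqrt (1 + a\<^sup>2) \<le> b / sqrt (1 + b\<^sup>2)"
    using ab by (cases "a = b") (auto simp: zero_le_mult_iff)
qed

text \<open>The function \<open>j(s) = \<surd>(1 + s\<^sup>2) - 1\<close> is positive except at \<open>0\<close>, and its slope is bounded. So the energy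
  estimate applies to evolutions that are merely integrable, and it yields \<open>\<integral> j(v1 - v2) \<le> 0\<close>.\<close>

lemma evolution_unique:
  assumes p: "1 < p" and T: "0 < T" and k: "regular_kernel B k"
    and e1: "evolution T p k g v1 f1" and e2: "evolution T p k g v2 f2" and t: "t \<in> {0..T}"
  shows "AE x in lborel. v1 x t = v2 x t"
proof -
  define \<beta> :: "real \<Rightarrow> real" where "\<beta> s = s / sqrt (1 + s\<^sup>2)" for s
  define j :: "real \<Rightarrow> real" where "j s = sqrt (1 + s\<^sup>2) - 1" for s
  have pos: "0 < sqrt (1 + s\<^sup>2)" for s :: real by (simp add: add_pos_nonneg)
  have \<beta>_bd: "\<bar>\<beta> s\<bar> \<le> 1" for s
  proof -
    have "sqrt (s\<^sup>2) \<le> sqrt (1 + s\<^sup>2)" by (intro real_sqrt_le_mono) auto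
    then show ?thesis using pos[of s] by (simp add: \<beta>_def abs_divide)
  qed
  have j_bd: "\<bar>j s\<bar> \<le> 1 * \<bar>s\<bar>" for s
  proof -
    have "sqrt (1 + s\<^sup>2) \<le> sqrt ((1 + \<bar>s\<bar>)\<^sup>2)" by (intro real_sqrt_le_mono) (simp add: power2_sum)
    moreover have "1 \<le> sqrt (1 + s\<^sup>2)" by simp
    ultimately show ?thesis by (simp add: j_def)
  qed
  have j_pos: "0 \<le> j s" "j s = 0 \<longleftrightarrow> s = 0" for s by (auto simp: j_def)
  have \<beta>c: "continuous_on UNIV \<beta>" unfolding \<beta>_def
    by (intro continuous_intros) (use pos in \<open>auto simp: less_imp_neq[symmetric]\<close>)
  then have \<beta>m: "\<beta> \<in> borel_measurable borel" by (rule borel_measurable_continuous_onI)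
  have jm [measurable]: "j \<in> borel_measurable borel" unfolding j_def[abs_def] by measurable
  have \<beta>mono: "mono \<beta>" using mono_sqrt_slope by (simp add: \<beta>_def[abs_def])
  have tangent: "j b - j a \<le> \<beta> b * (b - a)" for a b
    unfolding j_def \<beta>_def by (rule sqrt_tangent)
  note d = e1[unfolded evolution_def] e2[unfolded evolution_def] 
  have k': "\<And>x y. 0 \<le> k x y" "\<And>x y. k x y = k y x" using k by (auto simp: regular_kernel_def)
  have vm [measurable]: "case_prod v1 \<in> borel_measurable borel_plane"
      "case_prod v2 \<in> borel_measurable borel_plane" using d by auto
  have rate: "AE s in lborel. s \<in> {0<..<T} \<longrightarrow>
       (\<integral>x. \<beta> (v1 x s - v2 x s) * ((\<integral>y. k x y * flux p (v1 y s - v1 x s) \<partial>lborel)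
          - (\<integral>y. k x y * flux p (v2 y s - v2 x s) \<partial>lborel)) \<partial>lborel) \<le> 0"
    using evolutionD(7)[OF e1]
      evolutionD(7)[OF e2]
  proof eventually_elim
    case (elim s)
    show ?case
    proof
      assume s: "s \<in> {0<..<T}"
      show "(\<integral>x. \<beta> (v1 x s - v2 x s) * ((\<integral>y. k x y * flux p (v1 y s - v1 x s) \<partial>lborel)
          - (\<integral>y. k x y * flux p (v2 y s - v2 x s) \<partial>lborel)) \<partial>lborel) \<le> 0"
        by (rule dissipation[where b=1, OF k' flux_mono[OF p] flux_minus _ _ \<beta>mono \<beta>m])
           (use elim s \<beta>_bd in auto)
    qed
  qed
  note est = difference_energy_estimate[OF e1 e2 T \<beta>c tangent jm \<beta>_bd j_bd t rate order_refl]
  have "(\<integral>x. j (v1 x t - v2 x t) \<partial>lborel) = 0"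
    using est(3) j_pos by (intro antisym integral_nonneg_AE) (auto simp: j_def)
  then have "AE x in lborel. j (v1 x t - v2 x t) = 0"
    using integral_nonneg_eq_0_iff_AE[OF est(2)] j_pos(1) by auto
  then show ?thesis by eventually_elim (simp add: j_pos(2))
qed

section \<open>Stability of bounded evolutions\<close>

text \<open>Here \<open>L\<close> bounds the flux between values in \<open>[-M, M]\<close>, and \<open>\<epsilon>\<close> is the parameter in Young's inequality. It is
  chosen such that \<open>p T L \<epsilon> \<le> 1/2\<close>.\<close>

definition stability_const :: "real \<Rightarrow> real \<Rightarrow> real \<Rightarrow> real" where
  "stability_const T p M =
     (let L = (2 * M) powr (p - 1); \<epsilon> = 1 / (2 * p * T * L + 1) in 2 * p * T * L * \<epsilon> powr (1 - p))"

lemma regular_kernel_off: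
  assumes "regular_kernel B k" "x \<notin> Omega \<or> y \<notin> Omega"
  shows "k x y = 0"
proof -
  have "0 \<le> k x y" "k x y \<le> B * (indicator Omega x * indicator Omega y)"
    using assms(1) by (auto simp: regular_kernel_def)
  then show ?thesis using assms(2) by auto
qed

lemma kernel_powr_integrable:
  assumes p: "0 < p" and k1: "regular_kernel B1 k1" and k2: "regular_kernel B2 k2"
  shows "integrable plane (\<lambda>(x, y). \<bar>k1 x y - k2 x y\<bar> powr p)"
proof (rule integrable_bounded_square[where C="(\<bar>B1\<bar> + \<bar>B2\<bar>) powr p"])
  have [measurable]: "case_prod k1 \<in> borel_measurable borel_plane"
      "case_prod k2 \<in> borel_measurable borel_plane"
    using k1 k2 by (auto simp: regular_kernel_def)
  show "(\<lambda>(x, y). \<bar>k1 x y - k2 x y\<bar> powr p) \<in> borel_measurable borel_plane" by measurable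
  fix x y
  have k: "0 \<le> k1 x y" "0 \<le> k2 x y" "k1 x y \<le> B1 * (indicator Omega x * indicator Omega y)"
    "k2 x y \<le> B2 * (indicator Omega x * indicator Omega y)"
    using k1 k2 by (auto simp: regular_kernel_def)
  show "\<bar>case (x, y) of (x, y) \<Rightarrow> \<bar>k1 x y - k2 x y\<bar> powr p\<bar>
      \<le> (\<bar>B1\<bar> + \<bar>B2\<bar>) powr p * (indicator Omega x * indicator Omega y)"
    using k p by (auto simp: indicator_def split: if_splits intro!: powr_mono2)
qed

lemma flux_integrable:
  assumes k: "regular_kernel B k" and [measurable]: "u \<in> borel_measurable borel"
    and u: "\<And>x y. \<bar>flux p (u y - u x)\<bar> \<le> C"
  shows "integrable plane (\<lambda>(x, y). k x y * flux p (u y - u x))"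
proof (rule integrable_bounded_square[where C="B * C"])
  have [measurable]: "case_prod k \<in> borel_measurable borel_plane"
    using k by (auto simp: regular_kernel_def)
  show "(\<lambda>(x, y). k x y * flux p (u y - u x)) \<in> borel_measurable borel_plane" by measurable
  fix x y
  have "k x y * \<bar>flux p (u y - u x)\<bar> \<le> B * (indicator Omega x * indicator Omega y) * C"
    using k u[of y x] order_trans[of 0 "k x y" "B * (indicator Omega x * indicator Omega y)"]
    by (intro mult_mono) (auto simp: regular_kernel_def)
  then show "\<bar>case (x, y) of (x, y) \<Rightarrow> k x y * flux p (u y - u x)\<bar>
      \<le> B * C * (indicator Omega x * indicator Omega y)"
    using k by (simp add: regular_kernel_def abs_mult mult_ac)
qed

text \<open>Insert the net flux of \<open>v\<close> for the kernel \<open>k2\<close>. The difference between \<open>v\<close> and \<open>w\<close> for the same kernel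
  \<open>k2\<close> is dissipative. The difference between the kernels occurs with the flux of \<open>v\<close> only, which is
  bounded in terms of \<open>M1\<close>; Young's inequality separates it from \<open>v - w\<close>.\<close>

lemma rate_bound:
  assumes p: "1 < p" and k1: "regular_kernel B1 k1" and k2: "regular_kernel B2 k2" and \<epsilon>: "0 < \<epsilon>"
    and [measurable]: "v \<in> borel_measurable borel" "w \<in> borel_measurable borel"
    and v: "\<And>x. \<bar>v x\<bar> \<le> M1" and w: "\<And>x. \<bar>w x\<bar> \<le> M2"
    and off: "\<And>x. x \<notin> Omega \<Longrightarrow> v x = w x"
  shows "(\<integral>x. flux p (v x - w x) * ((\<integral>y. k1 x y * flux p (v y - v x) \<partial>lborel)
            - (\<integral>y. k2 x y * flux p (w y - w x) \<partial>lborel)) \<partial>lborel)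
       \<le> (2 * M1) powr (p - 1) * (\<epsilon> * (\<integral>x. \<bar>v x - w x\<bar> powr p \<partial>lborel)
            + \<epsilon> powr (1 - p) * (\<integral>(x, y). \<bar>k1 x y - k2 x y\<bar> powr p \<partial>plane))"
proof -
  let ?\<beta> = "\<lambda>x. flux p (v x - w x)" and ?\<kappa> = "\<lambda>x y. \<bar>k1 x y - k2 x y\<bar> powr p"
  let ?F11 = "\<lambda>x. \<integral>y. k1 x y * flux p (v y - v x) \<partial>lborel"
    and ?F21 = "\<lambda>x. \<integral>y. k2 x y * flux p (v y - v x) \<partial>lborel"
    and ?F22 = "\<lambda>x. \<integral>y. k2 x y * flux p (w y - w x) \<partial>lborel"
  let ?Y = "\<integral>x. \<bar>v x - w x\<bar> powr p \<partial>lborel"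
  have [measurable]: "case_prod k1 \<in> borel_measurable borel_plane"
      "case_prod k2 \<in> borel_measurable borel_plane"
    using k1 k2 by (auto simp: regular_kernel_def)
  define L where "L = (2 * M1) powr (p - 1)"
  have vL: "\<bar>flux p (v y - v x)\<bar> \<le> L" for x y
    unfolding L_def using v[of x] v[of y] by (intro abs_flux_le p) auto
  have wL: "\<bar>flux p (w y - w x)\<bar> \<le> (2 * M2) powr (p - 1)" for x y
    using w[of x] w[of y] by (intro abs_flux_le p) auto
  have zb: "\<bar>flux p (v x - w x)\<bar> \<le> (M1 + M2) powr (p - 1)" for x
    using v[of x] w[of x] by (intro abs_flux_le p) auto
  have i11: "integrable plane (\<lambda>(x, y). k1 x y * flux p (v y - v x))"
    by (rule flux_integrable[OF k1 _ vL]) measurable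
  have i21: "integrable plane (\<lambda>(x, y). k2 x y * flux p (v y - v x))"
    by (rule flux_integrable[OF k2 _ vL]) measurable
  have i22: "integrable plane (\<lambda>(x, y). k2 x y * flux p (w y - w x))"
    by (rule flux_integrable[OF k2 _ wL]) measurable
  have zm: "(\<lambda>x. flux p (v x - w x)) \<in> borel_measurable borel" by measurable
  note W = weighted_difference[OF i11 i21 zm zb]
  note W' = weighted_difference[OF i21 i22 zm zb]
  have k_int: "integrable plane (\<lambda>(x, y). ?\<kappa> x y)"
    by (rule kernel_powr_integrable[OF _ k1 k2]) (use p in auto)
  have sq_int: "integrable plane (\<lambda>(x, y). \<bar>v x - w x\<bar> powr p * indicator Omega y)"
  proof (rule integrable_bounded_square[where C="(M1 + M2) powr p"])
    show "\<bar>case (x, y) of (x, y) \<Rightarrow> \<bar>v x - w x\<bar> powr p * indicator Omega y\<bar>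
        \<le> (M1 + M2) powr p * (indicator Omega x * indicator Omega y)" for x y
      using off[of x] v[of x] w[of x] p by (cases "x \<in> Omega") (auto intro!: powr_mono2 mult_right_mono)
  qed measurable
  have sq_eq: "(\<integral>(x, y). \<bar>v x - w x\<bar> powr p * indicator Omega y \<partial>plane) = ?Y"
    using lborel_pair.integral_fst[OF sq_int] by (simp add: Omega_def)
  have bound_int: "integrable plane (\<lambda>(x, y). L * (\<epsilon> * (\<bar>v x - w x\<bar> powr p * indicator Omega y)
        + \<epsilon> powr (1 - p) * ?\<kappa> x y))"
    using sq_int k_int unfolding case_prod_beta' by (intro integrable_mult_right Bochner_Integration.integrable_add)
  have bound_eq: "(\<integral>(x, y). L * (\<epsilon> * (\<bar>v x - w x\<bar> powr p * indicator Omega y)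
        + \<epsilon> powr (1 - p) * ?\<kappa> x y) \<partial>plane)
      = L * (\<epsilon> * ?Y
            + \<epsilon> powr (1 - p) * (\<integral>(x, y). ?\<kappa> x y \<partial>plane))"
    using sq_int k_int unfolding sq_eq[symmetric] case_prod_beta'
    by (subst integral_mult_right_zero, subst Bochner_Integration.integral_add) auto
  have "(\<integral>x. ?\<beta> x * (?F11 x
        - ?F22 x) \<partial>lborel)
      = (\<integral>x. ?\<beta> x * (?F11 x - ?F21 x)
           + ?\<beta> x * (?F21 x - ?F22 x) \<partial>lborel)"
    by (rule Bochner_Integration.integral_cong) (auto simp: algebra_simps)
  also have "\<dots> = (\<integral>x. ?\<beta> x * (?F11 x - ?F21 x) \<partial>lborel)
      + (\<integral>x. ?\<beta> x * (?F21 x - ?F22 x) \<partial>lborel)"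
    by (rule Bochner_Integration.integral_add[OF W(2) W'(2)])
  also have "(\<integral>x. ?\<beta> x * (?F21 x - ?F22 x) \<partial>lborel) \<le> 0"
    by (rule dissipation[OF _ _ flux_mono[OF p] flux_minus i21 i22 flux_mono[OF p] _ _ _ zb])
       (use k2 in \<open>auto simp: regular_kernel_def\<close>)
  also have "(\<integral>x. ?\<beta> x * (?F11 x - ?F21 x) \<partial>lborel)
      \<le> (\<integral>(x, y). L * (\<epsilon> * (\<bar>v x - w x\<bar> powr p * indicator Omega y)
        + \<epsilon> powr (1 - p) * ?\<kappa> x y) \<partial>plane)"
    unfolding W(3)
  proof (rule integral_mono[OF W(1) bound_int], clarify)
    fix x y :: real
    show "flux p (v x - w x) * (k1 x y * flux p (v y - v x) - k2 x y * flux p (v y - v x))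
        \<le> L * (\<epsilon> * (\<bar>v x - w x\<bar> powr p * indicator Omega y) + \<epsilon> powr (1 - p) * ?\<kappa> x y)"
    proof (cases "y \<in> Omega")
      case True
      have "flux p (v x - w x) * (k1 x y * flux p (v y - v x) - k2 x y * flux p (v y - v x))
          = flux p (v x - w x) * (k1 x y - k2 x y) * flux p (v y - v x)" by (simp add: algebra_simps)
      also have "\<dots> \<le> \<bar>flux p (v x - w x) * (k1 x y - k2 x y) * flux p (v y - v x)\<bar>" by (rule abs_ge_self)
      also have "\<dots> = (\<bar>v x - w x\<bar> powr (p - 1) * \<bar>k1 x y - k2 x y\<bar>) * \<bar>flux p (v y - v x)\<bar>"
        by (simp add: abs_mult abs_flux)
      also have "\<dots> \<le> (\<epsilon> * \<bar>v x - w x\<bar> powr p + \<epsilon> powr (1 - p) * ?\<kappa> x y) * L"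
        using powr_young_split[OF p, of "\<bar>v x - w x\<bar>" "\<bar>k1 x y - k2 x y\<bar>" \<epsilon>] \<epsilon> vL[of y x]
        by (intro mult_mono) auto
      finally show ?thesis using True by (simp add: mult_ac)
    next
      case False
      then have "k1 x y = 0" "k2 x y = 0"
        using regular_kernel_off[OF k1] regular_kernel_off[OF k2] by auto
      then show ?thesis using False by (simp add: L_def)
    qed
  qed
  finally show ?thesis unfolding bound_eq by (simp add: L_def)
qed

text \<open>Let \<open>Y\<close> be the supremum over time of \<open>y(t) = \<integral> \<bar>v1 - v2\<bar>\<^sup>p\<close>. The energy estimate for \<open>j(s) = \<bar>s\<bar>\<^sup>p/p\<close> bounds \<open>Y\<close>
  by \<open>y(0)\<close>, a multiple of \<open>\<integral>\<integral> \<bar>k1 - k2\<bar>\<^sup>p\<close>, and \<open>p T L \<epsilon> Y \<le> Y/2\<close>, which is absorbed on the left. This is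
  possible since \<open>Y\<close> is finite for bounded evolutions.\<close>

lemma evolution_Lp_estimate:
  assumes p: "1 < p" and T: "0 < T" and k1: "regular_kernel B1 k1" and k2: "regular_kernel B2 k2"
    and e1: "evolution T p k1 g1 v1 f1" and e2: "evolution T p k2 g2 v2 f2"
    and v1: "\<And>x s. s \<in> {0..T} \<Longrightarrow> \<bar>v1 x s\<bar> \<le> M1" and v2: "\<And>x s. s \<in> {0..T} \<Longrightarrow> \<bar>v2 x s\<bar> \<le> M2"
    and t: "t \<in> {0..T}"
  shows "(\<integral>x. \<bar>v1 x t - v2 x t\<bar> powr p \<partial>lborel) \<le> 2 * (\<integral>x. \<bar>g1 x - g2 x\<bar> powr p \<partial>lborel)
     + stability_const T p M1 * (\<integral>(x, y). \<bar>k1 x y - k2 x y\<bar> powr p \<partial>plane)"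
proof -
  define L where "L = (2 * M1) powr (p - 1)"
  define \<epsilon> where "\<epsilon> = 1 / (2 * p * T * L + 1)"
  define \<kappa> where "\<kappa> = (\<integral>(x, y). \<bar>k1 x y - k2 x y\<bar> powr p \<partial>plane)"
  define y where "y s = (\<integral>x. \<bar>v1 x s - v2 x s\<bar> powr p \<partial>lborel)" for s
  define y0 where "y0 = (\<integral>x. \<bar>g1 x - g2 x\<bar> powr p \<partial>lborel)"
  define Y where "Y = (SUP s\<in>{0..T}. y s)"
  have L: "0 \<le> L" by (simp add: L_def)
  have pTL: "0 \<le> p * T * L" using p T L by simp
  have \<epsilon>: "0 < \<epsilon>" using pTL by (auto simp: \<epsilon>_def intro!: add_nonneg_pos)
  have \<kappa>: "0 \<le> \<kappa>" unfolding \<kappa>_def by (intro integral_nonneg_AE) auto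
  note d = e1[unfolded evolution_def] e2[unfolded evolution_def] 
  have vm [measurable]: "case_prod v1 \<in> borel_measurable borel_plane"
      "case_prod v2 \<in> borel_measurable borel_plane" using d by auto
  have off: "v1 x s = v2 x s" if "x \<notin> Omega" "s \<in> {0..T}" for x s
    using d that by (auto simp: set_lebesgue_integral_def)
  have y_le: "y s \<le> (M1 + M2) powr p" if s: "s \<in> {0..T}" for s
  proof -
    have "\<bar>\<integral>x. \<bar>v1 x s - v2 x s\<bar> powr p \<partial>lborel\<bar> \<le> (M1 + M2) powr p"
    proof (rule integrable_bounded_Omega(2))
      show "\<bar>\<bar>v1 x s - v2 x s\<bar> powr p\<bar> \<le> (M1 + M2) powr p * indicator Omega x" for x
        using off[of x s] v1[OF s, of x] v2[OF s, of x] p s by (cases "x \<in> Omega") (auto intro!: powr_mono2)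
    qed measurable
    then show ?thesis by (simp add: y_def)
  qed
  then have bdd: "bdd_above (y ` {0..T})" by (auto intro!: bdd_aboveI2[where M="(M1 + M2) powr p"])
  have yY: "y s \<le> Y" if "s \<in> {0..T}" for s
    unfolding Y_def by (rule cSUP_upper[OF that bdd])
  have y_nonneg: "0 \<le> y s" for s unfolding y_def by (intro integral_nonneg_AE) auto
  have Y: "0 \<le> Y" using order_trans[OF y_nonneg yY[of 0]] T by auto
  define R where "R = L * (\<epsilon> * Y + \<epsilon> powr (1 - p) * \<kappa>)"
  have R: "0 \<le> R" using L \<epsilon> Y \<kappa> by (simp add: R_def)
  have rate: "(\<integral>x. flux p (v1 x s - v2 x s) * ((\<integral>y. k1 x y * flux p (v1 y s - v1 x s) \<partial>lborel)
          - (\<integral>y. k2 x y * flux p (v2 y s - v2 x s) \<partial>lborel)) \<partial>lborel) \<le> R" if s: "s \<in> {0..T}" for s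
  proof -
    have "(\<integral>x. flux p (v1 x s - v2 x s) * ((\<integral>y. k1 x y * flux p (v1 y s - v1 x s) \<partial>lborel)
          - (\<integral>y. k2 x y * flux p (v2 y s - v2 x s) \<partial>lborel)) \<partial>lborel) \<le> L * (\<epsilon> * y s + \<epsilon> powr (1 - p) * \<kappa>)"
      unfolding L_def \<kappa>_def y_def
      by (rule rate_bound[OF p k1 k2 \<epsilon>, where ?M2.0=M2]) (use v1 v2 off s in auto)
    also have "\<dots> \<le> R"
      unfolding R_def using L \<epsilon> yY[OF s] by (intro mult_left_mono add_right_mono) auto
    finally show ?thesis .
  qed
  have z_bd: "\<bar>flux p (v1 x s - v2 x s)\<bar> \<le> (M1 + M2) powr (p - 1)" if "s \<in> {0..T}" for x s
    using v1[OF that, of x] v2[OF that, of x] by (intro abs_flux_le p) auto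
  have j_bd: "\<bar>\<bar>v1 x s - v2 x s\<bar> powr p / p\<bar> \<le> (M1 + M2) powr (p - 1) * \<bar>v1 x s - v2 x s\<bar>" if "s \<in> {0..T}" for x s
  proof -
    have "\<bar>v1 x s - v2 x s\<bar> powr p / p \<le> \<bar>v1 x s - v2 x s\<bar> powr p / 1"
      using p by (intro divide_left_mono) auto
    also have "\<dots> = \<bar>flux p (v1 x s - v2 x s)\<bar> * \<bar>v1 x s - v2 x s\<bar>"
      using arg_cong[OF flux_mult_self[of p "v1 x s - v2 x s"], of abs] by (simp add: abs_mult)
    also have "\<dots> \<le> (M1 + M2) powr (p - 1) * \<bar>v1 x s - v2 x s\<bar>"
      by (intro mult_right_mono z_bd that) auto
    finally show ?thesis using p by simp
  qed
  have y_est: "y s \<le> y0 + p * (T * R)" if s: "s \<in> {0..T}" for s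
  proof -
    have "(\<integral>x. \<bar>v1 x s - v2 x s\<bar> powr p / p \<partial>lborel) \<le> (\<integral>x. \<bar>g1 x - g2 x\<bar> powr p / p \<partial>lborel) + T * R"
      by (rule difference_energy_estimate(3)[OF e1 e2 T continuous_flux[OF p] powr_convex_tangent[OF p] _ z_bd j_bd s _ R])
         (use rate in auto)
    then have "y s / p \<le> y0 / p + T * R" by (simp add: y_def y0_def)
    then show ?thesis using p by (simp add: field_simps)
  qed
  have "Y \<le> y0 + p * (T * R)"
    unfolding Y_def by (rule cSUP_least) (use T y_est in auto)
  moreover have "p * (T * R) = (p * T * L * \<epsilon>) * Y + p * T * L * \<epsilon> powr (1 - p) * \<kappa>"
    by (simp add: R_def algebra_simps)
  moreover have "(p * T * L * \<epsilon>) * Y \<le> 1 / 2 * Y"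
  proof (rule mult_right_mono[OF _ Y])
    have "2 * (p * T * L) / (2 * (p * T * L) + 1) \<le> 1" using pTL by simp
    then show "p * T * L * \<epsilon> \<le> 1 / 2" by (simp add: \<epsilon>_def mult_ac)
  qed
  ultimately have "Y \<le> 2 * y0 + 2 * p * T * L * \<epsilon> powr (1 - p) * \<kappa>" by linarith
  with yY[OF t] have "y t \<le> 2 * y0 + 2 * p * T * L * \<epsilon> powr (1 - p) * \<kappa>" by linarith
  then show ?thesis
    by (simp add: y_def y0_def \<kappa>_def stability_const_def Let_def L_def \<epsilon>_def)
qed

section \<open>Smooth cut-offs and weak time derivatives\<close>

text \<open>The functions \<open>exp(-1/s) / s\<^sup>n\<close>, continued by \<open>0\<close> to \<open>s \<le> 0\<close>. The whole family is needed, because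
  differentiation raises \<open>n\<close>.\<close>

definition flat :: "nat \<Rightarrow> real \<Rightarrow> real" where
  "flat n s = (if 0 < s then exp (- inverse s) * inverse s ^ n else 0)"

lemma flat_tendsto_0: "(flat n \<longlongrightarrow> 0) (at_right 0)"
proof -
  have "((\<lambda>s::real. inverse s ^ n / exp (inverse s)) \<longlongrightarrow> 0) (at_right 0)"
    by (rule filterlim_compose[OF tendsto_power_div_exp_0 filterlim_inverse_at_top_right])
  then show ?thesis
  proof (rule Lim_transform_eventually)
    show "\<forall>\<^sub>F s in at_right 0. inverse s ^ n / exp (inverse s) = flat n s"
      using eventually_at_right_less[of "0::real"]
      by eventually_elim (simp add: flat_def exp_minus divide_inverse mult.commute)
  qed
qed

lemma flat_derivative:
  "(flat n has_real_derivative flat (n + 2) s - real n * flat (n + 1) s) (at s)"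
proof -
  consider "0 < s" | "s < 0" | "s = 0" by linarith
  then show ?thesis
  proof cases
    case 1
    have inv: "(inverse has_real_derivative - (inverse s)\<^sup>2) (at s)"
      using DERIV_inverse[of s] 1 by (simp add: numeral_2_eq_2)
    have e: "((\<lambda>s. exp (- inverse s)) has_real_derivative exp (- inverse s) * (inverse s)\<^sup>2) (at s)"
      using DERIV_chain2[OF DERIV_exp DERIV_minus[OF inv]] by simp
    have "((\<lambda>s. inverse s ^ n) has_real_derivative - real n * inverse s ^ (n + 1)) (at s)"
      by (rule DERIV_cong[OF DERIV_power[OF inv]]) (cases n; simp add: power2_eq_square algebra_simps)
    from DERIV_mult[OF e this]
    have "((\<lambda>s. exp (- inverse s) * inverse s ^ n) has_real_derivative flat (n + 2) s - real n * flat (n + 1) s) (at s)"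
      by (rule DERIV_cong) (use 1 in \<open>simp add: flat_def power2_eq_square algebra_simps\<close>)
    then show ?thesis
    proof (rule DERIV_cong_ev[THEN iffD1, rotated 3])
      show "\<forall>\<^sub>F x in nhds s. exp (- inverse x) * inverse x ^ n = flat n x"
        using eventually_nhds_in_open[of "{0<..}" s] 1 by (auto elim!: eventually_mono simp: flat_def)
    qed auto
  next
    case 2
    have "((\<lambda>s. 0) has_real_derivative flat (n + 2) s - real n * flat (n + 1) s) (at s)"
      using 2 by (simp add: flat_def)
    then show ?thesis
    proof (rule DERIV_cong_ev[THEN iffD1, rotated 3])
      show "\<forall>\<^sub>F x in nhds s. 0 = flat n x"
        using eventually_nhds_in_open[of "{..<0}" s] 2 by (auto elim!: eventually_mono simp: flat_def)
    qed auto
  next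
    case 3
    have right: "((\<lambda>h. flat n h / h) \<longlongrightarrow> 0) (at_right 0)"
      by (rule Lim_transform_eventually[OF flat_tendsto_0[of "Suc n"]])
         (auto simp: flat_def eventually_at_filter divide_inverse mult_ac)
    have left: "((\<lambda>h. flat n h / h) \<longlongrightarrow> 0) (at_left 0)"
      by (rule Lim_transform_eventually[OF tendsto_const])
         (auto simp: flat_def eventually_at_filter)
    have "((\<lambda>h. flat n h / h) \<longlongrightarrow> 0) (at 0)"
      using left right by (simp add: filterlim_at_split)
    then show ?thesis using 3 by (simp add: DERIV_def flat_def)
  qed
qed

text \<open>An algebra of functions that contains all derivatives of its members, which are therefore smooth
  (\<open>iterated_deriv_smooth_algebra\<close>). The reciprocals serve to normalise the smooth step below.\<close>

inductive_set smooth_algebra :: "(real \<Rightarrow> real) set" where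
  flat: "(\<lambda>t. flat n (c * t + d)) \<in> smooth_algebra"
| const: "(\<lambda>t. c) \<in> smooth_algebra"
| add: "f \<in> smooth_algebra \<Longrightarrow> g \<in> smooth_algebra \<Longrightarrow> (\<lambda>t. f t + g t) \<in> smooth_algebra"
| mult: "f \<in> smooth_algebra \<Longrightarrow> g \<in> smooth_algebra \<Longrightarrow> (\<lambda>t. f t * g t) \<in> smooth_algebra"
| recip: "f \<in> smooth_algebra \<Longrightarrow> (\<And>t. 0 < f t) \<Longrightarrow> (\<lambda>t. 1 / f t) \<in> smooth_algebra"

lemma smooth_algebra_derivative:
  "f \<in> smooth_algebra \<Longrightarrow> \<exists>f'\<in>smooth_algebra. \<forall>t. (f has_real_derivative f' t) (at t)"
proof (induction rule: smooth_algebra.induct)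
  case (flat n c d)
  let ?f' = "\<lambda>t. c * (flat (n + 2) (c * t + d) + (- real n) * flat (n + 1) (c * t + d))"
  have "?f' \<in> smooth_algebra" by (intro smooth_algebra.intros)
  moreover have "((\<lambda>t. flat n (c * t + d)) has_real_derivative ?f' t) (at t)" for t
  proof -
    have "((\<lambda>t. c * t + d) has_real_derivative c) (at t)" by (auto intro!: derivative_eq_intros)
    from DERIV_chain2[OF flat_derivative this] show ?thesis by (simp add: mult.commute)
  qed
  ultimately show ?case by (intro bexI[of _ ?f'] allI)
next
  case (const c)
  show ?case by (rule bexI[OF _ smooth_algebra.const[of 0]]) auto
next
  case (add f g)
  then obtain f' g' where "f' \<in> smooth_algebra" "g' \<in> smooth_algebra"
    "\<And>t. (f has_real_derivative f' t) (at t)" "\<And>t. (g has_real_derivative g' t) (at t)" by blast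
  then show ?case
    by (intro bexI[of _ "\<lambda>t. f' t + g' t"] smooth_algebra.intros allI DERIV_add)
next
  case (mult f g)
  then obtain f' g' where "f' \<in> smooth_algebra" "g' \<in> smooth_algebra"
    "\<And>t. (f has_real_derivative f' t) (at t)" "\<And>t. (g has_real_derivative g' t) (at t)" by blast
  with mult.hyps show ?case
    by (intro bexI[of _ "\<lambda>t. f' t * g t + g' t * f t"] smooth_algebra.intros allI DERIV_mult)
next
  case (recip f)
  then obtain f' where f': "f' \<in> smooth_algebra" "\<And>t. (f has_real_derivative f' t) (at t)" by blast
  have "(\<lambda>t. (- 1) * (f' t * ((1 / f t) * (1 / f t)))) \<in> smooth_algebra"
    by (intro smooth_algebra.mult smooth_algebra.const smooth_algebra.recip recip.hyps f')
  moreover have "((\<lambda>t. 1 / f t) has_real_derivative (- 1) * (f' t * ((1 / f t) * (1 / f t)))) (at t)" for t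
    using recip.hyps(2)[of t] by (auto intro!: derivative_eq_intros f')
  ultimately show ?case by (intro bexI[of _ "\<lambda>t. (- 1) * (f' t * ((1 / f t) * (1 / f t)))"] allI)
qed

lemma deriv_smooth_algebra:
  assumes "f \<in> smooth_algebra"
  shows "deriv f \<in> smooth_algebra" "(f has_real_derivative deriv f t) (at t)"
proof -
  obtain f' where f': "f' \<in> smooth_algebra" "\<And>t. (f has_real_derivative f' t) (at t)"
    using smooth_algebra_derivative[OF assms] by blast
  then have "deriv f = f'" by (intro ext DERIV_imp_deriv) auto
  with f' show "deriv f \<in> smooth_algebra" "(f has_real_derivative deriv f t) (at t)" by auto
qed

lemma continuous_smooth_algebra: "f \<in> smooth_algebra \<Longrightarrow> continuous_on S f"
  using deriv_smooth_algebra(2) DERIV_isCont continuous_at_imp_continuous_on by blast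

lemma iterated_deriv_smooth_algebra:
  "f \<in> smooth_algebra \<Longrightarrow> (deriv ^^ k) f \<in> smooth_algebra"
  by (induction k) (auto intro: deriv_smooth_algebra)

lemma smooth_algebra_test_function:
  assumes "f \<in> smooth_algebra" "0 < a" "b < T" "\<And>t. t \<notin> {a..b} \<Longrightarrow> f t = 0"
  shows "test_function T f"
  unfolding test_function_def
proof (intro conjI allI)
  show "(deriv ^^ k) f field_differentiable at t" for k t
    using deriv_smooth_algebra(2)[OF iterated_deriv_smooth_algebra[OF assms(1)]]
    unfolding field_differentiable_def by blast
  show "\<exists>a b. 0 < a \<and> b < T \<and> (\<forall>t. t \<notin> {a..b} \<longrightarrow> f t = 0)" using assms by blast
qed

definition step :: "real \<Rightarrow> real" where
  "step s = flat 0 (s - 1) / (flat 0 (s - 1) + flat 0 (2 - s))"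

lemma flat_nonneg: "0 \<le> flat n s"
  by (simp add: flat_def)

lemma step_denominator: "0 < flat 0 (s - 1) + flat 0 (2 - s)"
  by (cases "1 < s") (auto simp: flat_def intro: add_pos_nonneg)

lemma step_range: "0 \<le> step s" "step s \<le> 1"
  using step_denominator[of s] flat_nonneg[of 0 "s - 1"] flat_nonneg[of 0 "2 - s"]
  by (auto simp: step_def)

lemma step_low: "s \<le> 1 \<Longrightarrow> step s = 0" and step_high: "2 \<le> s \<Longrightarrow> step s = 1"
  by (auto simp: step_def flat_def)

lemma step_affine_smooth: "(\<lambda>t. step (c * t + d)) \<in> smooth_algebra"
proof -
  have "(\<lambda>t. flat 0 (c * t + (d - 1)) * (1 / (flat 0 (c * t + (d - 1)) + flat 0 ((- c) * t + (2 - d))))) \<in> smooth_algebra"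
    using step_denominator[of "c * _ + d"]
    by (intro smooth_algebra.mult smooth_algebra.recip smooth_algebra.add smooth_algebra.flat)
       (simp add: algebra_simps)
  then show ?thesis by (simp add: step_def algebra_simps)
qed

lemma step_smooth: "step \<in> smooth_algebra"
  using step_affine_smooth[of 1 0] by simp

lemma step_deriv: "(step has_real_derivative deriv step s) (at s)"
  by (rule deriv_smooth_algebra(2)[OF step_smooth])

lemma deriv_step_outside: "s \<notin> {1..2} \<Longrightarrow> deriv step s = 0"
proof -
  assume "s \<notin> {1..2}"
  then consider "s < 1" | "2 < s" by fastforce
  then have "(step has_real_derivative 0) (at s)"
  proof cases
    case 1
    then show ?thesis
      by (intro DERIV_cong_ev[THEN iffD1, OF refl _ refl DERIV_const[of 0]])
         (use eventually_nhds_in_open[of "{..<1}" s] in \<open>auto elim!: eventually_mono simp: step_low\<close>)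
  next
    case 2
    then show ?thesis
      by (intro DERIV_cong_ev[THEN iffD1, OF refl _ refl DERIV_const[of 1]])
         (use eventually_nhds_in_open[of "{2<..}" s] in \<open>auto elim!: eventually_mono simp: step_high\<close>)
  qed
  then show ?thesis by (rule DERIV_imp_deriv)
qed

lemma continuous_deriv_step: "continuous_on S (deriv step)"
  by (rule continuous_smooth_algebra[OF deriv_smooth_algebra(1)[OF step_smooth]])

lemma deriv_step_measurable [measurable]: "deriv step \<in> borel_measurable borel"
  by (rule borel_measurable_continuous_onI[OF continuous_deriv_step])

lemma deriv_step_bounded: obtains C where "0 \<le> C" "\<And>s. \<bar>deriv step s\<bar> \<le> C * indicator {1..2} s"
proof -
  obtain C where C: "\<forall>s\<in>{1..2}. \<bar>deriv step s\<bar> \<le> C"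
    using compact_imp_bounded[OF compact_continuous_image[OF continuous_deriv_step compact_Icc[of 1 2]]]
    by (auto simp: bounded_iff)
  then have "0 \<le> C" using order_trans[OF abs_ge_zero, of "deriv step 1" C] by auto
  moreover have "\<bar>deriv step s\<bar> \<le> C * indicator {1..2} s" for s
    using C deriv_step_outside[of s] by (auto simp: indicator_def)
  ultimately show ?thesis by (rule that)
qed

lemma integral_scaled_deriv_step:
  assumes c: "c \<noteq> 0"
  shows "(\<integral>t. \<bar>c\<bar> * deriv step (c * t + d) \<partial>lborel) = 1"
proof -
  have "(\<integral>s. indicator {1..2} s *\<^sub>R deriv step s \<partial>lborel) = step 2 - step 1"
    by (rule integral_FTC_atLeastAtMost)
       (auto intro!: continuous_deriv_step DERIV_subset[OF step_deriv]
         simp flip: has_real_derivative_iff_has_vector_derivative)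
  moreover have "(\<lambda>s. indicator {1..2} s *\<^sub>R deriv step s) = deriv step"
    using deriv_step_outside by (auto simp: fun_eq_iff indicator_def)
  ultimately have "(\<integral>s. deriv step s \<partial>lborel) = 1"
    by (simp only:) (simp add: step_low step_high)
  then show ?thesis
    using lborel_integral_real_affine[OF c, of "deriv step" d] c by (simp add: mult_ac add_ac)
qed

text \<open>This is a smooth approximation of the indicator of \<open>(0, b)\<close> from inside: it vanishes near \<open>0\<close> and near \<open>b\<close>, so that it
  is a test function on \<open>(0, T)\<close> even for \<open>b = T\<close>.\<close>

definition cutoff :: "real \<Rightarrow> real \<Rightarrow> real \<Rightarrow> real" where
  "cutoff k b t = step (k * t) * step (k * (b - t))"

lemma cutoff_range: "0 \<le> cutoff k b t" "cutoff k b t \<le> 1"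
  using step_range by (auto simp: cutoff_def intro!: mult_le_one)

lemma cutoff_smooth: "cutoff k b \<in> smooth_algebra"
  using smooth_algebra.mult[OF step_affine_smooth[of k 0] step_affine_smooth[of "- k" "k * b"]]
  by (simp add: cutoff_def[abs_def] algebra_simps)

lemma cutoff_outside: "0 < k \<Longrightarrow> t \<notin> {1 / k..b - 1 / k} \<Longrightarrow> cutoff k b t = 0"
  by (auto simp: cutoff_def field_simps not_le intro!: step_low)

lemma cutoff_inside: "0 < k \<Longrightarrow> 2 / k \<le> t \<Longrightarrow> t \<le> b - 2 / k \<Longrightarrow> cutoff k b t = 1"
  using step_high[of "k * t"] step_high[of "k * (b - t)"] by (simp add: cutoff_def field_simps)

lemma cutoff_test_function: "0 < k \<Longrightarrow> b \<le> T \<Longrightarrow> test_function T (cutoff k b)"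
  using smooth_algebra_test_function[OF cutoff_smooth, of "1 / k" "b - 1 / k" T k b] cutoff_outside[of k _ b]
    divide_pos_pos[of 1 k] by fastforce

text \<open>The assumption \<open>4 < k b\<close> separates the rise near \<open>0\<close> from the descent near \<open>b\<close>: where one factor varies, the
  other one is \<open>1\<close>.\<close>

lemma deriv_cutoff:
  assumes k: "0 < k" "4 < k * b"
  shows "deriv (cutoff k b) t = k * deriv step (k * t) - k * deriv step (k * (b - t))"
proof -
  have "(cutoff k b has_real_derivative
      (k * deriv step (k * t)) * step (k * (b - t)) - (k * deriv step (k * (b - t))) * step (k * t)) (at t)"
    unfolding cutoff_def[abs_def]
    by (auto intro!: derivative_eq_intros DERIV_chain2[OF step_deriv])
  moreover have "k * deriv step (k * t) * step (k * (b - t)) = k * deriv step (k * t)"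
    using k step_high[of "k * (b - t)"] deriv_step_outside[of "k * t"]
    by (cases "k * t \<le> 2") (auto simp: algebra_simps)
  moreover have "k * deriv step (k * (b - t)) * step (k * t) = k * deriv step (k * (b - t))"
    using k step_high[of "k * t"] deriv_step_outside[of "k * (b - t)"]
    by (cases "k * (b - t) \<le> 2") (auto simp: algebra_simps)
  ultimately show ?thesis by (simp add: DERIV_imp_deriv)
qed

text \<open>Since \<open>\<rho>\<close> has integral \<open>1\<close>, the average of \<open>U\<close> minus \<open>w\<close> is the average of \<open>U - w\<close>, and it only involves times
  at which \<open>U\<close> is close to \<open>w\<close> in \<open>L\<^sup>1\<close>. The sign of \<open>\<rho>\<close> is arbitrary, so the bound contains \<open>C (c2 - c1)\<close> instead of \<open>1\<close>;
  for the rescaled steps this number does not depend on the scale.\<close>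

lemma approximate_identity:
  fixes U :: "real \<Rightarrow> real \<Rightarrow> real" and w \<rho> :: "real \<Rightarrow> real"
  assumes U: "integrable plane (case_prod U)"
    and [measurable]: "w \<in> borel_measurable borel" "\<rho> \<in> borel_measurable borel"
    and \<rho>: "\<And>t. \<bar>\<rho> t\<bar> \<le> C * indicator {c1..c2} t" and one: "(\<integral>t. \<rho> t \<partial>lborel) = 1"
    and c: "c1 \<le> c2" "0 \<le> C" "0 \<le> e"
    and near: "AE t in lborel. t \<in> {c1..c2} \<longrightarrow> (\<integral>\<^sup>+x. ennreal \<bar>U x t - w x\<bar> \<partial>lborel) \<le> ennreal e"
  shows "(\<integral>\<^sup>+x. ennreal \<bar>(\<integral>t. U x t * \<rho> t \<partial>lborel) - w x\<bar> \<partial>lborel) \<le> ennreal (C * (c2 - c1) * e)"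
proof -
  have Um [measurable]: "case_prod U \<in> borel_measurable borel_plane"
    using borel_measurable_integrable[OF U] by (simp cong: measurable_cong_sets)
  have \<rho>i: "integrable lborel \<rho>" using one not_integrable_integral_eq by fastforce
  have "(\<integral>\<^sup>+x. ennreal \<bar>(\<integral>t. U x t * \<rho> t \<partial>lborel) - w x\<bar> \<partial>lborel)
      \<le> (\<integral>\<^sup>+x. (\<integral>\<^sup>+t. ennreal (\<bar>U x t - w x\<bar> * \<bar>\<rho> t\<bar>) \<partial>lborel) \<partial>lborel)"
  proof (rule nn_integral_mono_AE)
    show "AE x in lborel. ennreal \<bar>(\<integral>t. U x t * \<rho> t \<partial>lborel) - w x\<bar>
        \<le> (\<integral>\<^sup>+t. ennreal (\<bar>U x t - w x\<bar> * \<bar>\<rho> t\<bar>) \<partial>lborel)"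
      using lborel_pair.AE_integrable_fst[OF U]
    proof eventually_elim
      case (elim x)
      have *: "\<bar>\<rho> t\<bar> \<le> C" for t using \<rho>[of t] c by (cases "t \<in> {c1..c2}") auto
      have i1: "integrable lborel (\<lambda>t. U x t * \<rho> t)"
      proof (rule Bochner_Integration.integrable_bound)
        show "integrable lborel (\<lambda>t. C * U x t)" using elim by simp
        have "\<bar>U x t\<bar> * \<bar>\<rho> t\<bar> \<le> \<bar>U x t\<bar> * C" for t using * by (rule mult_left_mono) auto
        then show "AE t in lborel. norm (U x t * \<rho> t) \<le> norm (C * U x t)"
          using c by (simp add: abs_mult mult.commute)
      qed measurable
      have i2: "integrable lborel (\<lambda>t. w x * \<rho> t)" using \<rho>i by simp
      have "(\<integral>t. U x t * \<rho> t \<partial>lborel) - w x = (\<integral>t. U x t * \<rho> t - w x * \<rho> t \<partial>lborel)"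
        using i1 i2 one by simp
      also have "\<dots> = (\<integral>t. (U x t - w x) * \<rho> t \<partial>lborel)" by (simp add: algebra_simps)
      finally have eq: "(\<integral>t. U x t * \<rho> t \<partial>lborel) - w x = (\<integral>t. (U x t - w x) * \<rho> t \<partial>lborel)" .
      have "integrable lborel (\<lambda>t. (U x t - w x) * \<rho> t)"
        using Bochner_Integration.integrable_diff[OF i1 i2] by (simp add: algebra_simps)
      from integral_norm_bound_ennreal[OF this] show ?case
        unfolding eq by (simp add: abs_mult)
    qed
  qed
  also have "\<dots> = (\<integral>\<^sup>+t. (\<integral>\<^sup>+x. ennreal (\<bar>U x t - w x\<bar> * \<bar>\<rho> t\<bar>) \<partial>lborel) \<partial>lborel)"
    by (rule lborel_pair.Fubini'[symmetric]) measurable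
  also have "\<dots> \<le> (\<integral>\<^sup>+t. ennreal (C * e) * indicator {c1..c2} t \<partial>lborel)"
  proof (rule nn_integral_mono_AE)
    show "AE t in lborel. (\<integral>\<^sup>+x. ennreal (\<bar>U x t - w x\<bar> * \<bar>\<rho> t\<bar>) \<partial>lborel) \<le> ennreal (C * e) * indicator {c1..c2} t"
      using near
    proof eventually_elim
      case (elim t)
      have "(\<integral>\<^sup>+x. ennreal (\<bar>U x t - w x\<bar> * \<bar>\<rho> t\<bar>) \<partial>lborel)
          = (\<integral>\<^sup>+x. ennreal \<bar>U x t - w x\<bar> \<partial>lborel) * ennreal \<bar>\<rho> t\<bar>"
        by (simp add: ennreal_mult nn_integral_multc)
      also have "\<dots> \<le> ennreal (C * e) * indicator {c1..c2} t"
      proof (cases "t \<in> {c1..c2}")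
        case True
        then have "(\<integral>\<^sup>+x. ennreal \<bar>U x t - w x\<bar> \<partial>lborel) * ennreal \<bar>\<rho> t\<bar> \<le> ennreal e * ennreal C"
          using elim \<rho>[of t] by (intro mult_mono) (auto intro: ennreal_leI)
        then show ?thesis using True c by (simp add: ennreal_mult mult.commute)
      next
        case False
        then show ?thesis using \<rho>[of t] by simp
      qed
      finally show ?case .
    qed
  qed
  also have "\<dots> = ennreal (C * e) * ennreal (c2 - c1)"
    using c by (simp add: nn_integral_cmult_indicator)
  also have "\<dots> = ennreal (C * (c2 - c1) * e)"
    using c by (simp add: ennreal_mult[symmetric] mult_ac)
  finally show ?thesis .
qed

lemma cutoff_integral_tendsto:
  fixes F :: "real \<Rightarrow> real \<Rightarrow> real"
  assumes F: "integrable plane (case_prod F)" and b: "0 < b"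
  shows "(\<lambda>n. \<integral>\<^sup>+x. ennreal \<bar>(\<integral>t. F x t * cutoff (real n) b t \<partial>lborel) - (\<integral>t. F x t * indicator {0<..<b} t \<partial>lborel)\<bar> \<partial>lborel)
      \<longlonglongrightarrow> 0"
proof -
  let ?d = "\<lambda>n x. (\<integral>t. F x t * cutoff (real n) b t \<partial>lborel) - (\<integral>t. F x t * indicator {0<..<b} t \<partial>lborel)"
  define h where "h n t = cutoff (real n) b t - indicator {0<..<b} t" for n t
  have cm [measurable]: "cutoff k b \<in> borel_measurable borel" for k
    by (rule borel_measurable_continuous_onI[OF continuous_smooth_algebra[OF cutoff_smooth]])
  have Fm [measurable]: "case_prod F \<in> borel_measurable borel_plane"
    using borel_measurable_integrable[OF F] by (simp cong: measurable_cong_sets)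
  have hm [measurable]: "h n \<in> borel_measurable borel" for n unfolding h_def by measurable
  have h1: "\<bar>h n t\<bar> \<le> 1" for n t
    using cutoff_range[of "real n" b t] by (auto simp: h_def indicator_def)
  have lim: "(\<lambda>n. h n t) \<longlonglongrightarrow> 0" for t
  proof (rule tendsto_eventually)
    have inv: "(\<lambda>n. 2 / real n) \<longlonglongrightarrow> 0" by (rule lim_const_over_n)
    show "\<forall>\<^sub>F n in sequentially. h n t = 0"
    proof (cases "t \<in> {0<..<b}")
      case True
      then have "\<forall>\<^sub>F n in sequentially. 2 / real n < min t (b - t)"
        by (intro order_tendstoD(2)[OF inv]) auto
      then show ?thesis using eventually_gt_at_top[of 0]
      proof eventually_elim
        case (elim n)
        then show ?case using True cutoff_inside[of "real n" t b] by (auto simp: h_def)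
      qed
    next
      case False
      show ?thesis using eventually_gt_at_top[of 0]
      proof eventually_elim
        case (elim n)
        have "t \<notin> {r..b - r}" if "0 < r" for r using False that by auto
        then have "t \<notin> {1 / real n..b - 1 / real n}" using elim by simp
        then show ?case using False elim by (simp add: h_def cutoff_outside)
      qed
    qed
  qed
  have dct: "(\<lambda>n. \<integral>\<^sup>+z. ennreal (\<bar>case_prod F z\<bar> * \<bar>h n (snd z)\<bar>) \<partial>plane) \<longlonglongrightarrow> (\<integral>\<^sup>+(z::real \<times> real). 0 \<partial>plane)"
  proof (rule nn_integral_dominated_convergence[where w="\<lambda>z. ennreal \<bar>case_prod F z\<bar>"])
    show "AE z in plane. ennreal (\<bar>case_prod F z\<bar> * \<bar>h n (snd z)\<bar>) \<le> ennreal \<bar>case_prod F z\<bar>" for n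
      using h1 by (auto intro!: AE_I2 ennreal_leI mult_left_le)
    show "(\<integral>\<^sup>+z. ennreal \<bar>case_prod F z\<bar> \<partial>plane) < \<infinity>"
      using F unfolding integrable_iff_bounded by simp
    show "AE z in plane. (\<lambda>n. ennreal (\<bar>case_prod F z\<bar> * \<bar>h n (snd z)\<bar>)) \<longlonglongrightarrow> 0"
    proof (rule AE_I2)
      fix z :: "real \<times> real"
      have "(\<lambda>n. \<bar>case_prod F z\<bar> * \<bar>h n (snd z)\<bar>) \<longlonglongrightarrow> \<bar>case_prod F z\<bar> * \<bar>0\<bar>"
        by (intro tendsto_mult tendsto_const tendsto_rabs lim)
      from tendsto_ennrealI[OF this]
      show "(\<lambda>n. ennreal (\<bar>case_prod F z\<bar> * \<bar>h n (snd z)\<bar>)) \<longlonglongrightarrow> 0" by simp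
    qed
  qed measurable
  have bound: "(\<integral>\<^sup>+x. ennreal \<bar>?d n x\<bar> \<partial>lborel)
      \<le> (\<integral>\<^sup>+z. ennreal (\<bar>case_prod F z\<bar> * \<bar>h n (snd z)\<bar>) \<partial>plane)" for n
  proof -
    have "(\<integral>\<^sup>+x. ennreal \<bar>?d n x\<bar> \<partial>lborel)
       \<le> (\<integral>\<^sup>+x. (\<integral>\<^sup>+t. ennreal (\<bar>F x t\<bar> * \<bar>h n t\<bar>) \<partial>lborel) \<partial>lborel)"
    proof (rule nn_integral_mono_AE)
      show "AE x in lborel. ennreal \<bar>?d n x\<bar>
          \<le> (\<integral>\<^sup>+t. ennreal (\<bar>F x t\<bar> * \<bar>h n t\<bar>) \<partial>lborel)"
        using lborel_pair.AE_integrable_fst[OF F]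
      proof eventually_elim
        case (elim x)
        have i: "integrable lborel (\<lambda>t. F x t * \<eta> t)" if [measurable]: "\<eta> \<in> borel_measurable borel"
          and \<eta>: "\<And>t. \<bar>\<eta> t\<bar> \<le> 1" for \<eta> :: "real \<Rightarrow> real"
        proof (rule Bochner_Integration.integrable_bound[OF elim])
          show "AE t in lborel. norm (F x t * \<eta> t) \<le> norm (F x t)"
            using \<eta> by (auto simp: abs_mult intro!: mult_left_le)
        qed measurable
        have i12: "integrable lborel (\<lambda>t. F x t * cutoff (real n) b t)" "integrable lborel (\<lambda>t. F x t * indicator {0<..<b} t)"
          using cutoff_range[of "real n" b] by (auto intro!: i simp: abs_le_iff indicator_def)
        have eq: "?d n x
            = (\<integral>t. F x t * h n t \<partial>lborel)"
          unfolding h_def right_diff_distrib by (rule Bochner_Integration.integral_diff[OF i12, symmetric])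
        from integral_norm_bound_ennreal[OF i[OF hm h1]] show ?case
          unfolding eq by (simp add: abs_mult)
      qed
    qed
    also have "\<dots> = (\<integral>\<^sup>+z. ennreal (\<bar>case_prod F z\<bar> * \<bar>h n (snd z)\<bar>) \<partial>plane)"
      by (subst lborel.nn_integral_fst[symmetric]) auto
    finally show ?thesis .
  qed
  show ?thesis
    by (rule tendsto_sandwich[OF _ _ tendsto_const dct[simplified]]) (use bound in auto)
qed

text \<open>The derivative of \<open>cutoff k b\<close> is the difference of two approximate identities at \<open>0\<close> and at \<open>b\<close>. Hence,
  as \<open>k\<close> grows, the left-hand side of the weak equation tends to \<open>ua - ub\<close> in \<open>L\<^sup>1\<close>, and the right-hand side tends to
  \<open>- \<integral> F\<close> over \<open>(0, b)\<close>. The functions \<open>ua\<close> and \<open>ub\<close> stand for the values at the times \<open>0\<close> and \<open>b\<close>, to which \<open>U\<close>, being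
  given almost everywhere only, is linked by continuity in \<open>L\<^sup>1\<close>.\<close>

lemma weak_derivative_primitive:
  fixes U F :: "real \<Rightarrow> real \<Rightarrow> real" and ua ub :: "real \<Rightarrow> real"
  assumes U: "integrable plane (case_prod U)"
    and F: "integrable plane (case_prod F)"
    and weak: "\<And>\<phi>. test_function T \<phi> \<Longrightarrow>
       AE x in lborel. (\<integral>t. U x t * deriv \<phi> t \<partial>lborel) = - (\<integral>t. F x t * \<phi> t \<partial>lborel)"
    and b: "0 < b" "b \<le> T"
    and [measurable]: "ua \<in> borel_measurable borel" "ub \<in> borel_measurable borel"
    and ua: "\<And>e. 0 < e \<Longrightarrow> \<exists>\<delta>>0. AE t in lborel. t \<in> {0<..<\<delta>} \<longrightarrow> (\<integral>\<^sup>+x. ennreal \<bar>U x t - ua x\<bar> \<partial>lborel) \<le> ennreal e"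
    and ub: "\<And>e. 0 < e \<Longrightarrow> \<exists>\<delta>>0. AE t in lborel. t \<in> {b - \<delta><..<b} \<longrightarrow> (\<integral>\<^sup>+x. ennreal \<bar>U x t - ub x\<bar> \<partial>lborel) \<le> ennreal e"
  shows "AE x in lborel. ub x = ua x + (LINT t:{0..b}|lborel. F x t)"
proof -
  obtain C where C: "0 \<le> C" "\<And>s. \<bar>deriv step s\<bar> \<le> C * indicator {1..2} s"
    using deriv_step_bounded by metis
  have Um [measurable]: "case_prod U \<in> borel_measurable borel_plane"
      "case_prod F \<in> borel_measurable borel_plane"
    using borel_measurable_integrable[OF U] borel_measurable_integrable[OF F]
    by (simp_all cong: measurable_cong_sets)
  have [measurable]: "cutoff k b \<in> borel_measurable borel" for k b
    by (rule borel_measurable_continuous_onI[OF continuous_smooth_algebra[OF cutoff_smooth]])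
  define \<Phi> where "\<Phi> x = (\<integral>t. F x t * indicator {0<..<b} t \<partial>lborel)" for x
  have [measurable]: "\<Phi> \<in> borel_measurable borel" unfolding \<Phi>_def by measurable
  have small: "(\<integral>\<^sup>+x. ennreal \<bar>ub x - ua x - \<Phi> x\<bar> \<partial>lborel) \<le> ennreal (C * e + C * e + e)" if e: "0 < e" for e
  proof -
    obtain \<delta>1 where \<delta>1: "0 < \<delta>1" "AE t in lborel. t \<in> {0<..<\<delta>1} \<longrightarrow> (\<integral>\<^sup>+x. ennreal \<bar>U x t - ua x\<bar> \<partial>lborel) \<le> ennreal e"
      using ua[OF e] by blast
    obtain \<delta>2 where \<delta>2: "0 < \<delta>2" "AE t in lborel. t \<in> {b - \<delta>2<..<b} \<longrightarrow> (\<integral>\<^sup>+x. ennreal \<bar>U x t - ub x\<bar> \<partial>lborel) \<le> ennreal e"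
      using ub[OF e] by blast
    have "\<forall>\<^sub>F n in sequentially. (\<integral>\<^sup>+x. ennreal \<bar>(\<integral>t. F x t * cutoff (real n) b t \<partial>lborel) - \<Phi> x\<bar> \<partial>lborel) < ennreal e"
      using order_tendstoD(2)[OF cutoff_integral_tendsto[OF F b(1)], of "ennreal e"] e by (simp add: \<Phi>_def)
    moreover have "\<forall>\<^sub>F n in sequentially. 4 / real n < min b (min \<delta>1 \<delta>2)"
      using b \<delta>1(1) \<delta>2(1) by (intro order_tendstoD(2)[OF lim_const_over_n]) auto
    ultimately have "\<forall>\<^sub>F n in sequentially. 0 < n \<and> 4 / real n < min b (min \<delta>1 \<delta>2) \<and>
      (\<integral>\<^sup>+x. ennreal \<bar>(\<integral>t. F x t * cutoff (real n) b t \<partial>lborel) - \<Phi> x\<bar> \<partial>lborel) < ennreal e"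
      using eventually_gt_at_top[of 0] by eventually_elim blast
    then obtain n where n: "0 < n" "4 / real n < min b (min \<delta>1 \<delta>2)"
      and Fn: "(\<integral>\<^sup>+x. ennreal \<bar>(\<integral>t. F x t * cutoff (real n) b t \<partial>lborel) - \<Phi> x\<bar> \<partial>lborel) < ennreal e"
      using eventually_happens'[OF sequentially_bot] by blast
    \<comment> \<open>The support of the derivative of the cut-off lies within \<open>2/k\<close> of \<open>0\<close> and of \<open>b\<close>.\<close>
    define k where "k = real n"
    have k: "0 < k" "4 < k * b" "2 / k < \<delta>1" "2 / k < \<delta>2" "0 < 1 / k"
      using n b by (auto simp: k_def field_simps)
    define A where "A x = (\<integral>t. U x t * (k * deriv step (k * t)) \<partial>lborel)" for x
    define D where "D x = (\<integral>t. U x t * (k * deriv step (k * (b - t))) \<partial>lborel)" for x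
    have [measurable]: "A \<in> borel_measurable borel" "D \<in> borel_measurable borel"
      unfolding A_def D_def by measurable
    have A: "(\<integral>\<^sup>+x. ennreal \<bar>A x - ua x\<bar> \<partial>lborel) \<le> ennreal (k * C * (2 / k - 1 / k) * e)"
      unfolding A_def
    proof (rule approximate_identity[OF U])
      show "\<bar>k * deriv step (k * t)\<bar> \<le> k * C * indicator {1 / k..2 / k} t" for t
        using C(2)[of "k * t"] k by (auto simp: abs_mult indicator_def field_simps split: if_splits)
      show "(\<integral>t. k * deriv step (k * t) \<partial>lborel) = 1"
        using integral_scaled_deriv_step[of k 0] k by simp
      show "AE t in lborel. t \<in> {1 / k..2 / k} \<longrightarrow> (\<integral>\<^sup>+x. ennreal \<bar>U x t - ua x\<bar> \<partial>lborel) \<le> ennreal e"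
        using \<delta>1(2)
      proof eventually_elim
        case (elim t)
        have "t \<in> {r..2 / k} \<Longrightarrow> 0 < r \<Longrightarrow> t \<in> {0<..<\<delta>1}" for r using k by auto
        from this[of "1 / k"] show ?case using elim k by blast
      qed
    qed (use k C e in \<open>auto intro: divide_right_mono\<close>)
    have D: "(\<integral>\<^sup>+x. ennreal \<bar>D x - ub x\<bar> \<partial>lborel) \<le> ennreal (k * C * ((b - 1 / k) - (b - 2 / k)) * e)"
      unfolding D_def
    proof (rule approximate_identity[OF U])
      show "\<bar>k * deriv step (k * (b - t))\<bar> \<le> k * C * indicator {b - 2 / k..b - 1 / k} t" for t
        using C(2)[of "k * (b - t)"] k by (auto simp: abs_mult indicator_def field_simps split: if_splits)
      show "(\<integral>t. k * deriv step (k * (b - t)) \<partial>lborel) = 1"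
        using integral_scaled_deriv_step[of "- k" "k * b"] k by (simp add: algebra_simps)
      show "AE t in lborel. t \<in> {b - 2 / k..b - 1 / k} \<longrightarrow> (\<integral>\<^sup>+x. ennreal \<bar>U x t - ub x\<bar> \<partial>lborel) \<le> ennreal e"
        using \<delta>2(2)
      proof eventually_elim
        case (elim t)
        have "t \<in> {b - 2 / k..b - r} \<Longrightarrow> 0 < r \<Longrightarrow> t \<in> {b - \<delta>2<..<b}" for r using k by auto
        from this[of "1 / k"] show ?case using elim k by blast
      qed
    qed (use k C e in \<open>auto intro: divide_right_mono\<close>)
    have AD: "AE x in lborel. A x - D x = - (\<integral>t. F x t * cutoff k b t \<partial>lborel)"
      using weak[OF cutoff_test_function[OF k(1) b(2)]] lborel_pair.AE_integrable_fst[OF U]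
    proof eventually_elim
      case (elim x)
      have bound: "\<bar>k * deriv step s\<bar> \<le> k * C" for s
        using C(1) C(2)[of s] k by (cases "s \<in> {1..2}") (auto simp: abs_mult)
      have i: "integrable lborel (\<lambda>t. U x t * (k * deriv step (\<eta> t)))" if [measurable]: "\<eta> \<in> borel_measurable borel" for \<eta>
      proof (rule Bochner_Integration.integrable_bound)
        show "integrable lborel (\<lambda>t. (k * C) * U x t)" using elim(2) by simp
        have "\<bar>U x t\<bar> * \<bar>k * deriv step (\<eta> t)\<bar> \<le> \<bar>U x t\<bar> * (k * C)" for t
          by (intro mult_left_mono bound) auto
        then show "AE t in lborel. norm (U x t * (k * deriv step (\<eta> t))) \<le> norm ((k * C) * U x t)"
          using k C by (simp add: abs_mult mult_ac)
      qed measurable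
      have "A x - D x = (\<integral>t. U x t * deriv (cutoff k b) t \<partial>lborel)"
        unfolding A_def D_def deriv_cutoff[OF k(1,2)] right_diff_distrib
        by (rule Bochner_Integration.integral_diff[symmetric]) (auto intro!: i)
      then show ?case using elim(1) by simp
    qed
    have "(\<integral>\<^sup>+x. ennreal \<bar>ub x - ua x - \<Phi> x\<bar> \<partial>lborel)
        \<le> (\<integral>\<^sup>+x. ennreal \<bar>A x - ua x\<bar> + ennreal \<bar>D x - ub x\<bar>
             + ennreal \<bar>(\<integral>t. F x t * cutoff k b t \<partial>lborel) - \<Phi> x\<bar> \<partial>lborel)"
    proof (rule nn_integral_mono_AE)
      show "AE x in lborel. ennreal \<bar>ub x - ua x - \<Phi> x\<bar> \<le> ennreal \<bar>A x - ua x\<bar> + ennreal \<bar>D x - ub x\<bar>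
             + ennreal \<bar>(\<integral>t. F x t * cutoff k b t \<partial>lborel) - \<Phi> x\<bar>"
        using AD
      proof eventually_elim
        case (elim x)
        then have "\<bar>ub x - ua x - \<Phi> x\<bar> \<le> \<bar>A x - ua x\<bar> + \<bar>D x - ub x\<bar>
             + \<bar>(\<integral>t. F x t * cutoff k b t \<partial>lborel) - \<Phi> x\<bar>" by linarith
        then show ?case by (simp flip: ennreal_plus)
      qed
    qed
    also have "\<dots> = (\<integral>\<^sup>+x. ennreal \<bar>A x - ua x\<bar> \<partial>lborel) + (\<integral>\<^sup>+x. ennreal \<bar>D x - ub x\<bar> \<partial>lborel)
        + (\<integral>\<^sup>+x. ennreal \<bar>(\<integral>t. F x t * cutoff k b t \<partial>lborel) - \<Phi> x\<bar> \<partial>lborel)"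
      by (subst nn_integral_add, measurable, subst nn_integral_add, measurable)
    also have "\<dots> \<le> ennreal (k * C * (2 / k - 1 / k) * e) + ennreal (k * C * ((b - 1 / k) - (b - 2 / k)) * e) + ennreal e"
      using A D Fn by (intro add_mono) (auto simp: k_def)
    also have "\<dots> = ennreal (C * e + C * e + e)"
      using k C e by (simp add: field_simps flip: ennreal_plus)
    finally show ?thesis .
  qed
  have eps: "(\<integral>\<^sup>+x. ennreal \<bar>ub x - ua x - \<Phi> x\<bar> \<partial>lborel) \<le> 0 + ennreal \<epsilon>" if "0 < \<epsilon>" for \<epsilon>
  proof -
    have "0 < \<epsilon> / (2 * C + 1)" using C that by auto
    moreover have "C * (\<epsilon> / (2 * C + 1)) + C * (\<epsilon> / (2 * C + 1)) + \<epsilon> / (2 * C + 1) = \<epsilon>"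
      using C(1) by (simp add: divide_simps) (simp add: algebra_simps)
    ultimately show ?thesis using small[of "\<epsilon> / (2 * C + 1)"] by simp
  qed
  have "(\<integral>\<^sup>+x. ennreal \<bar>ub x - ua x - \<Phi> x\<bar> \<partial>lborel) \<le> 0"
    by (rule ennreal_le_epsilon, rule eps)
  then have zero: "AE x in lborel. ennreal \<bar>ub x - ua x - \<Phi> x\<bar> = 0"
    by (subst (asm) le_zero_eq, subst (asm) nn_integral_0_iff_AE) auto
  have "\<Phi> x = (LINT t:{0..b}|lborel. F x t)" for x
    unfolding \<Phi>_def set_lebesgue_integral_def
  proof (rule integral_cong_AE)
    \<comment> \<open>The cut-offs converge pointwise to the indicator of the open interval; the end points form a null set.\<close>
    show "AE t in lborel. F x t * indicator {0<..<b} t = indicator {0..b} t *\<^sub>R F x t"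
      using AE_lborel_singleton[of 0] AE_lborel_singleton[of b] by eventually_elim (auto simp: indicator_def)
  qed measurable
  with zero show ?thesis by (auto elim!: eventually_mono)
qed

section \<open>Borel versions of Lebesgue measurable data\<close>

lemma AE_lebesgue_on_iff:
  "S \<in> sets borel \<Longrightarrow> (AE x in lebesgue_on S. P x) \<longleftrightarrow> (AE x in lborel. x \<in> S \<longrightarrow> P x)"
  by (subst AE_restrict_space_iff) (auto simp: AE_completion_iff)

text \<open>The product of two completed measures is not complete. Therefore Fubini's theorem is applied to Borel
  functions and to \<open>lborel\<close>, and this lemma translates the integrals.\<close>

lemma lebesgue_on_transfer:
  fixes f g :: "'a::euclidean_space \<Rightarrow> real"
  assumes S [measurable]: "S \<in> sets borel" and g [measurable]: "g \<in> borel_measurable borel"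
    and eq: "AE x in lborel. x \<in> S \<longrightarrow> f x = g x"
  shows "f \<in> borel_measurable (lebesgue_on S)"
    "integrable (lebesgue_on S) f \<longleftrightarrow> integrable lborel (\<lambda>x. indicator S x * g x)"
    "integral\<^sup>L (lebesgue_on S) f = (\<integral>x. indicator S x * g x \<partial>lborel)"
proof -
  have S': "S \<inter> space lebesgue \<in> sets lebesgue" using S by auto
  have gm: "(\<lambda>x. indicator S x * g x) \<in> borel_measurable lborel" by measurable
  have gm': "(\<lambda>x. indicator S x * g x) \<in> borel_measurable lebesgue" by (rule measurable_completion[OF gm])
  have ae: "AE x in lebesgue. indicator S x * g x = indicator S x *\<^sub>R f x"
    using AE_completion[OF eq] by (auto elim!: eventually_mono simp: indicator_def)
  then have fm: "(\<lambda>x. indicator S x *\<^sub>R f x) \<in> borel_measurable lebesgue"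
    by (rule borel_measurable_AE[OF gm'])
  show "f \<in> borel_measurable (lebesgue_on S)"
    using fm borel_measurable_restrict_space_iff[OF S'] by blast
  have "integrable (lebesgue_on S) f \<longleftrightarrow> integrable lebesgue (\<lambda>x. indicator S x *\<^sub>R f x)"
    by (rule integrable_restrict_space[OF S'])
  also have "\<dots> \<longleftrightarrow> integrable lebesgue (\<lambda>x. indicator S x * g x)"
    by (rule integrable_cong_AE[OF fm gm']) (use ae in \<open>auto elim!: eventually_mono\<close>)
  also have "\<dots> \<longleftrightarrow> integrable lborel (\<lambda>x. indicator S x * g x)"
    by (rule integrable_completion[OF gm])
  finally show "integrable (lebesgue_on S) f \<longleftrightarrow> integrable lborel (\<lambda>x. indicator S x * g x)" .
  have "integral\<^sup>L (lebesgue_on S) f = (\<integral>x. indicator S x *\<^sub>R f x \<partial>lebesgue)"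
    by (rule integral_restrict_space[OF S'])
  also have "\<dots> = (\<integral>x. indicator S x * g x \<partial>lebesgue)"
    by (rule integral_cong_AE[OF fm gm']) (use ae in \<open>auto elim!: eventually_mono\<close>)
  also have "\<dots> = (\<integral>x. indicator S x * g x \<partial>lborel)"
    by (rule integral_completion[OF gm])
  finally show "integral\<^sup>L (lebesgue_on S) f = (\<integral>x. indicator S x * g x \<partial>lborel)" .
qed

lemma borel_version:
  fixes f :: "'a::euclidean_space \<Rightarrow> real"
  assumes S [measurable]: "S \<in> sets borel" and f: "f \<in> borel_measurable (lebesgue_on S)"
  shows "\<exists>g. g \<in> borel_measurable borel \<and> (AE x in lborel. x \<in> S \<longrightarrow> f x = g x) \<and> (\<forall>x. x \<notin> S \<longrightarrow> g x = 0)"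
proof -
  have S': "S \<inter> space lebesgue \<in> sets lebesgue" using S by auto
  have "(\<lambda>x. indicator S x *\<^sub>R f x) \<in> borel_measurable lebesgue"
    using f borel_measurable_restrict_space_iff[OF S'] by blast
  then obtain g where g: "g \<in> borel_measurable lborel" "AE x in lborel. indicator S x *\<^sub>R f x = g x"
    using completion_ex_borel_measurable_real by blast
  have [measurable]: "g \<in> borel_measurable borel" using g(1) by simp
  show ?thesis
  proof (intro exI[of _ "\<lambda>x. indicator S x * g x"] conjI)
    show "AE x in lborel. x \<in> S \<longrightarrow> f x = indicator S x * g x"
      using g(2) by eventually_elim auto
  qed auto
qed

text \<open>The second claim passes through a Borel null set, because \<open>P\<close> need not be measurable.\<close>

lemma AE_pair_both:
  fixes P :: "real \<times> real \<Rightarrow> bool"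
  assumes "AE z in lborel. P z"
  shows "AE x in lborel. AE y in lborel. P (x, y)" "AE y in lborel. AE x in lborel. P (x, y)"
proof -
  have P: "AE z in plane. P z" by (subst lborel_prod) (rule assms)
  then show "AE x in lborel. AE y in lborel. P (x, y)" by (rule lborel_pair.AE_pair)
  obtain N where N: "N \<in> null_sets plane" "\<And>z. z \<notin> N \<Longrightarrow> P z"
    using P unfolding eventually_ae_filter by (auto simp: space_pair_measure)
  then have [measurable]: "N \<in> sets plane" by auto
  have "AE z in plane. z \<notin> N" using N(1) by (rule AE_not_in)
  then have "AE x in lborel. AE y in lborel. (x, y) \<notin> N" by (rule lborel_pair.AE_pair)
  then have "AE y in lborel. AE x in lborel. (x, y) \<notin> N"
    by (subst (asm) lborel_pair.AE_commute, measurable)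
  then show "AE y in lborel. AE x in lborel. P (x, y)"
    by (rule AE_mp) (auto intro!: AE_I2 elim!: eventually_mono simp: N(2))
qed

lemma AE_pair_product:
  fixes P Q :: "real \<Rightarrow> bool"
  assumes P: "AE x in lborel. P x" and Q: "AE y in lborel. Q y"
  shows "AE z in lborel. P (fst z) \<and> Q (snd z)"
proof -
  obtain N where N: "N \<in> null_sets lborel" "\<And>x. x \<notin> N \<Longrightarrow> P x"
    using P unfolding eventually_ae_filter by auto
  obtain M where M: "M \<in> null_sets lborel" "\<And>x. x \<notin> M \<Longrightarrow> Q x"
    using Q unfolding eventually_ae_filter by auto
  have [measurable]: "N \<in> sets borel" "M \<in> sets borel" using N(1) M(1) by auto
  have "AE z in plane. fst z \<notin> N \<and> snd z \<notin> M"
  proof (rule lborel_pair.AE_pair_measure)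
    show "AE x in lborel. AE y in lborel. fst (x, y) \<notin> N \<and> snd (x, y) \<notin> M"
      using AE_not_in[OF N(1)] AE_not_in[OF M(1)] by auto
  qed measurable
  then show ?thesis unfolding lborel_prod by eventually_elim (use N M in auto)
qed

lemma AE_swap:
  fixes P :: "real \<times> real \<Rightarrow> bool"
  assumes "AE z in lborel. P z"
  shows "AE z in lborel. P (snd z, fst z)"
proof -
  have "AE z in plane. P z" by (subst lborel_prod) (rule assms)
  then have "AE z in distr plane plane (\<lambda>(x, y). (y, x)). P z"
    using lborel_pair.distr_pair_swap by metis
  then have "AE z in plane. P (case z of (x, y) \<Rightarrow> (y, x))"
    by (rule AE_distrD[rotated]) measurable
  then show ?thesis unfolding lborel_prod by (simp add: case_prod_beta')
qed

definition kernel_version :: "real \<Rightarrow> (real \<times> real \<Rightarrow> real) \<Rightarrow> (real \<Rightarrow> real \<Rightarrow> real) \<Rightarrow> bool" where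
  "kernel_version B K k \<longleftrightarrow> regular_kernel B k \<and> (AE z in lborel. z \<in> Omega \<times> Omega \<longrightarrow> K z = case_prod k z)"

definition datum_version :: "real \<Rightarrow> (real \<Rightarrow> real) \<Rightarrow> (real \<Rightarrow> real) \<Rightarrow> bool" where
  "datum_version M g h \<longleftrightarrow> h \<in> borel_measurable borel \<and> (\<forall>x. \<bar>h x\<bar> \<le> M * indicator Omega x) \<and>
     (AE x in lborel. x \<in> Omega \<longrightarrow> g x = h x)"

lemma Omega_square_sets [measurable]: "Omega \<times> Omega \<in> sets borel"
  unfolding borel_prod[symmetric] by auto

lemma ex_datum_version:
  assumes "g \<in> Linfty (lebesgue_on Omega)"
  shows "\<exists>M h. 0 \<le> M \<and> datum_version M g h"
proof -
  obtain M where gm: "g \<in> borel_measurable (lebesgue_on Omega)" and M: "AE x in lebesgue_on Omega. \<bar>g x\<bar> \<le> M"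
    using assms by (auto simp: Linfty_def)
  obtain h where [measurable]: "h \<in> borel_measurable borel" and h: "AE x in lborel. x \<in> Omega \<longrightarrow> g x = h x"
    using borel_version[OF Omega_sets gm] by blast
  have M': "AE x in lborel. x \<in> Omega \<longrightarrow> \<bar>g x\<bar> \<le> M" using M by (simp add: AE_lebesgue_on_iff)
  define h' where "h' x = (if x \<in> Omega \<and> \<bar>h x\<bar> \<le> M then h x else 0)" for x
  have "datum_version \<bar>M\<bar> g h'"
    unfolding datum_version_def
  proof (intro conjI allI)
    show "h' \<in> borel_measurable borel" unfolding h'_def by measurable
    show "\<bar>h' x\<bar> \<le> \<bar>M\<bar> * indicator Omega x" for x by (auto simp: h'_def)
    show "AE x in lborel. x \<in> Omega \<longrightarrow> g x = h' x"
      using h M' by eventually_elim (auto simp: h'_def)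
  qed
  then show ?thesis by (intro exI[of _ "\<bar>M\<bar>"]) auto
qed

text \<open>Averaging a Borel version over \<open>(x, y)\<close> and \<open>(y, x)\<close> makes it symmetric at every point. It remains a version of
  \<open>K\<close>, because \<open>K\<close> is symmetric and the reflection preserves null sets.\<close>

lemma ex_kernel_version:
  assumes K: "symmetric_kernel K"
  shows "\<exists>B k. kernel_version B K k"
proof -
  have Km: "K \<in> borel_measurable (lebesgue_on (Omega \<times> Omega))"
    and sym: "\<And>x y. x \<in> Omega \<Longrightarrow> y \<in> Omega \<Longrightarrow> K (x, y) = K (y, x)"
    and nonneg: "\<And>z. z \<in> Omega \<times> Omega \<Longrightarrow> 0 \<le> K z"
    and bdd: "bounded (K ` (Omega \<times> Omega))"
    using K by (auto simp: symmetric_kernel_def)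
  obtain B where B: "\<And>z. z \<in> Omega \<times> Omega \<Longrightarrow> \<bar>K z\<bar> \<le> B" using bdd by (auto simp: bounded_iff)
  obtain h where [measurable]: "h \<in> borel_measurable borel"
    and h: "AE z in lborel. z \<in> Omega \<times> Omega \<longrightarrow> K z = h z"
    using borel_version[OF Omega_square_sets Km] by blast
  have hm [measurable]: "h \<in> borel_measurable borel_plane" unfolding borel_prod by simp
  define c where "c x y = max 0 (min B (h (x, y))) * (indicator Omega x * indicator Omega y)" for x y
  define k where "k x y = (c x y + c y x) / 2" for x y
  have B0: "0 \<le> B" using order_trans[OF abs_ge_zero B[of "(0, 0)"]] by (auto simp: Omega_def)
  have "kernel_version B K k"
    unfolding kernel_version_def regular_kernel_def
  proof (intro conjI allI)
    show "case_prod k \<in> borel_measurable borel_plane" unfolding k_def c_def by measurable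
    have c: "0 \<le> c x y" "c x y \<le> B * (indicator Omega x * indicator Omega y)" for x y
      using B0 by (auto simp: c_def indicator_def)
    show "0 \<le> k x y" for x y using c[of x y] c[of y x] by (simp add: k_def)
    show "k x y \<le> B * (indicator Omega x * indicator Omega y)" for x y
      using c[of x y] c[of y x] by (simp add: k_def mult_ac)
    show "k x y = k y x" for x y by (simp add: k_def add.commute)
    show "AE z in lborel. z \<in> Omega \<times> Omega \<longrightarrow> K z = case_prod k z"
      using h AE_swap[OF h]
    proof eventually_elim
      case (elim z)
      obtain x y where z: "z = (x, y)" by (cases z)
      show ?case
      proof
        assume "z \<in> Omega \<times> Omega"
        then have xy: "x \<in> Omega" "y \<in> Omega" by (auto simp: z)
        then have "h (x, y) = K (x, y)" "h (y, x) = K (x, y)" "0 \<le> K (x, y)" "K (x, y) \<le> B"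
          using elim sym[OF xy] nonneg[of "(x, y)"] B[of "(x, y)"] by (auto simp: z)
        then show "K z = case_prod k z" using xy by (simp add: z k_def c_def)
      qed
    qed
  qed
  then show ?thesis by blast
qed

text \<open>The exceptional set of \<open>x\<close> depends on \<open>K\<close> and \<open>k\<close> only, and not on \<open>u\<close> and \<open>v\<close>. Hence the same null set serves for all
  times \<open>t\<close> when this is applied to \<open>u(\<cdot>, t)\<close>.\<close>

lemma p_Laplacian_version:
  assumes k: "kernel_version B K k"
  shows "AE x in lborel. x \<in> Omega \<longrightarrow> (\<forall>u v. v \<in> borel_measurable borel \<longrightarrow>
     (AE y in lborel. y \<in> Omega \<longrightarrow> u y = v y) \<longrightarrow> u x = v x \<longrightarrow>
     - p_Laplacian p K u x = (\<integral>y. k x y * flux p (v y - v x) \<partial>lborel))"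
proof -
  have [measurable]: "case_prod k \<in> borel_measurable borel_plane" and nk: "regular_kernel B k"
    using k by (auto simp: kernel_version_def regular_kernel_def)
  have "AE x in lborel. AE y in lborel. (x, y) \<in> Omega \<times> Omega \<longrightarrow> K (x, y) = k x y"
    using k AE_pair_both(1)[of "\<lambda>z. z \<in> Omega \<times> Omega \<longrightarrow> K z = case_prod k z"] by (auto simp: kernel_version_def)
  then show ?thesis
  proof eventually_elim
    case (elim x)
    show ?case
    proof (intro impI allI)
      fix u v :: "real \<Rightarrow> real"
      assume x: "x \<in> Omega" and [measurable]: "v \<in> borel_measurable borel"
        and u: "AE y in lborel. y \<in> Omega \<longrightarrow> u y = v y" and ux: "u x = v x"
      have "- p_Laplacian p K u x = (LINT y|lebesgue_on Omega. K (x, y) * \<bar>u y - u x\<bar> powr (p - 2) * (u y - u x))"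
        by (simp add: p_Laplacian_def)
      also have "\<dots> = (\<integral>y. indicator Omega y * (k x y * flux p (v y - v x)) \<partial>lborel)"
      proof (rule lebesgue_on_transfer(3))
        show "AE y in lborel. y \<in> Omega \<longrightarrow> K (x, y) * \<bar>u y - u x\<bar> powr (p - 2) * (u y - u x) = k x y * flux p (v y - v x)"
          using elim u by eventually_elim (use x ux in \<open>auto simp: flux_def\<close>)
      qed measurable
      also have "\<dots> = (\<integral>y. k x y * flux p (v y - v x) \<partial>lborel)"
        by (rule Bochner_Integration.integral_cong) (auto simp: indicator_def regular_kernel_off[OF nk])
      finally show "- p_Laplacian p K u x = (\<integral>y. k x y * flux p (v y - v x) \<partial>lborel)" .
    qed
  qed
qed

lemma p_Laplacian_domain_version:
  assumes k: "kernel_version B K k" and [measurable]: "v \<in> borel_measurable borel"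
    and u: "AE x in lborel. x \<in> Omega \<longrightarrow> u x = v x"
  shows "in_p_Laplacian_domain p K u \<longleftrightarrow> integrable plane (\<lambda>(x, y). k x y * flux p (v y - v x))"
proof -
  have km [measurable]: "case_prod k \<in> borel_measurable borel_plane" and nk: "regular_kernel B k"
    and kK: "AE z in lborel. z \<in> Omega \<times> Omega \<longrightarrow> K z = case_prod k z"
    using k by (auto simp: kernel_version_def regular_kernel_def)
  have "in_p_Laplacian_domain p K u \<longleftrightarrow>
      integrable lborel (\<lambda>z. indicator (Omega \<times> Omega) z * (case z of (x, y) \<Rightarrow> k x y * flux p (v y - v x)))"
    unfolding in_p_Laplacian_domain_def
  proof (rule lebesgue_on_transfer(2)[OF Omega_square_sets])
    have "(\<lambda>(x, y). k x y * flux p (v y - v x)) \<in> borel_measurable borel_plane" by measurable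
    then show "(\<lambda>(x, y). k x y * flux p (v y - v x)) \<in> borel_measurable borel" by (simp add: borel_prod)
    show "AE z in lborel. z \<in> Omega \<times> Omega \<longrightarrow>
        (case z of (x, y) \<Rightarrow> K (x, y) * \<bar>u y - u x\<bar> powr (p - 2) * (u y - u x)) = (case z of (x, y) \<Rightarrow> k x y * flux p (v y - v x))"
      using kK AE_pair_product[OF u u] by eventually_elim (auto simp: flux_def)
  qed
  also have "\<dots> \<longleftrightarrow> integrable lborel (\<lambda>(x, y). k x y * flux p (v y - v x))"
  proof (rule Bochner_Integration.integrable_cong[OF refl])
    fix z :: "real \<times> real"
    show "indicator (Omega \<times> Omega) z * (case z of (x, y) \<Rightarrow> k x y * flux p (v y - v x))
        = (case z of (x, y) \<Rightarrow> k x y * flux p (v y - v x))"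
      using regular_kernel_off[OF nk, of "fst z" "snd z"] by (cases z) (auto simp: indicator_def)
  qed
  finally show ?thesis unfolding lborel_prod .
qed

section \<open>Solutions as Borel evolutions\<close>

lemma test_functionD:
  assumes "test_function T \<phi>"
  shows "(\<phi> has_real_derivative deriv \<phi> t) (at t)" "continuous_on S \<phi>" "continuous_on S (deriv \<phi>)"
    "t \<le> 0 \<Longrightarrow> \<phi> t = 0" "T \<le> t \<Longrightarrow> \<phi> t = 0"
proof -
  have "(deriv ^^ 0) \<phi> field_differentiable at t" "(deriv ^^ 1) \<phi> field_differentiable at t" for t
    using assms unfolding test_function_def by blast+
  then have d: "\<phi> field_differentiable at t" "deriv \<phi> field_differentiable at t" for t by simp_all
  show "(\<phi> has_real_derivative deriv \<phi> t) (at t)"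
    using d(1) DERIV_deriv_iff_field_differentiable by blast
  show "continuous_on S \<phi>" "continuous_on S (deriv \<phi>)"
    using d field_differentiable_imp_continuous_at continuous_at_imp_continuous_on by blast+
  obtain a b where "0 < a" "b < T" "\<And>t. t \<notin> {a..b} \<Longrightarrow> \<phi> t = 0"
    using assms unfolding test_function_def by blast
  then show "t \<le> 0 \<Longrightarrow> \<phi> t = 0" "T \<le> t \<Longrightarrow> \<phi> t = 0" by auto
qed

lemma test_function_measurable:
  assumes "test_function T \<phi>"
  shows "\<phi> \<in> borel_measurable borel" "deriv \<phi> \<in> borel_measurable borel"
  using test_functionD(2,3)[OF assms] by (auto intro: borel_measurable_continuous_onI)

lemma integral_deriv_test_function:
  assumes \<phi>: "test_function T \<phi>" and s: "s \<le> T"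
  shows "(\<integral>t. indicator {s..T} t * deriv \<phi> t \<partial>lborel) = - \<phi> s"
proof -
  have "(\<integral>t. indicator {s..T} t *\<^sub>R deriv \<phi> t \<partial>lborel) = \<phi> T - \<phi> s"
    by (rule integral_FTC_atLeastAtMost[OF s])
       (auto intro!: test_functionD[OF \<phi>] DERIV_subset[OF test_functionD(1)[OF \<phi>]]
         simp flip: has_real_derivative_iff_has_vector_derivative)
  then show ?thesis using test_functionD(5)[OF \<phi>, of T] by simp
qed

text \<open>Fubini's theorem on the triangle \<open>s \<le> t\<close>, for the function \<open>\<phi>'(t) q(s)\<close>.\<close>

lemma primitive_integration_by_parts:
  fixes q z \<phi> :: "real \<Rightarrow> real"
  assumes T: "0 < T" and [measurable]: "q \<in> borel_measurable borel" "z \<in> borel_measurable borel"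
    and q: "\<And>s. \<bar>q s\<bar> \<le> C"
    and z: "\<And>t. t \<in> {0..T} \<Longrightarrow> z t = z0 + (LINT s:{0..t}|lborel. q s)"
    and \<phi>: "test_function T \<phi>"
  shows "(\<integral>t. indicator {0<..<T} t * (z t * deriv \<phi> t) \<partial>lborel)
    = - (\<integral>t. indicator {0<..<T} t * (q t * \<phi> t) \<partial>lborel)"
proof -
  note [measurable] = test_function_measurable[OF \<phi>]
  obtain D where D: "\<forall>t\<in>{0..T}. \<bar>deriv \<phi> t\<bar> \<le> D"
    using compact_imp_bounded[OF compact_continuous_image[OF test_functionD(3)[OF \<phi>] compact_Icc[of 0 T]]]
    by (auto simp: bounded_iff)
  have CD: "0 \<le> C" "0 \<le> D" using q[of 0] D T order_trans[OF abs_ge_zero] by (auto dest!: bspec[of _ _ 0])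
  define H where "H t s = (indicator {0..T} t * deriv \<phi> t) * ((if 0 \<le> s \<and> s \<le> t then 1 else 0) * q s)" for t s
  have sq: "integrable plane (\<lambda>(t, s). indicator {0..T} t * indicator {0..T} s :: real)"
  proof -
    have "emeasure plane ({0..T} \<times> {0..T}) < \<infinity>"
      using T by (subst lborel.emeasure_pair_measure_Times) (auto simp: ennreal_mult_less_top)
    then have "integrable plane (indicator ({0..T} \<times> {0..T}) :: real \<times> real \<Rightarrow> real)"
      by (intro integrable_real_indicator) auto
    then show ?thesis
      by (rule Bochner_Integration.integrable_cong[THEN iffD1, OF refl, rotated]) (auto simp: indicator_def)
  qed
  have H: "integrable plane (case_prod H)"
  proof (rule Bochner_Integration.integrable_bound)
    show "integrable plane (\<lambda>w. (D * C) * (case w of (t, s) \<Rightarrow> indicator {0..T} t * indicator {0..T} s))"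
      by (intro integrable_mult_right sq)
    show "case_prod H \<in> borel_measurable plane" unfolding H_def by measurable
    have "\<bar>H t s\<bar> \<le> D * C * (indicator {0..T} t * indicator {0..T} s)" for t s
    proof (cases "t \<in> {0..T} \<and> 0 \<le> s \<and> s \<le> t")
      case True
      then have "\<bar>deriv \<phi> t\<bar> * \<bar>q s\<bar> \<le> D * C"
        using q[of s] D CD by (intro mult_mono) auto
      then show ?thesis using True by (simp add: H_def abs_mult)
    qed (use CD in \<open>auto simp: H_def indicator_def\<close>)
    then show "AE w in plane. norm (case_prod H w) \<le> norm ((D * C) * (case w of (t, s) \<Rightarrow> indicator {0..T} t * indicator {0..T} s))"
      using CD by (auto intro!: AE_I2 simp: abs_mult)
  qed
  have inner1: "(\<integral>s. H t s \<partial>lborel) = indicator {0..T} t * (deriv \<phi> t * (z t - z0))" for t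
  proof (cases "t \<in> {0..T}")
    case True
    have "(\<integral>s. (if 0 \<le> s \<and> s \<le> t then 1 else 0) * q s \<partial>lborel) = (LINT s:{0..t}|lborel. q s)"
      unfolding set_lebesgue_integral_def
      by (rule Bochner_Integration.integral_cong) (auto simp: indicator_def)
    then show ?thesis using True z[OF True] by (simp add: H_def)
  qed (simp add: H_def)
  have inner2: "(\<integral>t. H t s \<partial>lborel) = - (indicator {0<..<T} s * (q s * \<phi> s))" for s
  proof (cases "s \<in> {0..T}")
    case True
    have "(\<integral>t. H t s \<partial>lborel) = (\<integral>t. q s * (indicator {s..T} t * deriv \<phi> t) \<partial>lborel)"
      using True by (intro Bochner_Integration.integral_cong) (auto simp: H_def indicator_def)
    also have "\<dots> = - (q s * \<phi> s)"
      using integral_deriv_test_function[OF \<phi>, of s] True by simp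
    finally show ?thesis
      using True test_functionD(4,5)[OF \<phi>, of s]
      by (cases "s = 0"; cases "s = T") (auto simp: indicator_def)
  next
    case False
    then have "H t s = 0" for t by (auto simp: H_def indicator_def)
    then show ?thesis using False by (auto simp: indicator_def)
  qed
  have zi: "integrable lborel (\<lambda>t. indicator {0..T} t * (deriv \<phi> t * (z t - z0)))"
    using lborel_pair.integrable_fst[OF H] by (simp add: inner1)
  have ci: "integrable lborel (\<lambda>t. indicator {0..T} t * deriv \<phi> t)"
    using borel_integrable_atLeastAtMost'[OF test_functionD(3)[OF \<phi>], of 0 T]
    by (simp add: set_integrable_def)
  have "(\<integral>t. indicator {0<..<T} t * (z t * deriv \<phi> t) \<partial>lborel)
      = (\<integral>t. indicator {0..T} t * (deriv \<phi> t * (z t - z0)) + z0 * (indicator {0..T} t * deriv \<phi> t) \<partial>lborel)"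
  proof (rule integral_cong_AE)
    show "AE t in lborel. indicator {0<..<T} t * (z t * deriv \<phi> t)
        = indicator {0..T} t * (deriv \<phi> t * (z t - z0)) + z0 * (indicator {0..T} t * deriv \<phi> t)"
      using AE_lborel_singleton[of 0] AE_lborel_singleton[of T]
      by eventually_elim (auto simp: indicator_def algebra_simps)
  qed measurable
  also have "\<dots> = (\<integral>t. indicator {0..T} t * (deriv \<phi> t * (z t - z0)) \<partial>lborel) + z0 * (\<integral>t. indicator {0..T} t * deriv \<phi> t \<partial>lborel)"
    using zi ci by simp
  also have "(\<integral>t. indicator {0..T} t * deriv \<phi> t \<partial>lborel) = 0"
    using integral_deriv_test_function[OF \<phi>, of 0] test_functionD(4)[OF \<phi>, of 0] T by simp
  also have "(\<integral>t. indicator {0..T} t * (deriv \<phi> t * (z t - z0)) \<partial>lborel) = (\<integral>t. (\<integral>s. H t s \<partial>lborel) \<partial>lborel)"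
    by (simp add: inner1)
  also have "\<dots> = (\<integral>s. (\<integral>t. H t s \<partial>lborel) \<partial>lborel)"
    by (rule lborel_pair.Fubini_integral[OF H, symmetric])
  also have "\<dots> = - (\<integral>t. indicator {0<..<T} t * (q t * \<phi> t) \<partial>lborel)"
    by (simp add: inner2)
  finally show ?thesis by simp
qed

text \<open>The bound on \<open>f\<close> makes \<open>v\<close> Lipschitz in time, uniformly in \<open>x\<close>, which gives the continuity in \<open>L\<^sup>1\<close>. The weak
  derivative is an integration by parts for each \<open>x\<close>.\<close>

lemma bounded_evolution_is_solution:
  assumes T: "0 < T" and k: "kernel_version B K k" and g: "datum_version M g h"
    and e: "evolution T p k h v f"
    and v: "\<And>x t. t \<in> {0..T} \<Longrightarrow> \<bar>v x t\<bar> \<le> M" and f: "\<And>x t. \<bar>f x t\<bar> \<le> C"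
  shows "is_solution T p K g v"
proof -
  note d = e[unfolded evolution_def]
  have vm [measurable]: "case_prod v \<in> borel_measurable borel_plane" using d by auto
  have fi: "integrable plane (case_prod f)" using d by auto
  then have fm [measurable]: "case_prod f \<in> borel_measurable borel_plane"
    using borel_measurable_integrable[OF fi] by (simp cong: measurable_cong_sets)
  have v_eq: "v x t = h x + (LINT s:{0..t}|lborel. f x s)" if "t \<in> {0..T}" for x t using d that by auto
  have v0: "v x 0 = h x" for x using v_eq[of 0 x] T by simp
  have off: "v x t = 0" if "x \<notin> Omega" "t \<in> {0..T}" for x t
    using d that by (auto simp: set_lebesgue_integral_def)
  have C: "0 \<le> C" using order_trans[OF abs_ge_zero f[of 0 0]] .
  have int_v: "integrable lborel (\<lambda>x. v x t)" if t: "t \<in> {0..T}" for t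
  proof (rule integrable_bounded_Omega(1))
    show "\<bar>v x t\<bar> \<le> M * indicator Omega x" for x using off[of x t] v[OF t, of x] t by (auto simp: indicator_def)
  qed measurable
  have ind_off: "indicator Omega x * v x t = v x t" if "t \<in> {0..T}" for x t
    using off[of x t] that by (auto simp: indicator_def)
  have lip: "\<bar>v x s - v x t\<bar> \<le> C * \<bar>s - t\<bar>" if st: "s \<in> {0..T}" "t \<in> {0..T}" for x s t
  proof -
    have fq: "f x \<in> borel_measurable borel" by measurable
    have *: "\<bar>v x b - v x a\<bar> \<le> C * (b - a)" if ab: "0 \<le> a" "a \<le> b" "b \<le> T" for a b
      using increment_bound[OF fq f ab] v_eq[of a x] v_eq[of b x] ab by simp
    show ?thesis using *[of s t] *[of t s] st by (cases "s \<le> t") (auto simp: abs_minus_commute)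
  qed
  have L1: "L1_continuous T v"
    unfolding L1_continuous_def
  proof (intro conjI ballI)
    fix t assume t: "t \<in> {0..T}"
    have "integrable (lebesgue_on Omega) (\<lambda>x. v x t) \<longleftrightarrow> integrable lborel (\<lambda>x. indicator Omega x * v x t)"
      by (rule lebesgue_on_transfer(2)) auto
    then show "integrable (lebesgue_on Omega) (\<lambda>x. v x t)" using int_v[OF t] ind_off[OF t] by simp
    show "((\<lambda>s. LINT x|lebesgue_on Omega. \<bar>v x s - v x t\<bar>) \<longlongrightarrow> 0) (at t within {0..T})"
    proof (rule Lim_null_comparison)
      show "\<forall>\<^sub>F s in at t within {0..T}. norm (LINT x|lebesgue_on Omega. \<bar>v x s - v x t\<bar>) \<le> C * \<bar>s - t\<bar>"
        unfolding eventually_at_filter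
      proof (intro always_eventually allI impI)
        fix s assume s: "s \<in> {0..T}"
        have "(LINT x|lebesgue_on Omega. \<bar>v x s - v x t\<bar>) = (\<integral>x. indicator Omega x * \<bar>v x s - v x t\<bar> \<partial>lborel)"
          by (rule lebesgue_on_transfer(3)) auto
        moreover have "\<bar>\<integral>x. indicator Omega x * \<bar>v x s - v x t\<bar> \<partial>lborel\<bar> \<le> C * \<bar>s - t\<bar>"
        proof (rule integrable_bounded_Omega(2))
          show "\<bar>indicator Omega x * \<bar>v x s - v x t\<bar>\<bar> \<le> C * \<bar>s - t\<bar> * indicator Omega x" for x
            using lip[OF s t, of x] by (auto simp: indicator_def)
        qed measurable
        ultimately show "norm (LINT x|lebesgue_on Omega. \<bar>v x s - v x t\<bar>) \<le> C * \<bar>s - t\<bar>" by simp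
      qed
      have "((\<lambda>s. C * \<bar>s - t\<bar>) \<longlongrightarrow> C * \<bar>t - t\<bar>) (at t within {0..T})"
        by (intro tendsto_intros)
      then show "((\<lambda>s. C * \<bar>s - t\<bar>) \<longlongrightarrow> 0) (at t within {0..T})" by simp
    qed
  qed
  have initial: "AE x in lebesgue_on Omega. v x 0 = g x"
    using g by (auto simp: datum_version_def AE_lebesgue_on_iff v0 elim!: eventually_mono)
  have law: "AE t in lborel. t \<in> {0<..<T} \<longrightarrow>
        integrable plane (\<lambda>(x, y). k x y * flux p (v y t - v x t)) \<and>
        (AE x in lborel. f x t = (\<integral>y. k x y * flux p (v y t - v x t) \<partial>lborel))"
    using d by auto
  have domain: "AE t in lebesgue_on {0<..<T}. in_p_Laplacian_domain p K (\<lambda>x. v x t)"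
    unfolding AE_lebesgue_on_iff[OF borel_open[OF open_greaterThanLessThan]]
    using law
  proof eventually_elim
    case (elim t)
    then show ?case by (subst p_Laplacian_domain_version[OF k, where v="\<lambda>x. v x t"]) auto
  qed
  have strip: "Omega \<times> {0<..<T} \<in> sets borel"
    unfolding borel_prod[symmetric] by auto
  have deriv: "has_weak_time_derivative T v f"
    unfolding has_weak_time_derivative_def
  proof (intro conjI allI impI)
    have vb: "case_prod v \<in> borel_measurable borel" "case_prod f \<in> borel_measurable borel"
      using vm fm by (simp_all add: borel_prod)
    show "integrable (lebesgue_on (Omega \<times> {0<..<T})) (\<lambda>(x, t). v x t)"
    proof (subst lebesgue_on_transfer(2)[OF strip vb(1)])
      have "integrable lborel (\<lambda>z::real\<times>real. M * indicator (Omega \<times> {0<..<T}) z)"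
      proof (intro integrable_mult_right integrable_real_indicator)
        show "emeasure lborel (Omega \<times> {0<..<T}) < \<infinity>"
          using T unfolding lborel_prod[symmetric]
          by (subst lborel.emeasure_pair_measure_Times) (auto simp: Omega_def)
      qed (use strip in auto)
      then show "integrable lborel (\<lambda>z. indicator (Omega \<times> {0<..<T}) z * case_prod v z)"
      proof (rule Bochner_Integration.integrable_bound)
        show "(\<lambda>z. indicator (Omega \<times> {0<..<T}) z * case_prod v z) \<in> borel_measurable lborel"
          using vb strip by measurable
        have M: "0 \<le> M" using order_trans[OF abs_ge_zero v[of 0 0]] T by auto
        show "AE z in lborel. norm (indicator (Omega \<times> {0<..<T}) z * case_prod v z) \<le> norm (M * indicator (Omega \<times> {0<..<T}) z :: real)"
          using v M by (intro AE_I2) (auto simp: indicator_def)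
      qed
    qed auto
    show "integrable (lebesgue_on (Omega \<times> {0<..<T})) (\<lambda>(x, t). f x t)"
    proof (subst lebesgue_on_transfer(2)[OF strip vb(2)])
      have "integrable lborel (case_prod f)" using fi unfolding lborel_prod .
      then show "integrable lborel (\<lambda>z. indicator (Omega \<times> {0<..<T}) z * case_prod f z)"
        by (rule integrable_bounded_mult[where C=1]) (use strip in \<open>auto simp: indicator_def\<close>)
    qed auto
    fix \<phi> assume \<phi>: "test_function T \<phi>"
    note [measurable] = test_function_measurable[OF \<phi>]
    show "AE x in lebesgue_on Omega. (LINT t|lebesgue_on {0<..<T}. v x t * deriv \<phi> t) =
        - (LINT t|lebesgue_on {0<..<T}. f x t * \<phi> t)"
    proof (rule AE_I2)
      fix x
      have "(LINT t|lebesgue_on {0<..<T}. v x t * deriv \<phi> t) = (\<integral>t. indicator {0<..<T} t * (v x t * deriv \<phi> t) \<partial>lborel)"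
        by (rule lebesgue_on_transfer(3)) auto
      moreover have "(LINT t|lebesgue_on {0<..<T}. f x t * \<phi> t) = (\<integral>t. indicator {0<..<T} t * (f x t * \<phi> t) \<partial>lborel)"
        by (rule lebesgue_on_transfer(3)) auto
      moreover have "(\<integral>t. indicator {0<..<T} t * (v x t * deriv \<phi> t) \<partial>lborel)
          = - (\<integral>t. indicator {0<..<T} t * (f x t * \<phi> t) \<partial>lborel)"
        by (rule primitive_integration_by_parts[OF T _ _ f v_eq \<phi>]) measurable
      ultimately show "(LINT t|lebesgue_on {0<..<T}. v x t * deriv \<phi> t) = - (LINT t|lebesgue_on {0<..<T}. f x t * \<phi> t)"
        by simp
    qed
  qed
  have equation: "AE (x, t) in lebesgue_on (Omega \<times> {0<..<T}). f x t = - p_Laplacian p K (\<lambda>y. v y t) x"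
  proof -
    have km [measurable]: "case_prod k \<in> borel_measurable borel_plane"
      using k by (auto simp: kernel_version_def regular_kernel_def)
    have true: "AE t in lborel. True" by simp
    have "AE t in lborel. AE x in lborel. t \<in> {0<..<T} \<longrightarrow> f x t = (\<integral>y. k x y * flux p (v y t - v x t) \<partial>lborel)"
      using law by eventually_elim (auto elim!: eventually_mono)
    then have "AE x in lborel. AE t in lborel. t \<in> {0<..<T} \<longrightarrow> f x t = (\<integral>y. k x y * flux p (v y t - v x t) \<partial>lborel)"
      by (subst (asm) lborel_pair.AE_commute, measurable)
    then have ae: "AE x in lborel. AE t in lborel. snd (x, t) \<in> {0<..<T} \<longrightarrow> f (fst (x, t)) (snd (x, t))
        = (\<integral>y. k (fst (x, t)) y * flux p (v y (snd (x, t)) - v (fst (x, t)) (snd (x, t))) \<partial>lborel)"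
      by simp
    have "AE z in plane. snd z \<in> {0<..<T} \<longrightarrow>
        f (fst z) (snd z) = (\<integral>y. k (fst z) y * flux p (v y (snd z) - v (fst z) (snd z)) \<partial>lborel)"
      by (rule lborel_pair.AE_pair_measure[OF _ ae]) measurable
    then have "AE z in lborel. snd z \<in> {0<..<T} \<longrightarrow>
        f (fst z) (snd z) = (\<integral>y. k (fst z) y * flux p (v y (snd z) - v (fst z) (snd z)) \<partial>lborel)"
      unfolding lborel_prod .
    then have "AE z in lborel. z \<in> Omega \<times> {0<..<T} \<longrightarrow> (case z of (x, t) \<Rightarrow> f x t = - p_Laplacian p K (\<lambda>y. v y t) x)"
      using AE_pair_product[OF p_Laplacian_version[OF k, of p] true]
    proof eventually_elim
      case (elim z)
      obtain x t where z: "z = (x, t)" by (cases z)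
      have vt: "(\<lambda>y. v y t) \<in> borel_measurable borel" by measurable
      have "- p_Laplacian p K (\<lambda>y. v y t) x = (\<integral>y. k x y * flux p (v y t - v x t) \<partial>lborel)" if "x \<in> Omega"
        by (rule elim(2)[unfolded z fst_conv snd_conv, THEN conjunct1, rule_format, OF that vt]) auto
      then show ?case using elim(1) unfolding z by auto
    qed
    then show ?thesis unfolding AE_lebesgue_on_iff[OF strip] .
  qed
  show ?thesis
    unfolding is_solution_def using L1 initial domain deriv equation by blast
qed

lemma L1_distance_version:
  assumes [measurable]: "U \<in> borel_measurable borel" "W \<in> borel_measurable borel"
    and U: "AE x in lborel. x \<in> Omega \<longrightarrow> u x = U x" "\<And>x. x \<notin> Omega \<Longrightarrow> U x = 0"
    and W: "AE x in lborel. x \<in> Omega \<longrightarrow> w x = W x" "\<And>x. x \<notin> Omega \<Longrightarrow> W x = 0"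
    and i: "integrable (lebesgue_on Omega) u" "integrable (lebesgue_on Omega) w"
  shows "(\<integral>\<^sup>+x. ennreal \<bar>U x - W x\<bar> \<partial>lborel) = ennreal (LINT x|lebesgue_on Omega. \<bar>u x - w x\<bar>)"
proof -
  have eq: "AE x in lborel. x \<in> Omega \<longrightarrow> \<bar>u x - w x\<bar> = \<bar>U x - W x\<bar>"
    using U(1) W(1) by eventually_elim auto
  have ind: "indicator Omega x * \<bar>U x - W x\<bar> = \<bar>U x - W x\<bar>" for x
    using U(2) W(2) by (auto simp: indicator_def)
  have m: "(\<lambda>x. \<bar>U x - W x\<bar>) \<in> borel_measurable borel" by measurable
  have "integrable (lebesgue_on Omega) (\<lambda>x. \<bar>u x - w x\<bar>)" using i by auto
  then have "integrable lborel (\<lambda>x. \<bar>U x - W x\<bar>)"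
    using lebesgue_on_transfer(2)[OF Omega_sets m eq] ind by simp
  then have "(\<integral>\<^sup>+x. ennreal \<bar>U x - W x\<bar> \<partial>lborel) = ennreal (\<integral>x. \<bar>U x - W x\<bar> \<partial>lborel)"
    by (rule nn_integral_eq_integral) auto
  then show ?thesis using lebesgue_on_transfer(3)[OF Omega_sets m eq] ind by simp
qed

text \<open>The Borel functions \<open>U\<close> and \<open>F\<close> agree with \<open>u\<close> and its derivative almost everywhere on the strip, so \<open>U\<close> represents
  \<open>u(\<cdot>, t)\<close> at almost every time only. At a given time \<open>t\<close>, the value is found by \<open>weak_derivative_primitive\<close>, since \<open>u(\<cdot>, s)\<close> tends to
  \<open>u(\<cdot>, t)\<close> in \<open>L\<^sup>1\<close>.\<close>

lemma solution_is_evolution: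
  assumes T: "0 < T" and k: "kernel_version B K k" and g: "datum_version M g h"
    and sol: "is_solution T p K g u"
  shows "\<exists>v f. evolution T p k h v f \<and> (\<forall>t\<in>{0..T}. AE x in lborel. x \<in> Omega \<longrightarrow> u x t = v x t)"
proof -
  have L1: "L1_continuous T u" and init: "AE x in lebesgue_on Omega. u x 0 = g x"
    and dom: "AE t in lebesgue_on {0<..<T}. in_p_Laplacian_domain p K (\<lambda>x. u x t)"
    using sol by (auto simp: is_solution_def)
  obtain u' where weak: "has_weak_time_derivative T u u'"
    and eqn: "AE (x, t) in lebesgue_on (Omega \<times> {0<..<T}). u' x t = - p_Laplacian p K (\<lambda>y. u y t) x"
    using sol by (auto simp: is_solution_def)
  have hm [measurable]: "h \<in> borel_measurable borel" and h_le: "\<And>x. \<bar>h x\<bar> \<le> M * indicator Omega x"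
    and gh: "AE x in lborel. x \<in> Omega \<longrightarrow> g x = h x"
    using g by (auto simp: datum_version_def)
  have h_off: "h x = 0" if "x \<notin> Omega" for x using h_le[of x] that by simp
  have h_int: "integrable lborel h" by (rule integrable_bounded_Omega(1)[OF hm h_le])
  have km [measurable]: "case_prod k \<in> borel_measurable borel_plane" and nk: "regular_kernel B k"
    using k by (auto simp: kernel_version_def regular_kernel_def)
  let ?S = "Omega \<times> {0<..<T}"
  have strip: "?S \<in> sets borel" unfolding borel_prod[symmetric] by auto
  have ui: "integrable (lebesgue_on ?S) (\<lambda>(x, t). u x t)" "integrable (lebesgue_on ?S) (\<lambda>(x, t). u' x t)"
    using weak by (auto simp: has_weak_time_derivative_def)
  have strip_version: "\<exists>W :: real \<Rightarrow> real \<Rightarrow> real. case_prod W \<in> borel_measurable borel_plane \<and>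
      integrable plane (case_prod W) \<and> (\<forall>x t. (x, t) \<notin> ?S \<longrightarrow> W x t = 0) \<and>
      (AE z in lborel. z \<in> ?S \<longrightarrow> case_prod w z = case_prod W z)"
    if w: "integrable (lebesgue_on ?S) (case_prod w)" for w :: "real \<Rightarrow> real \<Rightarrow> real"
  proof -
    obtain W where [measurable]: "W \<in> borel_measurable borel"
      and W: "AE z in lborel. z \<in> ?S \<longrightarrow> case_prod w z = W z" and W0: "\<And>z. z \<notin> ?S \<Longrightarrow> W z = 0"
      using borel_version[OF strip borel_measurable_integrable[OF w]] by blast
    have "integrable lborel (\<lambda>z. indicator ?S z * W z)"
      using w lebesgue_on_transfer(2)[OF strip _ W] by simp
    also have "(\<lambda>z. indicator ?S z * W z) = W"
    proof
      show "indicator ?S z * W z = W z" for z using W0[of z] by (cases "z \<in> ?S") auto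
    qed
    finally have "integrable plane W" unfolding lborel_prod .
    moreover have "W \<in> borel_measurable borel_plane" unfolding borel_prod by measurable
    ultimately show ?thesis using W W0 by (intro exI[of _ "curry W"]) (auto simp: curry_def case_prod_beta')
  qed
  obtain U where Um [measurable]: "case_prod U \<in> borel_measurable borel_plane"
    and Ui: "integrable plane (case_prod U)" and U0: "\<And>x t. (x, t) \<notin> ?S \<Longrightarrow> U x t = 0"
    and uU: "AE z in lborel. z \<in> ?S \<longrightarrow> case_prod u z = case_prod U z"
    using strip_version[of u] ui(1) by auto
  obtain F where Fm [measurable]: "case_prod F \<in> borel_measurable borel_plane"
    and Fi: "integrable plane (case_prod F)" and F0: "\<And>x t. (x, t) \<notin> ?S \<Longrightarrow> F x t = 0"
    and uF: "AE z in lborel. z \<in> ?S \<longrightarrow> case_prod u' z = case_prod F z"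
    using strip_version[of u'] ui(2) by auto
  have ind: "indicator {0<..<T} t * U x t = U x t" "indicator {0<..<T} t * F x t = F x t" for x t
    using U0[of x t] F0[of x t] by (auto simp: indicator_def simp del: greaterThanLessThan_iff)
  have u_int: "integrable (lebesgue_on Omega) (\<lambda>x. u x t)" if "t \<in> {0..T}" for t
    using L1 that by (auto simp: L1_continuous_def)
  have uU_slice: "AE t in lborel. t \<in> {0<..<T} \<longrightarrow> (AE x in lborel. x \<in> Omega \<longrightarrow> u x t = U x t)"
    using AE_pair_both(2)[OF uU] by eventually_elim (auto elim!: eventually_mono)
  have weak_borel: "AE x in lborel. (\<integral>t. U x t * deriv \<phi> t \<partial>lborel) = - (\<integral>t. F x t * \<phi> t \<partial>lborel)"
    if \<phi>: "test_function T \<phi>" for \<phi>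
  proof -
    note [measurable] = test_function_measurable[OF \<phi>]
    have "AE x in lebesgue_on Omega. (LINT t|lebesgue_on {0<..<T}. u x t * deriv \<phi> t) =
           - (LINT t|lebesgue_on {0<..<T}. u' x t * \<phi> t)"
      using weak \<phi> by (simp add: has_weak_time_derivative_def)
    then have "AE x in lborel. x \<in> Omega \<longrightarrow> (LINT t|lebesgue_on {0<..<T}. u x t * deriv \<phi> t) =
           - (LINT t|lebesgue_on {0<..<T}. u' x t * \<phi> t)"
      by (simp add: AE_lebesgue_on_iff)
    then show ?thesis using AE_pair_both(1)[OF uU] AE_pair_both(1)[OF uF]
    proof eventually_elim
      case (elim x)
      show ?case
      proof (cases "x \<in> Omega")
        case True
        have "(LINT t|lebesgue_on {0<..<T}. u x t * deriv \<phi> t) = (\<integral>t. indicator {0<..<T} t * (U x t * deriv \<phi> t) \<partial>lborel)"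
          by (rule lebesgue_on_transfer(3)) (use True elim(2) in \<open>auto elim!: eventually_mono\<close>)
        also have "\<dots> = (\<integral>t. U x t * deriv \<phi> t \<partial>lborel)"
          by (simp add: ind flip: mult.assoc)
        finally have 1: "(LINT t|lebesgue_on {0<..<T}. u x t * deriv \<phi> t) = (\<integral>t. U x t * deriv \<phi> t \<partial>lborel)" .
        have "(LINT t|lebesgue_on {0<..<T}. u' x t * \<phi> t) = (\<integral>t. indicator {0<..<T} t * (F x t * \<phi> t) \<partial>lborel)"
          by (rule lebesgue_on_transfer(3)) (use True elim(3) in \<open>auto elim!: eventually_mono\<close>)
        also have "\<dots> = (\<integral>t. F x t * \<phi> t \<partial>lborel)"
          by (simp add: ind flip: mult.assoc)
        finally show ?thesis using 1 elim(1) True by simp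
      qed (simp add: U0 F0)
    qed
  qed
  have close: "\<exists>\<delta>>0. AE t in lborel. \<bar>t - a\<bar> < \<delta> \<and> t \<noteq> a \<and> t \<in> {0<..<T} \<longrightarrow>
      (\<integral>\<^sup>+x. ennreal \<bar>U x t - w x\<bar> \<partial>lborel) \<le> ennreal e"
    if a: "a \<in> {0..T}" and wm: "w \<in> borel_measurable borel" and uw: "AE x in lborel. x \<in> Omega \<longrightarrow> u x a = w x"
      and w0: "\<And>x. x \<notin> Omega \<Longrightarrow> w x = 0" and e: "0 < e" for a w e
  proof -
    have "((\<lambda>s. LINT x|lebesgue_on Omega. \<bar>u x s - u x a\<bar>) \<longlongrightarrow> 0) (at a within {0..T})"
      using L1 a by (auto simp: L1_continuous_def)
    from order_tendstoD(2)[OF this e]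
    obtain \<delta> where \<delta>: "0 < \<delta>" "\<And>s. s \<in> {0..T} \<Longrightarrow> s \<noteq> a \<Longrightarrow> \<bar>s - a\<bar> < \<delta> \<Longrightarrow>
        (LINT x|lebesgue_on Omega. \<bar>u x s - u x a\<bar>) < e"
      unfolding eventually_at dist_real_def by auto
    have "AE t in lborel. \<bar>t - a\<bar> < \<delta> \<and> t \<noteq> a \<and> t \<in> {0<..<T} \<longrightarrow>
        (\<integral>\<^sup>+x. ennreal \<bar>U x t - w x\<bar> \<partial>lborel) \<le> ennreal e"
      using uU_slice
    proof eventually_elim
      case (elim t)
      show ?case
      proof
        assume t: "\<bar>t - a\<bar> < \<delta> \<and> t \<noteq> a \<and> t \<in> {0<..<T}"
        have "(\<lambda>x. U x t) \<in> borel_measurable borel" by measurable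
        then have "(\<integral>\<^sup>+x. ennreal \<bar>U x t - w x\<bar> \<partial>lborel) = ennreal (LINT x|lebesgue_on Omega. \<bar>u x t - u x a\<bar>)"
          by (rule L1_distance_version[OF _ wm _ _ uw w0 u_int u_int]) (use elim t a U0 in auto)
        also have "\<dots> \<le> ennreal e" using \<delta>(2)[of t] t by (intro ennreal_leI) auto
        finally show "(\<integral>\<^sup>+x. ennreal \<bar>U x t - w x\<bar> \<partial>lborel) \<le> ennreal e" .
      qed
    qed
    then show ?thesis using \<delta>(1) by blast
  qed
  have u0: "AE x in lborel. x \<in> Omega \<longrightarrow> u x 0 = h x"
    using init[unfolded AE_lebesgue_on_iff[OF Omega_sets]] gh by eventually_elim auto
  define v where "v x t = h x + (\<integral>s. (if 0 \<le> s \<and> s \<le> t then 1 else 0) * F x s \<partial>lborel)" for x t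
  have v_eq: "v x t = h x + (LINT s:{0..t}|lborel. F x s)" for x t
    unfolding v_def set_lebesgue_integral_def
    by (auto intro!: Bochner_Integration.integral_cong simp: indicator_def)
  have vm [measurable]: "case_prod v \<in> borel_measurable borel_plane" unfolding v_def by measurable
  have uv: "AE x in lborel. x \<in> Omega \<longrightarrow> u x t = v x t" if t: "t \<in> {0..T}" for t
  proof (cases "t = 0")
    case True
    then show ?thesis using u0 by (simp add: v_eq)
  next
    case False
    with t have t': "0 < t" "t \<le> T" by auto
    obtain w where wm: "w \<in> borel_measurable borel" and uw: "AE x in lborel. x \<in> Omega \<longrightarrow> u x t = w x"
      and w0: "\<And>x. x \<notin> Omega \<Longrightarrow> w x = 0"
      using borel_version[OF Omega_sets borel_measurable_integrable[OF u_int[OF t]]] by blast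
    have "AE x in lborel. w x = h x + (LINT s:{0..t}|lborel. F x s)"
    proof (rule weak_derivative_primitive[OF Ui Fi weak_borel t' hm wm])
      fix e :: real assume e: "0 < e"
      obtain \<delta> where "0 < \<delta>" and \<delta>: "AE s in lborel. \<bar>s - 0\<bar> < \<delta> \<and> s \<noteq> 0 \<and> s \<in> {0<..<T} \<longrightarrow>
          (\<integral>\<^sup>+x. ennreal \<bar>U x s - h x\<bar> \<partial>lborel) \<le> ennreal e"
        using close[OF _ hm u0 h_off e] T by auto
      then show "\<exists>\<delta>>0. AE s in lborel. s \<in> {0<..<\<delta>} \<longrightarrow> (\<integral>\<^sup>+x. ennreal \<bar>U x s - h x\<bar> \<partial>lborel) \<le> ennreal e"
        using T by (intro exI[of _ "min \<delta> T"]) (auto elim!: eventually_mono)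
      obtain \<epsilon> where "0 < \<epsilon>" and \<epsilon>: "AE s in lborel. \<bar>s - t\<bar> < \<epsilon> \<and> s \<noteq> t \<and> s \<in> {0<..<T} \<longrightarrow>
          (\<integral>\<^sup>+x. ennreal \<bar>U x s - w x\<bar> \<partial>lborel) \<le> ennreal e"
        using close[OF t wm uw w0 e] by auto
      then show "\<exists>\<delta>>0. AE s in lborel. s \<in> {t - \<delta><..<t} \<longrightarrow> (\<integral>\<^sup>+x. ennreal \<bar>U x s - w x\<bar> \<partial>lborel) \<le> ennreal e"
        using t' by (intro exI[of _ "min \<epsilon> t"]) (auto elim!: eventually_mono)
    qed
    then show ?thesis using uw by eventually_elim (auto simp: v_eq)
  qed
  have eq_slice: "AE t in lborel. AE x in lborel. (x, t) \<in> ?S \<longrightarrow> u' x t = - p_Laplacian p K (\<lambda>y. u y t) x"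
    using AE_pair_both(2)[OF eqn[unfolded AE_lebesgue_on_iff[OF strip]]] by simp
  have "evolution T p k h v F"
    unfolding evolution_def
  proof (intro conjI allI ballI impI)
    show "AE t in lborel. t \<in> {0<..<T} \<longrightarrow>
        integrable plane (\<lambda>(x, y). k x y * flux p (v y t - v x t)) \<and>
        (AE x in lborel. F x t = (\<integral>y. k x y * flux p (v y t - v x t) \<partial>lborel))"
      using eq_slice AE_pair_both(2)[OF uF]
        dom[unfolded AE_lebesgue_on_iff[OF borel_open[OF open_greaterThanLessThan]]]
    proof eventually_elim
      case (elim t)
      show ?case
      proof
        assume t: "t \<in> {0<..<T}"
        then have t': "t \<in> {0..T}" by auto
        have vt: "(\<lambda>x. v x t) \<in> borel_measurable borel" by measurable
        have "AE x in lborel. F x t = (\<integral>y. k x y * flux p (v y t - v x t) \<partial>lborel)"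
          using elim(1,2) uv[OF t'] p_Laplacian_version[OF k, of p]
        proof eventually_elim
          case (elim x)
          show ?case
          proof (cases "x \<in> Omega")
            case True
            then have "F x t = - p_Laplacian p K (\<lambda>y. u y t) x" "u x t = v x t" using elim t by auto
            then show ?thesis using elim(4)[rule_format, OF True vt uv[OF t']] by simp
          qed (simp add: F0 regular_kernel_off[OF nk])
        qed
        then show "integrable plane (\<lambda>(x, y). k x y * flux p (v y t - v x t)) \<and>
          (AE x in lborel. F x t = (\<integral>y. k x y * flux p (v y t - v x t) \<partial>lborel))"
          using elim(3) t p_Laplacian_domain_version[OF k vt uv[OF t']] by auto
      qed
    qed
  qed (use h_int h_off vm Fi F0 v_eq in auto)
  with uv show ?thesis by blast
qed

section \<open>Existence, uniqueness and stability\<close>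

lemma uniformly_continuous_clamped:
  fixes \<Phi> :: "real \<Rightarrow> real"
  assumes \<Phi>: "continuous_on UNIV \<Phi>" and L: "0 \<le> L"
  shows "uniformly_continuous_on UNIV (\<lambda>s. \<Phi> (max (- L) (min L s)))"
proof -
  have uc: "uniformly_continuous_on {- L..L} \<Phi>"
    by (rule compact_uniformly_continuous) (auto intro: continuous_on_subset[OF \<Phi>])
  show ?thesis
    unfolding uniformly_continuous_on_def
  proof (intro allI impI)
    fix e :: real assume "0 < e"
    then obtain d where d: "0 < d" "\<And>a b. a \<in> {- L..L} \<Longrightarrow> b \<in> {- L..L} \<Longrightarrow> dist b a < d \<Longrightarrow> dist (\<Phi> b) (\<Phi> a) < e"
      using uc unfolding uniformly_continuous_on_def by metis
    have clamp: "dist (max (- L) (min L s')) (max (- L) (min L s)) \<le> dist s' s" for s s' :: real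
      by (auto simp: dist_real_def)
    show "\<exists>d>0. \<forall>s\<in>UNIV. \<forall>s'\<in>UNIV. dist s' s < d \<longrightarrow>
        dist (\<Phi> (max (- L) (min L s'))) (\<Phi> (max (- L) (min L s))) < e"
      using d L by (intro exI[of _ d]) (auto intro!: d(2) le_less_trans[OF clamp])
  qed
qed

text \<open>The truncation \<open>\<psi>\<close> of the flux at \<open>\<plusminus>2M\<close> is bounded and uniformly continuous. The solution for \<open>\<psi>\<close> has values in
  \<open>[-M, M]\<close>, hence differences in \<open>[-2M, 2M]\<close>, where \<open>\<psi>\<close> is the flux itself.\<close>

lemma bounded_evolution_exists:
  assumes T: "0 < T" and p: "1 < p" and k: "regular_kernel B k" and M: "0 \<le> M"
    and hm [measurable]: "h \<in> borel_measurable borel" and h: "\<And>x. \<bar>h x\<bar> \<le> M * indicator Omega x"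
  shows "\<exists>v f C. evolution T p k h v f \<and> (\<forall>x. \<forall>t\<in>{0..T}. \<bar>v x t\<bar> \<le> M) \<and> (\<forall>x t. \<bar>f x t\<bar> \<le> C)"
proof -
  define L where "L = 2 * M"
  define \<psi> where "\<psi> s = flux p (max (- L) (min L s))" for s
  have L: "0 \<le> L" using M by (simp add: L_def)
  have km [measurable]: "case_prod k \<in> borel_measurable borel_plane" and k0: "0 \<le> k x y"
    and kB: "k x y \<le> B * (indicator Omega x * indicator Omega y)" for x y
    using k by (auto simp: regular_kernel_def)
  have B: "0 \<le> B" using k0[of 0 0] kB[of 0 0] by (simp add: Omega_def)
  interpret bounded_flux k \<psi> B "L powr (p - 1)"
  proof
    show "k x y \<le> B * indicator Omega y" for x y
      by (rule order_trans[OF kB]) (use B in \<open>auto simp: indicator_def\<close>)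
    show "mono \<psi>" unfolding \<psi>_def by (intro monoI monoD[OF flux_mono[OF p]]) auto
    show "\<bar>\<psi> s\<bar> \<le> L powr (p - 1)" for s unfolding \<psi>_def by (rule abs_flux_le[OF p]) (use L in auto)
    show "uniformly_continuous_on UNIV \<psi>" unfolding \<psi>_def
      by (rule uniformly_continuous_clamped[OF continuous_flux[OF p] L])
    show "\<psi> 0 = 0" using L by (simp add: \<psi>_def)
  qed (use k0 in auto)
  have hM: "\<bar>h x\<bar> \<le> M" for x using h[of x] M by (cases "x \<in> Omega") auto
  have h_off: "h x = 0" if "x \<notin> Omega" for x using h[of x] that by simp
  obtain v where vm [measurable]: "case_prod v \<in> borel_measurable borel_plane"
    and v_eq: "\<And>x t. t \<in> {0..T} \<Longrightarrow> v x t = h x + (LINT s:{0..t}|lborel. net_flux (\<lambda>y. v y s) x)"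
    and vM: "\<And>x t. t \<in> {0..T} \<Longrightarrow> \<bar>v x t\<bar> \<le> M"
    using integral_solution_exists[OF less_imp_le[OF T] hm hM] by blast
  define f where "f x t = indicator {0..T} t * net_flux (\<lambda>y. v y t) x" for x t
  have fm [measurable]: "case_prod f \<in> borel_measurable borel_plane"
    unfolding f_def by measurable
  define C where "C = B * L powr (p - 1)"
  have C: "0 \<le> C" using B by (simp add: C_def)
  have fC: "\<bar>f x t\<bar> \<le> C" for x t
  proof -
    have "\<bar>net_flux (\<lambda>y. v y t) x\<bar> \<le> C" unfolding C_def by (rule net_flux_bound) measurable
    then show ?thesis using C by (auto simp: f_def indicator_def)
  qed
  have f_off: "f x t = 0" if "x \<notin> Omega" for x t
    using regular_kernel_off[OF k] that by (simp add: f_def net_flux_def)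
  have fi: "integrable plane (case_prod f)"
  proof (rule integrableI_bounded_set[where A="Omega \<times> {0..T}" and B=C])
    show "emeasure plane (Omega \<times> {0..T}) < \<infinity>"
      using T by (subst lborel.emeasure_pair_measure_Times) (auto simp: Omega_def ennreal_mult_less_top)
    show "AE z in plane. z \<in> Omega \<times> {0..T} \<longrightarrow> norm (case_prod f z) \<le> C"
      using fC by (auto intro!: AE_I2)
    have "case_prod f z = 0" if "z \<notin> Omega \<times> {0..T}" for z
    proof (cases z)
      case (Pair x t)
      then show ?thesis using that f_off[of x t] by (cases "t \<in> {0..T}") (auto simp: f_def)
    qed
    then show "AE z in plane. z \<notin> Omega \<times> {0..T} \<longrightarrow> case_prod f z = 0"
      by (intro AE_I2 impI)
  qed auto
  have net_flux_eq: "net_flux (\<lambda>y. v y t) x = (\<integral>y. k x y * flux p (v y t - v x t) \<partial>lborel)" if t: "t \<in> {0..T}" for x t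
  proof -
    have "\<psi> (v y t - v x t) = flux p (v y t - v x t)" for y
    proof -
      have "\<bar>v y t - v x t\<bar> \<le> L" unfolding L_def using vM[OF t, of x] vM[OF t, of y] by linarith
      then have "max (- L) (min L (v y t - v x t)) = v y t - v x t" by auto
      then show ?thesis by (simp add: \<psi>_def)
    qed
    then show ?thesis by (simp add: net_flux_def)
  qed
  have "evolution T p k h v f"
    unfolding evolution_def
  proof (intro conjI allI ballI impI AE_I2)
    show "integrable lborel h" by (rule integrable_bounded_Omega(1)[OF hm h])
    fix x t :: real assume t: "t \<in> {0..T}"
    have "(LINT s:{0..t}|lborel. net_flux (\<lambda>y. v y s) x) = (LINT s:{0..t}|lborel. f x s)"
      by (rule set_lebesgue_integral_cong) (use t in \<open>auto simp: f_def\<close>)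
    then show "v x t = h x + (LINT s:{0..t}|lborel. f x s)" using v_eq[OF t] by simp
  next
    fix t assume t: "t \<in> {0<..<T}"
    show "integrable plane (\<lambda>(x, y). k x y * flux p (v y t - v x t))"
    proof (rule flux_integrable[OF k])
      show "\<bar>flux p (v y t - v x t)\<bar> \<le> L powr (p - 1)" for x y
        using vM[of t x] vM[of t y] t by (intro abs_flux_le[OF p]) (auto simp: L_def)
    qed measurable
    show "f x t = (\<integral>y. k x y * flux p (v y t - v x t) \<partial>lborel)" for x
      using net_flux_eq[of t x] t by (simp add: f_def)
  qed (use h_off f_off fi vm in auto)
  with vM fC show ?thesis by blast
qed

text \<open>Uniqueness transfers the bound on the constructed solution to every solution.\<close>

lemma bounded_solution:
  assumes T: "0 < T" and p: "1 < p" and k: "kernel_version B K k" and g: "datum_version M g h" and M: "0 \<le> M"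
  shows "\<exists>v f. evolution T p k h v f \<and> (\<forall>x. \<forall>t\<in>{0..T}. \<bar>v x t\<bar> \<le> M) \<and> is_solution T p K g v \<and>
    (\<forall>w. is_solution T p K g w \<longrightarrow> (\<forall>t\<in>{0..T}. AE x in lborel. x \<in> Omega \<longrightarrow> w x t = v x t))"
proof -
  have nk: "regular_kernel B k" using k by (simp add: kernel_version_def)
  have h: "h \<in> borel_measurable borel" "\<And>x. \<bar>h x\<bar> \<le> M * indicator Omega x"
    using g by (auto simp: datum_version_def)
  obtain v f C where e: "evolution T p k h v f" and vM: "\<And>x t. t \<in> {0..T} \<Longrightarrow> \<bar>v x t\<bar> \<le> M"
    and fC: "\<And>x t. \<bar>f x t\<bar> \<le> C"
    using bounded_evolution_exists[OF T p nk M h] by blast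
  have uniq: "AE x in lborel. x \<in> Omega \<longrightarrow> w x t = v x t" if w: "is_solution T p K g w" and t: "t \<in> {0..T}" for w t
  proof -
    obtain v' f' where e': "evolution T p k h v' f'"
      and wv: "\<forall>t\<in>{0..T}. AE x in lborel. x \<in> Omega \<longrightarrow> w x t = v' x t"
      using solution_is_evolution[OF T k g w] by blast
    show ?thesis
      using evolution_unique[OF p T nk e' e t] bspec[OF wv t] by eventually_elim auto
  qed
  have "is_solution T p K g v"
    by (rule bounded_evolution_is_solution[OF T k g e vM fC])
  with e vM uniq show ?thesis by blast
qed

lemma Lp_norm_eq_integral:
  assumes "integrable M (\<lambda>x. \<bar>f x\<bar> powr p)"
  shows "Lp_norm p M f = ennreal ((LINT x|M. \<bar>f x\<bar> powr p) powr (1 / p))"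
proof -
  have "(\<integral>\<^sup>+x. ennreal (\<bar>f x\<bar> powr p) \<partial>M) = ennreal (LINT x|M. \<bar>f x\<bar> powr p)"
    by (rule nn_integral_eq_integral[OF assms]) auto
  moreover have "0 \<le> (LINT x|M. \<bar>f x\<bar> powr p)" by (intro integral_nonneg_AE) auto
  ultimately show ?thesis by (simp add: Lp_norm_def)
qed

lemma Lp_norm_version:
  fixes f g :: "'a::euclidean_space \<Rightarrow> real"
  assumes S: "S \<in> sets borel" and [measurable]: "g \<in> borel_measurable borel"
    and eq: "AE x in lborel. x \<in> S \<longrightarrow> f x = g x" and off: "\<And>x. x \<notin> S \<Longrightarrow> g x = 0"
    and int: "integrable lborel (\<lambda>x. \<bar>g x\<bar> powr p)"
  shows "Lp_norm p (lebesgue_on S) f = ennreal ((\<integral>x. \<bar>g x\<bar> powr p \<partial>lborel) powr (1 / p))"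
proof -
  have ae: "AE x in lborel. x \<in> S \<longrightarrow> \<bar>f x\<bar> powr p = \<bar>g x\<bar> powr p"
    using eq by eventually_elim auto
  have m: "(\<lambda>x. \<bar>g x\<bar> powr p) \<in> borel_measurable borel" by measurable
  have ind: "indicator S x * \<bar>g x\<bar> powr p = \<bar>g x\<bar> powr p" for x
    using off[of x] by (auto simp: indicator_def)
  show ?thesis
    using lebesgue_on_transfer(2,3)[OF S m ae] int
    by (simp add: Lp_norm_eq_integral ind)
qed

lemma Lp_norm_tendsto_0:
  assumes p: "0 < p" and fin: "emeasure M (space M) < \<infinity>"
    and [measurable]: "\<And>n. f n \<in> borel_measurable M"
    and bound: "\<And>n. AE x in M. \<bar>f n x\<bar> \<le> C" and lim: "AE x in M. (\<lambda>n. f n x) \<longlonglongrightarrow> 0"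
  shows "(\<lambda>n. Lp_norm p M (f n)) \<longlonglongrightarrow> 0"
proof -
  interpret finite_measure M by (rule finite_measureI) (rule less_imp_neq[OF fin])
  have c: "integrable M (\<lambda>x. \<bar>C\<bar> powr p)" by simp
  have le: "AE x in M. norm (\<bar>f n x\<bar> powr p) \<le> \<bar>C\<bar> powr p" for n
    using bound[of n] by eventually_elim (use p in \<open>auto intro!: powr_mono2\<close>)
  have int: "integrable M (\<lambda>x. \<bar>f n x\<bar> powr p)" for n
    by (rule Bochner_Integration.integrable_bound[OF c]) (use le[of n] in auto)
  have "(\<lambda>n. LINT x|M. \<bar>f n x\<bar> powr p) \<longlonglongrightarrow> (LINT x|M. 0)"
  proof (rule integral_dominated_convergence[OF _ _ c _ le])
    show "AE x in M. (\<lambda>n. \<bar>f n x\<bar> powr p) \<longlonglongrightarrow> 0"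
      using lim
    proof eventually_elim
      case (elim x)
      then have "(\<lambda>n. \<bar>f n x\<bar> powr p) \<longlonglongrightarrow> 0 powr p"
        using p by (intro tendsto_powr') (auto intro: tendsto_rabs_zero)
      then show ?case by simp
    qed
  qed measurable
  then have "(\<lambda>n. (LINT x|M. \<bar>f n x\<bar> powr p) powr (1 / p)) \<longlonglongrightarrow> 0 powr (1 / p)"
    using p by (intro tendsto_powr') (auto intro!: always_eventually integral_nonneg_AE)
  from tendsto_ennrealI[OF this] show ?thesis by (simp add: Lp_norm_eq_integral[OF int])
qed

lemma powr_subadditive_bound:
  fixes y a b D p :: real
  assumes p: "0 < p" and ab: "0 \<le> a" "0 \<le> b" and y: "0 \<le> y" "y \<le> 2 * a + D * b"
  shows "y powr (1 / p) \<le> (2 * max 2 D) powr (1 / p) * (a powr (1 / p) + b powr (1 / p))"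
proof -
  have "2 * a + D * b \<le> max 2 D * max a b + max 2 D * max a b"
    using ab by (intro add_mono mult_mono) auto
  also have "\<dots> = 2 * max 2 D * max a b" by simp
  finally have "y powr (1 / p) \<le> (2 * max 2 D * max a b) powr (1 / p)"
    using y p by (intro powr_mono2) auto
  also have "\<dots> = (2 * max 2 D) powr (1 / p) * (max a b) powr (1 / p)"
    by (rule powr_mult)
  also have "\<dots> \<le> (2 * max 2 D) powr (1 / p) * (a powr (1 / p) + b powr (1 / p))"
    by (intro mult_left_mono) (auto simp: max_def)
  finally show ?thesis .
qed

text \<open>The constant involves the bound on the first datum only, so that it is uniform when the second problem
  varies.\<close>

lemma Lp_stability:
  assumes T: "0 < T" and p: "1 < p"
    and k1: "kernel_version B1 K1 k1" and g1: "datum_version M1 g1 h1" and M1: "0 \<le> M1"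
    and k2: "kernel_version B2 K2 k2" and g2: "datum_version M2 g2 h2" and M2: "0 \<le> M2"
    and u1: "is_solution T p K1 g1 u1" and u2: "is_solution T p K2 g2 u2"
  shows "C_Lp_norm T p (\<lambda>x t. u1 x t - u2 x t)
    \<le> ennreal ((2 * max 2 (stability_const T p M1)) powr (1 / p)) *
        (Lp_norm p (lebesgue_on Omega) (\<lambda>x. g1 x - g2 x) + Lp_norm p (lebesgue_on (Omega \<times> Omega)) (\<lambda>z. K1 z - K2 z))"
proof -
  obtain v1 f1 where e1: "evolution T p k1 h1 v1 f1" and vM1: "\<forall>x. \<forall>t\<in>{0..T}. \<bar>v1 x t\<bar> \<le> M1"
    and uvs1: "\<forall>w. is_solution T p K1 g1 w \<longrightarrow> (\<forall>t\<in>{0..T}. AE x in lborel. x \<in> Omega \<longrightarrow> w x t = v1 x t)"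
    using bounded_solution[OF T p k1 g1 M1] by blast
  have v1: "\<bar>v1 x t\<bar> \<le> M1" if "t \<in> {0..T}" for x t using vM1 that by blast
  have uv1: "AE x in lborel. x \<in> Omega \<longrightarrow> u1 x t = v1 x t" if "t \<in> {0..T}" for t
    using uvs1 u1 that by blast
  obtain v2 f2 where e2: "evolution T p k2 h2 v2 f2" and vM2: "\<forall>x. \<forall>t\<in>{0..T}. \<bar>v2 x t\<bar> \<le> M2"
    and uvs2: "\<forall>w. is_solution T p K2 g2 w \<longrightarrow> (\<forall>t\<in>{0..T}. AE x in lborel. x \<in> Omega \<longrightarrow> w x t = v2 x t)"
    using bounded_solution[OF T p k2 g2 M2] by blast
  have v2: "\<bar>v2 x t\<bar> \<le> M2" if "t \<in> {0..T}" for x t using vM2 that by blast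
  have uv2: "AE x in lborel. x \<in> Omega \<longrightarrow> u2 x t = v2 x t" if "t \<in> {0..T}" for t
    using uvs2 u2 that by blast
  have nk: "regular_kernel B1 k1" "regular_kernel B2 k2" using k1 k2 by (auto simp: kernel_version_def)
  have [measurable]: "case_prod k1 \<in> borel_measurable borel_plane" "case_prod k2 \<in> borel_measurable borel_plane"
    using nk by (auto simp: regular_kernel_def)
  have hm [measurable]: "h1 \<in> borel_measurable borel" "h2 \<in> borel_measurable borel"
    and h: "\<And>x. \<bar>h1 x\<bar> \<le> M1 * indicator Omega x" "\<And>x. \<bar>h2 x\<bar> \<le> M2 * indicator Omega x"
    and gh: "AE x in lborel. x \<in> Omega \<longrightarrow> g1 x = h1 x" "AE x in lborel. x \<in> Omega \<longrightarrow> g2 x = h2 x"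
    using g1 g2 by (auto simp: datum_version_def)
  have [measurable]: "case_prod v1 \<in> borel_measurable borel_plane" "case_prod v2 \<in> borel_measurable borel_plane"
    using e1 e2 by (auto simp: evolution_def)
  define a where "a = (\<integral>x. \<bar>h1 x - h2 x\<bar> powr p \<partial>lborel)"
  define b where "b = (\<integral>(x, y). \<bar>k1 x y - k2 x y\<bar> powr p \<partial>plane)"
  have powr_int: "integrable lborel (\<lambda>x. \<bar>w1 x - w2 x\<bar> powr p)"
    if [measurable]: "w1 \<in> borel_measurable borel" "w2 \<in> borel_measurable borel"
      and w: "\<And>x. \<bar>w1 x\<bar> \<le> M1" "\<And>x. \<bar>w2 x\<bar> \<le> M2" and off: "\<And>x. x \<notin> Omega \<Longrightarrow> w1 x = 0 \<and> w2 x = 0" for w1 w2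
  proof (rule integrable_bounded_Omega(1)[where C="(M1 + M2) powr p"])
    show "\<bar>\<bar>w1 x - w2 x\<bar> powr p\<bar> \<le> (M1 + M2) powr p * indicator Omega x" for x
      using off[of x] w(1)[of x] w(2)[of x] p by (cases "x \<in> Omega") (auto intro!: powr_mono2)
  qed measurable
  have datum: "Lp_norm p (lebesgue_on Omega) (\<lambda>x. g1 x - g2 x) = ennreal (a powr (1 / p))"
    unfolding a_def
  proof (rule Lp_norm_version)
    show "AE x in lborel. x \<in> Omega \<longrightarrow> g1 x - g2 x = h1 x - h2 x" using gh by eventually_elim auto
    show "h1 x - h2 x = 0" if "x \<notin> Omega" for x using h(1)[of x] h(2)[of x] that by simp
    show "integrable lborel (\<lambda>x. \<bar>h1 x - h2 x\<bar> powr p)"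
    proof (rule powr_int[OF hm])
      show "\<bar>h1 x\<bar> \<le> M1" "\<bar>h2 x\<bar> \<le> M2" for x
        using h(1)[of x] h(2)[of x] M1 M2 by (cases "x \<in> Omega"; simp)+
      show "h1 x = 0 \<and> h2 x = 0" if "x \<notin> Omega" for x using h(1)[of x] h(2)[of x] that by simp
    qed
  qed auto
  have kernel: "Lp_norm p (lebesgue_on (Omega \<times> Omega)) (\<lambda>z. K1 z - K2 z) = ennreal (b powr (1 / p))"
  proof -
    have "Lp_norm p (lebesgue_on (Omega \<times> Omega)) (\<lambda>z. K1 z - K2 z)
        = ennreal ((\<integral>z. \<bar>case_prod k1 z - case_prod k2 z\<bar> powr p \<partial>lborel) powr (1 / p))"
    proof (rule Lp_norm_version[OF Omega_square_sets])
      have "(\<lambda>z. case_prod k1 z - case_prod k2 z) \<in> borel_measurable borel_plane" by measurable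
      then show "(\<lambda>z. case_prod k1 z - case_prod k2 z) \<in> borel_measurable borel" by (simp add: borel_prod)
      show "AE z in lborel. z \<in> Omega \<times> Omega \<longrightarrow> K1 z - K2 z = case_prod k1 z - case_prod k2 z"
        using conjunct2[OF k1[unfolded kernel_version_def]] conjunct2[OF k2[unfolded kernel_version_def]]
        by eventually_elim auto
      show "case_prod k1 z - case_prod k2 z = 0" if "z \<notin> Omega \<times> Omega" for z
        using that regular_kernel_off[OF nk(1), of "fst z" "snd z"] regular_kernel_off[OF nk(2), of "fst z" "snd z"]
        by (cases z) auto
      show "integrable lborel (\<lambda>z. \<bar>case_prod k1 z - case_prod k2 z\<bar> powr p)"
        using kernel_powr_integrable[OF _ nk, of p] p unfolding lborel_prod by (simp add: case_prod_beta')
    qed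
    then show ?thesis unfolding b_def lborel_prod by (simp add: case_prod_beta')
  qed
  have ab: "0 \<le> a" "0 \<le> b" unfolding a_def b_def by (auto intro!: integral_nonneg_AE)
  show ?thesis
    unfolding C_Lp_norm_def
  proof (rule SUP_least)
    fix t assume t: "t \<in> {0..T}"
    have off: "v1 x t = 0 \<and> v2 x t = 0" if "x \<notin> Omega" for x
      using e1 e2 t that by (auto simp: evolution_def set_lebesgue_integral_def)
    define y where "y = (\<integral>x. \<bar>v1 x t - v2 x t\<bar> powr p \<partial>lborel)"
    have "Lp_norm p (lebesgue_on Omega) (\<lambda>x. u1 x t - u2 x t) = ennreal (y powr (1 / p))"
      unfolding y_def
    proof (rule Lp_norm_version)
      show "AE x in lborel. x \<in> Omega \<longrightarrow> u1 x t - u2 x t = v1 x t - v2 x t"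
        using uv1[OF t] uv2[OF t] by eventually_elim auto
      show "v1 x t - v2 x t = 0" if "x \<notin> Omega" for x using off[OF that] by simp
      show "integrable lborel (\<lambda>x. \<bar>v1 x t - v2 x t\<bar> powr p)"
        by (rule powr_int) (use v1[OF t] v2[OF t] off in auto)
    qed auto
    also have "\<dots> \<le> ennreal ((2 * max 2 (stability_const T p M1)) powr (1 / p) * (a powr (1 / p) + b powr (1 / p)))"
    proof (intro ennreal_leI powr_subadditive_bound[OF _ ab])
      show "y \<le> 2 * a + stability_const T p M1 * b"
        unfolding y_def a_def b_def by (rule evolution_Lp_estimate[OF p T nk e1 e2 v1 v2 t])
    qed (use p in \<open>auto simp: y_def intro!: integral_nonneg_AE\<close>)
    finally show "Lp_norm p (lebesgue_on Omega) (\<lambda>x. u1 x t - u2 x t)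
        \<le> ennreal ((2 * max 2 (stability_const T p M1)) powr (1 / p)) *
        (Lp_norm p (lebesgue_on Omega) (\<lambda>x. g1 x - g2 x) + Lp_norm p (lebesgue_on (Omega \<times> Omega)) (\<lambda>z. K1 z - K2 z))"
      unfolding datum kernel by (simp add: ennreal_mult flip: ennreal_plus)
  qed
qed

theorem theorem4p1:
  fixes T p :: real
    and g :: "real \<Rightarrow> real" and gn :: "nat \<Rightarrow> real \<Rightarrow> real"
    and K :: "real \<times> real \<Rightarrow> real" and Kn :: "nat \<Rightarrow> real \<times> real \<Rightarrow> real"
  assumes "T > 0" and "p > 1"
    and "g \<in> Linfty (lebesgue_on Omega)"
    and "\<And>n. gn n \<in> Linfty (lebesgue_on Omega)"
    and "symmetric_kernel K"
    and "\<And>n. symmetric_kernel (Kn n)"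
  shows "has_unique_solution T p K g \<and>
    (\<forall>n. has_unique_solution T p (Kn n) (gn n)) \<and>
    (\<forall>u un. is_solution T p K g u \<and> (\<forall>n. is_solution T p (Kn n) (gn n) (un n)) \<longrightarrow>
      (\<exists>C::real. C \<ge> 0 \<and>
        (\<forall>n. C_Lp_norm T p (\<lambda>x t. u x t - un n x t)
             \<le> ennreal C * (Lp_norm p (lebesgue_on Omega) (\<lambda>x. g x - gn n x)
                 + Lp_norm p (lebesgue_on (Omega \<times> Omega)) (\<lambda>z. K z - Kn n z)))) \<and>
      ((\<exists>B. \<forall>n. AE x in lebesgue_on Omega. \<bar>gn n x\<bar> \<le> B) \<and>
       (\<exists>B. \<forall>n. AE z in lebesgue_on (Omega \<times> Omega). \<bar>Kn n z\<bar> \<le> B) \<and>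
       (AE x in lebesgue_on Omega. (\<lambda>n. gn n x) \<longlonglongrightarrow> g x) \<and>
       (AE z in lebesgue_on (Omega \<times> Omega). (\<lambda>n. Kn n z) \<longlonglongrightarrow> K z) \<longrightarrow>
       (\<lambda>n. C_Lp_norm T p (\<lambda>x t. u x t - un n x t)) \<longlonglongrightarrow> 0))"
proof -
  note T = assms(1) and p = assms(2)
  have unique: "has_unique_solution T p k h" if k: "symmetric_kernel k" and h: "h \<in> Linfty (lebesgue_on Omega)" for k h
  proof -
    obtain B k' where k': "kernel_version B k k'" using ex_kernel_version[OF k] by blast
    obtain M h' where h': "0 \<le> M" "datum_version M h h'" using ex_datum_version[OF h] by blast
    show ?thesis
      using bounded_solution[OF T p k' h'(2,1)] unfolding has_unique_solution_def AE_lebesgue_on_iff[OF Omega_sets]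
      by blast
  qed
  obtain B k where k: "kernel_version B K k" using ex_kernel_version[OF assms(5)] by blast
  obtain M h where h: "0 \<le> M" "datum_version M g h" using ex_datum_version[OF assms(3)] by blast
  \<comment> \<open>This number depends on \<open>T\<close>, \<open>p\<close> and the bound of \<open>g\<close>, hence it serves for all \<open>n\<close>.\<close>
  define C where "C = (2 * max 2 (stability_const T p M)) powr (1 / p)"
  define err where "err n = Lp_norm p (lebesgue_on Omega) (\<lambda>x. g x - gn n x)
                 + Lp_norm p (lebesgue_on (Omega \<times> Omega)) (\<lambda>z. K z - Kn n z)" for n
  have estimate: "C_Lp_norm T p (\<lambda>x t. u x t - un n x t) \<le> ennreal C * err n"
    if u: "is_solution T p K g u" and un: "\<And>n. is_solution T p (Kn n) (gn n) (un n)" for u un n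
  proof -
    obtain B' k' where k': "kernel_version B' (Kn n) k'" using ex_kernel_version[OF assms(6)] by blast
    obtain M' h' where h': "0 \<le> M'" "datum_version M' (gn n) h'" using ex_datum_version[OF assms(4)] by blast
    show ?thesis unfolding C_def err_def
      by (rule Lp_stability[OF T p k h(2,1) k' h'(2,1) u un])
  qed
  have vanish: "(\<lambda>n. C_Lp_norm T p (\<lambda>x t. u x t - un n x t)) \<longlonglongrightarrow> 0"
    if u: "is_solution T p K g u" and un: "\<And>n. is_solution T p (Kn n) (gn n) (un n)"
      and Bg: "\<And>n. AE x in lebesgue_on Omega. \<bar>gn n x\<bar> \<le> Bg"
      and BK: "\<And>n. AE z in lebesgue_on (Omega \<times> Omega). \<bar>Kn n z\<bar> \<le> BK"
      and lg: "AE x in lebesgue_on Omega. (\<lambda>n. gn n x) \<longlonglongrightarrow> g x"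
      and lK: "AE z in lebesgue_on (Omega \<times> Omega). (\<lambda>n. Kn n z) \<longlonglongrightarrow> K z" for u un Bg BK
  proof -
    have gm [measurable]: "g \<in> borel_measurable (lebesgue_on Omega)" "\<And>n. gn n \<in> borel_measurable (lebesgue_on Omega)"
      using assms(3,4) by (auto simp: Linfty_def)
    have Km [measurable]: "K \<in> borel_measurable (lebesgue_on (Omega \<times> Omega))"
        "\<And>n. Kn n \<in> borel_measurable (lebesgue_on (Omega \<times> Omega))"
      using assms(5,6) by (auto simp: symmetric_kernel_def)
    obtain Cg where Cg: "AE x in lebesgue_on Omega. \<bar>g x\<bar> \<le> Cg" using assms(3) by (auto simp: Linfty_def)
    have "bounded (K ` (Omega \<times> Omega))" using assms(5) by (simp add: symmetric_kernel_def)
    then obtain CK where CK: "\<forall>z\<in>Omega \<times> Omega. \<bar>K z\<bar> \<le> CK" unfolding bounded_iff by auto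
    have diff_0: "(\<lambda>n. c - w n) \<longlonglongrightarrow> 0" if "w \<longlonglongrightarrow> c" for w and c :: real
      using tendsto_diff[OF tendsto_const that, of c] by simp
    have "(\<lambda>n. Lp_norm p (lebesgue_on Omega) (\<lambda>x. g x - gn n x)) \<longlonglongrightarrow> 0"
    proof (rule Lp_norm_tendsto_0[where C="Cg + Bg"])
      show "AE x in lebesgue_on Omega. \<bar>g x - gn n x\<bar> \<le> Cg + Bg" for n
        using Cg Bg[of n] by eventually_elim auto
      show "AE x in lebesgue_on Omega. (\<lambda>n. g x - gn n x) \<longlonglongrightarrow> 0"
        using lg by eventually_elim (rule diff_0)
      show "emeasure (lebesgue_on Omega) (space (lebesgue_on Omega)) < \<infinity>"
        by (simp add: space_restrict_space emeasure_restrict_space Omega_def)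
    qed (use p in auto)
    moreover have "(\<lambda>n. Lp_norm p (lebesgue_on (Omega \<times> Omega)) (\<lambda>z. K z - Kn n z)) \<longlonglongrightarrow> 0"
    proof (rule Lp_norm_tendsto_0[where C="CK + BK"])
      have K': "AE z in lebesgue_on (Omega \<times> Omega). \<bar>K z\<bar> \<le> CK"
        using CK by (intro AE_I2) (auto simp: space_restrict_space)
      show "AE z in lebesgue_on (Omega \<times> Omega). \<bar>K z - Kn n z\<bar> \<le> CK + BK" for n
        using K' BK[of n] by eventually_elim auto
      show "AE z in lebesgue_on (Omega \<times> Omega). (\<lambda>n. K z - Kn n z) \<longlonglongrightarrow> 0"
        using lK by eventually_elim (rule diff_0)
      have "emeasure lborel (Omega \<times> Omega) < \<infinity>"
        unfolding lborel_prod[symmetric]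
        by (subst lborel.emeasure_pair_measure_Times) (auto simp: Omega_def)
      then show "emeasure (lebesgue_on (Omega \<times> Omega)) (space (lebesgue_on (Omega \<times> Omega))) < \<infinity>"
        using Omega_square_sets by (simp add: space_restrict_space emeasure_restrict_space)
    qed (use p in auto)
    ultimately have "(\<lambda>n. ennreal C * err n) \<longlonglongrightarrow> ennreal C * (0 + 0)"
      unfolding err_def by (intro ennreal_tendsto_cmult tendsto_add) auto
    then have lim: "(\<lambda>n. ennreal C * err n) \<longlonglongrightarrow> 0" by simp
    show ?thesis
    proof (rule tendsto_sandwich[OF _ _ tendsto_const lim])
      show "\<forall>\<^sub>F n in sequentially. C_Lp_norm T p (\<lambda>x t. u x t - un n x t) \<le> ennreal C * err n"
        by (intro always_eventually allI estimate u un)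
    qed simp
  qed
  show ?thesis
  proof (intro conjI allI impI)
    show "has_unique_solution T p K g" by (rule unique[OF assms(5,3)])
    show "has_unique_solution T p (Kn n) (gn n)" for n by (rule unique[OF assms(6,4)])
  next
    fix u un assume *: "is_solution T p K g u \<and> (\<forall>n. is_solution T p (Kn n) (gn n) (un n))"
    show "\<exists>C::real. C \<ge> 0 \<and>
        (\<forall>n. C_Lp_norm T p (\<lambda>x t. u x t - un n x t)
             \<le> ennreal C * (Lp_norm p (lebesgue_on Omega) (\<lambda>x. g x - gn n x)
                 + Lp_norm p (lebesgue_on (Omega \<times> Omega)) (\<lambda>z. K z - Kn n z)))"
      using estimate[of u un] * by (intro exI[of _ C]) (auto simp: C_def err_def)
  next
    fix u un
    assume "is_solution T p K g u \<and> (\<forall>n. is_solution T p (Kn n) (gn n) (un n))"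
      and "(\<exists>B. \<forall>n. AE x in lebesgue_on Omega. \<bar>gn n x\<bar> \<le> B) \<and>
       (\<exists>B. \<forall>n. AE z in lebesgue_on (Omega \<times> Omega). \<bar>Kn n z\<bar> \<le> B) \<and>
       (AE x in lebesgue_on Omega. (\<lambda>n. gn n x) \<longlonglongrightarrow> g x) \<and>
       (AE z in lebesgue_on (Omega \<times> Omega). (\<lambda>n. Kn n z) \<longlonglongrightarrow> K z)"
    then show "(\<lambda>n. C_Lp_norm T p (\<lambda>x t. u x t - un n x t)) \<longlonglongrightarrow> 0"
      using vanish[of u un] by blast
  qed
qed

end
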